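(* Let $\mathfrak h\subseteq\Phi^+$ be a Hessenberg set. Then for every $x\in W$ there exists a flow-up class at $x$ in $H_T^*(\mathfrak h)$, and the GKM ring $H_T^*(\mathfrak h)$ has a basis (as a free $\mathbb R[\alpha_1,\dots,\alpha_k]$-module) consisting of flow-up classes, one at each $x\in W$.
   Context: Let $V$ be a finite-dimensional real vector space with a symmetric positive definite bilinear form; for nonzero $\alpha$, $s_\alpha$ is the orthogonal reflection through $\alpha$. Let $\Phi\subset V$ be a crystallographic root system with base $\Delta=\{\alpha_1,\dots,\alpha_k\}$, positive roots $\Phi^+$, $\Phi^-=-\Phi^+$, and Weyl group $W$ (generated by $s_{\alpha_i}$), acting on $\mathbb R[\Delta]=\mathbb R[\alpha_1,\dots,\alpha_k]$. Write $\alpha\prec\beta$ if $\beta-\alpha$ is a sum of positive roots. A Hessenberg set is a subset $\mathfrak h\subseteq\Phi^+$ whose complement in $\Phi^+$ is upward closed for $\prec$. The Hessenberg graph $\Gamma_{\mathfrak h}$ has vertex set $W$ and a directed edge $u\to w$ whenever $w=s_\alpha u$, $\alpha\in\Phi^+$ and $w^{-1}\alpha\in-\mathfrak h$. The GKM ring $H_T^*(\mathfrak h)$ is the ring of maps $\mathcal P:W\to\mathbb R[\Delta]$ with $\mathcal P(w)-\mathcal P(s_\alpha w)\in\langle\alpha\rangle$ for every edge of $\Gamma_{\mathfrak h}$ joining $w$ and $s_\alpha w$; $\mathcal P\in H_T^d(\mathfrak h)$ means every nonzero $\mathcal P(w)$ is homogeneous of degree $d$. Write $x<_{\mathfrak h}y$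 if there is a directed path $x\to\cdots\to y$ in $\Gamma_{\mathfrak h}$, and let $\ell_{\mathfrak h}(x)$ be the number of edges of $\Gamma_{\mathfrak h}$ ending at $x$. A flow-up class at $x$ is $\mathcal P^x\in H_T^{\ell_{\mathfrak h}(x)}(\mathfrak h)$ such that (1) $\mathcal P^x(x)=\prod\alpha$, the product over all edges $s_\alpha x\to x$ of $\Gamma_{\mathfrak h}$ ending at $x$, and (2) $\mathcal P^x(y)\neq0$ implies $y=x$ or $x<_{\mathfrak h}y$. *)

theory Defs
  imports "HOL-Analysis.Analysis" "HOL-Library.Poly_Mapping"
begin

definition refl :: "'a::real_inner \<Rightarrow> 'a \<Rightarrow> 'a" where
  "refl \<alpha> v = v - (2 * (v \<bullet> \<alpha>) / (\<alpha> \<bullet> \<alpha>)) *\<^sub>R \<alpha>"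

text \<open>Crystallographic (reduced) root system in V (not required to span V).\<close>
definition crystallographic_root_system :: "'a::euclidean_space set \<Rightarrow> bool" where
  "crystallographic_root_system \<Phi> \<longleftrightarrow>
     finite \<Phi> \<and> 0 \<notin> \<Phi> \<and>
     (\<forall>\<alpha>\<in>\<Phi>. \<forall>c::real. c *\<^sub>R \<alpha> \<in> \<Phi> \<longrightarrow> c = 1 \<or> c = -1) \<and>
     (\<forall>\<alpha>\<in>\<Phi>. refl \<alpha> ` \<Phi> = \<Phi>) \<and>
     (\<forall>\<alpha>\<in>\<Phi>. \<forall>\<beta>\<in>\<Phi>. 2 * (\<beta> \<bullet> \<alpha>) / (\<alpha> \<bullet> \<alpha>) \<in> \<int>)"

definition is_base :: "'a::euclidean_space set \<Rightarrow> 'a set \<Rightarrow> bool" where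
  "is_base \<Phi> \<Delta> \<longleftrightarrow> \<Delta> \<subseteq> \<Phi> \<and> independent \<Delta> \<and>
     (\<forall>\<beta>\<in>\<Phi>. \<exists>c. (\<forall>\<delta>\<in>\<Delta>. c \<delta> \<in> \<int>) \<and> \<beta> = (\<Sum>\<delta>\<in>\<Delta>. c \<delta> *\<^sub>R \<delta>) \<and>
        ((\<forall>\<delta>\<in>\<Delta>. c \<delta> \<ge> 0) \<or> (\<forall>\<delta>\<in>\<Delta>. c \<delta> \<le> 0)))"

definition positive_roots :: "'a::euclidean_space set \<Rightarrow> 'a set \<Rightarrow> 'a set" where
  "positive_roots \<Phi> \<Delta> = {\<beta>\<in>\<Phi>. \<exists>c. (\<forall>\<delta>\<in>\<Delta>. c \<delta> \<ge> 0) \<and> \<beta> = (\<Sum>\<delta>\<in>\<Delta>. c \<delta> *\<^sub>R \<delta>)}"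

text \<open>Weyl group: the group generated by the simple reflections (a finite group of
  linear automorphisms, so the monoid generated coincides with the group generated).\<close>
inductive_set weyl_group :: "'a::euclidean_space set \<Rightarrow> ('a \<Rightarrow> 'a) set" for \<Delta> where
  weyl_id: "id \<in> weyl_group \<Delta>"
| weyl_step: "w \<in> weyl_group \<Delta> \<Longrightarrow> \<delta> \<in> \<Delta> \<Longrightarrow> refl \<delta> \<circ> w \<in> weyl_group \<Delta>"

inductive_set pos_sums :: "'a::euclidean_space set \<Rightarrow> 'a set" for P where
  "\<alpha> \<in> P \<Longrightarrow> \<alpha> \<in> pos_sums P"
| "a \<in> pos_sums P \<Longrightarrow> b \<in> pos_sums P \<Longrightarrow> a + b \<in> pos_sums P"

definition root_prec :: "'a::euclidean_space set \<Rightarrow> 'a set \<Rightarrow> 'a \<Rightarrow> 'a \<Rightarrow> bool" where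
  "root_prec \<Phi> \<Delta> \<alpha> \<beta> \<longleftrightarrow> \<beta> - \<alpha> \<in> pos_sums (positive_roots \<Phi> \<Delta>)"

definition hessenberg_set :: "'a::euclidean_space set \<Rightarrow> 'a set \<Rightarrow> 'a set \<Rightarrow> bool" where
  "hessenberg_set \<Phi> \<Delta> h \<longleftrightarrow> h \<subseteq> positive_roots \<Phi> \<Delta> \<and>
     (\<forall>\<beta>\<in>positive_roots \<Phi> \<Delta> - h. \<forall>\<gamma>\<in>positive_roots \<Phi> \<Delta>.
        root_prec \<Phi> \<Delta> \<beta> \<gamma> \<longrightarrow> \<gamma> \<in> positive_roots \<Phi> \<Delta> - h)"

text \<open>Polynomials with real coefficients in commuting variables indexed by the
  vectors of V; R[Delta] consists of those only involving the variables in Delta.\<close>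
type_synonym 'a rpoly = "('a \<Rightarrow>\<^sub>0 nat) \<Rightarrow>\<^sub>0 real"

definition in_poly_ring :: "'a set \<Rightarrow> (('a \<Rightarrow>\<^sub>0 nat) \<Rightarrow>\<^sub>0 real) \<Rightarrow> bool" where
  "in_poly_ring \<Delta> p \<longleftrightarrow> (\<forall>m\<in>Poly_Mapping.keys p. Poly_Mapping.keys m \<subseteq> \<Delta>)"

definition monomial_degree :: "('a \<Rightarrow>\<^sub>0 nat) \<Rightarrow> nat" where
  "monomial_degree m = (\<Sum>i\<in>Poly_Mapping.keys m. Poly_Mapping.lookup m i)"

definition homogeneous :: "nat \<Rightarrow> (('a \<Rightarrow>\<^sub>0 nat) \<Rightarrow>\<^sub>0 real) \<Rightarrow> bool" where
  "homogeneous d p \<longleftrightarrow> (\<forall>m\<in>Poly_Mapping.keys p. monomial_degree m = d)"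

definition var :: "'a \<Rightarrow> 'a rpoly" where
  "var \<delta> = Poly_Mapping.single (Poly_Mapping.single \<delta> 1) 1"

definition base_coord :: "'a::euclidean_space set \<Rightarrow> 'a \<Rightarrow> 'a \<Rightarrow> real" where
  "base_coord \<Delta> \<beta> = (THE c. (\<forall>\<delta>. \<delta> \<notin> \<Delta> \<longrightarrow> c \<delta> = 0) \<and> \<beta> = (\<Sum>\<delta>\<in>\<Delta>. c \<delta> *\<^sub>R \<delta>))"

definition root_poly :: "'a::euclidean_space set \<Rightarrow> 'a \<Rightarrow> 'a rpoly" where
  "root_poly \<Delta> \<beta> = (\<Sum>\<delta>\<in>\<Delta>. Poly_Mapping.single 0 (base_coord \<Delta> \<beta> \<delta>) * var \<delta>)"

definition hess_edge :: "'a::euclidean_space set \<Rightarrow> 'a set \<Rightarrow> 'a set \<Rightarrow>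
    ('a \<Rightarrow> 'a) \<Rightarrow> 'a \<Rightarrow> ('a \<Rightarrow> 'a) \<Rightarrow> bool" where
  "hess_edge \<Phi> \<Delta> h u \<alpha> w \<longleftrightarrow> u \<in> weyl_group \<Delta> \<and> w \<in> weyl_group \<Delta> \<and>
     \<alpha> \<in> positive_roots \<Phi> \<Delta> \<and> w = refl \<alpha> \<circ> u \<and> inv w \<alpha> \<in> uminus ` h"

definition hess_less :: "'a::euclidean_space set \<Rightarrow> 'a set \<Rightarrow> 'a set \<Rightarrow>
    ('a \<Rightarrow> 'a) \<Rightarrow> ('a \<Rightarrow> 'a) \<Rightarrow> bool" where
  "hess_less \<Phi> \<Delta> h x y \<longleftrightarrow> (x, y) \<in> {(u, w). \<exists>\<alpha>. hess_edge \<Phi> \<Delta> h u \<alpha> w}\<^sup>+"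

definition in_edges :: "'a::euclidean_space set \<Rightarrow> 'a set \<Rightarrow> 'a set \<Rightarrow>
    ('a \<Rightarrow> 'a) \<Rightarrow> (('a \<Rightarrow> 'a) \<times> 'a) set" where
  "in_edges \<Phi> \<Delta> h x = {(u, \<alpha>). hess_edge \<Phi> \<Delta> h u \<alpha> x}"

definition hess_length :: "'a::euclidean_space set \<Rightarrow> 'a set \<Rightarrow> 'a set \<Rightarrow> ('a \<Rightarrow> 'a) \<Rightarrow> nat" where
  "hess_length \<Phi> \<Delta> h x = card (in_edges \<Phi> \<Delta> h x)"

definition gkm_ring :: "'a::euclidean_space set \<Rightarrow> 'a set \<Rightarrow> 'a set \<Rightarrow>
    (('a \<Rightarrow> 'a) \<Rightarrow> 'a rpoly) set" where
  "gkm_ring \<Phi> \<Delta> h = {P. (\<forall>w. w \<notin> weyl_group \<Delta> \<longrightarrow> P w = 0) \<and>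
     (\<forall>w\<in>weyl_group \<Delta>. in_poly_ring \<Delta> (P w)) \<and>
     (\<forall>u \<alpha> w. hess_edge \<Phi> \<Delta> h u \<alpha> w \<longrightarrow> root_poly \<Delta> \<alpha> dvd (P w - P u))}"

definition gkm_deg :: "'a::euclidean_space set \<Rightarrow> 'a set \<Rightarrow> 'a set \<Rightarrow> nat \<Rightarrow>
    (('a \<Rightarrow> 'a) \<Rightarrow> 'a rpoly) set" where
  "gkm_deg \<Phi> \<Delta> h d = {P \<in> gkm_ring \<Phi> \<Delta> h. \<forall>w. P w \<noteq> 0 \<longrightarrow> homogeneous d (P w)}"

definition flow_up :: "'a::euclidean_space set \<Rightarrow> 'a set \<Rightarrow> 'a set \<Rightarrow>
    ('a \<Rightarrow> 'a) \<Rightarrow> (('a \<Rightarrow> 'a) \<Rightarrow> 'a rpoly) \<Rightarrow> bool" where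
  "flow_up \<Phi> \<Delta> h x P \<longleftrightarrow> P \<in> gkm_deg \<Phi> \<Delta> h (hess_length \<Phi> \<Delta> h x) \<and>
     P x = (\<Prod>e\<in>in_edges \<Phi> \<Delta> h x. root_poly \<Delta> (snd e)) \<and>
     (\<forall>y. P y \<noteq> 0 \<longrightarrow> y = x \<or> hess_less \<Phi> \<Delta> h x y)"

end

theory Submission
  imports Defs "HOL-Computational_Algebra.Polynomial"
begin

text \<open>Writing an edge into \<open>w\<close> as \<open>w s\<^sub>\<beta> \<rightarrow> w\<close> with \<open>\<beta> \<in> h\<close>, \<open>w \<beta> < 0\<close>, flow-up classes are built vertex by
  vertex, in the order of decreasing \<open>\<psi> w = \<langle>w \<rho>, \<rho>\<rangle>\<close> for a vector \<open>\<rho>\<close> that is positive on the base. At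
  \<open>w\<close> one needs a polynomial with prescribed residues modulo the incoming labels; since linear forms
  are prime, it exists as soon as it exists for the labels in each plane separately. This leaves
  root systems of rank two. There, whenever the lower set \<open>h\<close> is stable under a simple reflection
  \<open>s\<^sub>c\<close>, divided differences by \<open>w c\<close> reduce the number of incoming edges; two edges are no obstruction
  because everything below \<open>w\<close> is connected; and the only remaining configuration is an octahedron in
  type \<open>G\<^sub>2\<close>, where the value is given by a formula. The basis property is triangularity.\<close>

section \<open>Polynomials\<close>

text \<open>Under right multiplication the root \<open>\<beta>\<close> of an edge stays fixed while
  the label moves with the vertex, so all vertices met in a plane share one positive system
  \<open>T\<close> and one lower set \<open>J\<close>. At \<open>w\<close> the map \<open>P\<close>
  is known only where \<open>\<psi>\<close> is larger; hence congruences are assumed only at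
  vertices reached from \<open>w\<close> by removing inversions. These steps use every root of
  \<open>T\<close>, also outside \<open>h\<close>, because only then is the relation compatible with
  both simple reflections. The obstacle is that a proper lower set containing both simple roots is
  stable under at most one simple reflection, and \<open>w\<close> need not have that one as a
  descent. What remains then are two edges, a subsystem of type A_2, or the octahedron formed by the
  six cosets modulo \<open>s_a\<close> in G_2. Its formula rests on the identity
  \<open>a (3a + 2b) = (3a + b) (a + b) - (2a + b) b\<close> between labels. Divisibility is studied
  with all vectors as variables. Projection to \<open>R[\<Delta>]\<close> and to a single degree
  comes afterwards; both preserve divisibility by labels.\<close>

abbreviation keys :: "('k \<Rightarrow>\<^sub>0 'v::zero) \<Rightarrow> 'k set" where "keys \<equiv> Poly_Mapping.keys"
abbreviation lookup :: "('k \<Rightarrow>\<^sub>0 'v::zero) \<Rightarrow> 'k \<Rightarrow> 'v" where "lookup \<equiv> Poly_Mapping.lookup"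
abbreviation scalar :: "real \<Rightarrow> 'i rpoly" where "scalar \<equiv> Poly_Mapping.single 0"

lemma poly_mapping_sum_single:
  fixes p :: "'k \<Rightarrow>\<^sub>0 'v::comm_monoid_add"
  shows "p = (\<Sum>m\<in>keys p. Poly_Mapping.single m (lookup p m))"
proof (rule poly_mapping_eqI)
  fix k
  have "(\<Sum>m\<in>keys p. lookup p m when m = k) = lookup p k"
    by (cases "k \<in> keys p")
      (auto simp: when_def sum.delta not_in_keys_iff_lookup_eq_zero)
  then show "lookup p k = lookup
      (\<Sum>m\<in>keys p. Poly_Mapping.single m (lookup p m)) k"
    by (simp add: lookup_sum lookup_single)
qed

section \<open>Evaluation homomorphisms\<close>

definition mono_eval :: "('i \<Rightarrow> 'b::comm_ring_1) \<Rightarrow> ('i \<Rightarrow>\<^sub>0 nat) \<Rightarrow> 'b" where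
  "mono_eval \<phi> m = (\<Prod>i\<in>keys m. \<phi> i ^ lookup m i)"

lemma mono_eval_superset:
  assumes "finite X" "keys m \<subseteq> X"
  shows "mono_eval \<phi> m = (\<Prod>i\<in>X. \<phi> i ^ lookup m i)"
  unfolding mono_eval_def
  by (rule prod.mono_neutral_left) (use assms in \<open>auto simp: not_in_keys_iff_lookup_eq_zero\<close>)

lemma mono_eval_add: "mono_eval \<phi> (m + n) = mono_eval \<phi> m * mono_eval \<phi> n"
proof -
  let ?X = "keys m \<union> keys n"
  have "keys (m + n) \<subseteq> ?X" by (rule Poly_Mapping.keys_add)
  then show ?thesis
    by (simp add: mono_eval_superset[of ?X] lookup_add power_add prod.distrib)
qed

lemma mono_eval_0 [simp]: "mono_eval \<phi> 0 = 1"
  by (simp add: mono_eval_def)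

lemma mono_eval_single [simp]: "mono_eval \<phi> (Poly_Mapping.single i k) = \<phi> i ^ k"
  by (simp add: mono_eval_def)

text \<open>Coefficients are mapped separately by \<open>\<kappa>\<close>, so that one definition
  serves substitution, renaming of variables to natural numbers, and the passage to polynomials in a
  grading variable.\<close>

definition poly_eval :: "(real \<Rightarrow> 'b::comm_ring_1) \<Rightarrow> ('i \<Rightarrow> 'b) \<Rightarrow> 'i rpoly \<Rightarrow> 'b" where
  "poly_eval \<kappa> \<phi> p = (\<Sum>m\<in>keys p. \<kappa> (lookup p m) * mono_eval \<phi> m)"

locale scalar_hom =
  fixes \<kappa> :: "real \<Rightarrow> 'b::comm_ring_1"
  assumes add: "\<kappa> (a + b) = \<kappa> a + \<kappa> b" and mult: "\<kappa> (a * b) = \<kappa> a * \<kappa> b" and one: "\<kappa> 1 = 1"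
begin

lemma zero [simp]: "\<kappa> 0 = 0"
  using add[of 0 0] by simp

lemma poly_eval_superset:
  assumes "finite X" "keys p \<subseteq> X"
  shows "poly_eval \<kappa> \<phi> p = (\<Sum>m\<in>X. \<kappa> (lookup p m) * mono_eval \<phi> m)"
  unfolding poly_eval_def
  by (rule sum.mono_neutral_left) (use assms in \<open>auto simp: not_in_keys_iff_lookup_eq_zero\<close>)

lemma poly_eval_add: "poly_eval \<kappa> \<phi> (p + q) = poly_eval \<kappa> \<phi> p + poly_eval \<kappa> \<phi> q"
proof -
  let ?X = "keys p \<union> keys q"
  have "keys (p + q) \<subseteq> ?X" by (rule Poly_Mapping.keys_add)
  then show ?thesis
    by (simp add: poly_eval_superset[of ?X] lookup_add add distrib_right sum.distrib)
qed

lemma poly_eval_0 [simp]: "poly_eval \<kappa> \<phi> 0 = 0"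
  by (simp add: poly_eval_def)

lemma poly_eval_single: "poly_eval \<kappa> \<phi> (Poly_Mapping.single m c) = \<kappa> c * mono_eval \<phi> m"
  by (simp add: poly_eval_def)

lemma poly_eval_1 [simp]: "poly_eval \<kappa> \<phi> 1 = 1"
  using poly_eval_single[of \<phi> 0 1] by (simp add: one)

lemma poly_eval_var [simp]: "poly_eval \<kappa> \<phi> (var i) = \<phi> i"
  by (simp add: var_def poly_eval_single one)

lemma poly_eval_const [simp]: "poly_eval \<kappa> \<phi> (scalar c) = \<kappa> c"
  by (simp add: poly_eval_single)

lemma poly_eval_sum: "poly_eval \<kappa> \<phi> (\<Sum>i\<in>I. f i) = (\<Sum>i\<in>I. poly_eval \<kappa> \<phi> (f i))"
  by (induction I rule: infinite_finite_induct) (simp_all add: poly_eval_add)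

lemma poly_eval_mult: "poly_eval \<kappa> \<phi> (p * q) = poly_eval \<kappa> \<phi> p * poly_eval \<kappa> \<phi> q"
proof -
  let ?s = "\<lambda>p m. Poly_Mapping.single m (lookup p m)"
  have "p * q = (\<Sum>m\<in>keys p. ?s p m) * (\<Sum>n\<in>keys q. ?s q n)"
    using poly_mapping_sum_single[of p] poly_mapping_sum_single[of q] by simp
  also have "\<dots> = (\<Sum>m\<in>keys p. \<Sum>n\<in>keys q. ?s p m * ?s q n)"
    by (rule sum_product)
  also have "poly_eval \<kappa> \<phi> \<dots> = (\<Sum>m\<in>keys p. \<Sum>n\<in>keys q.
      (\<kappa> (lookup p m) * mono_eval \<phi> m) * (\<kappa> (lookup q n) * mono_eval \<phi> n))"
    by (simp add: poly_eval_sum mult_single poly_eval_single mult mono_eval_add mult_ac)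
  also have "\<dots> = poly_eval \<kappa> \<phi> p * poly_eval \<kappa> \<phi> q"
    by (simp add: poly_eval_def sum_product)
  finally show ?thesis .
qed

lemma poly_eval_uminus: "poly_eval \<kappa> \<phi> (- p) = - poly_eval \<kappa> \<phi> p"
  using poly_eval_add[of \<phi> p "- p"] by (simp add: eq_neg_iff_add_eq_0 add.commute)

lemma poly_eval_diff: "poly_eval \<kappa> \<phi> (p - q) = poly_eval \<kappa> \<phi> p - poly_eval \<kappa> \<phi> q"
  using poly_eval_add[of \<phi> p "- q"] by (simp add: poly_eval_uminus)

lemma poly_eval_prod: "poly_eval \<kappa> \<phi> (\<Prod>i\<in>I. f i) = (\<Prod>i\<in>I. poly_eval \<kappa> \<phi> (f i))"
  by (induction I rule: infinite_finite_induct) (simp_all add: poly_eval_mult)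

lemma poly_eval_dvd: "p dvd q \<Longrightarrow> poly_eval \<kappa> \<phi> p dvd poly_eval \<kappa> \<phi> q"
  by (auto simp: dvd_def poly_eval_mult)

end

lemma scalar_hom_single: "scalar_hom (Poly_Mapping.single (0::'m::comm_monoid_add))"
  by unfold_locales (simp_all add: single_add mult_single)

interpretation single_hom: scalar_hom "Poly_Mapping.single (0::'i \<Rightarrow>\<^sub>0 nat)"
  by (rule scalar_hom_single)

lemma var_power: "var i ^ k = Poly_Mapping.single (Poly_Mapping.single i k) 1"
  by (induction k) (simp_all add: var_def mult_single flip: single_add)

lemma prod_single_1:
  "(\<Prod>i\<in>I. Poly_Mapping.single (f i) (1::real)) = Poly_Mapping.single (\<Sum>i\<in>I. f i) 1"
  by (induction I rule: infinite_finite_induct) (simp_all add: mult_single)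

lemma mono_eval_var: "mono_eval var m = Poly_Mapping.single m 1"
  by (simp add: mono_eval_def var_power prod_single_1 flip: poly_mapping_sum_single)

lemma poly_eval_id: "poly_eval scalar var p = p"
  by (simp add: poly_eval_def mono_eval_var mult_single flip: poly_mapping_sum_single)

section \<open>Cancellation in the polynomial ring\<close>

text \<open>The library makes polynomials an integral domain only when the variables are linearly
  ordered; finitely many variables may be renamed to natural numbers.\<close>

lemma rpoly_no_zero_divisors:
  fixes p q :: "'i rpoly"
  assumes "p * q = 0" "q \<noteq> 0"
  shows "p = 0"
proof (rule ccontr)
  assume "p \<noteq> 0"
  define X where "X = (\<Union>m\<in>keys p \<union> keys q. keys m)"
  have "finite X" by (auto simp: X_def)
  then obtain f :: "'i \<Rightarrow> nat" where f: "inj_on f X"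
    using finite_imp_inj_to_nat_seg by blast
  let ?\<kappa> = "Poly_Mapping.single (0::nat \<Rightarrow>\<^sub>0 nat)"
  let ?E = "poly_eval ?\<kappa> (\<lambda>i. var (f i)) :: 'i rpoly \<Rightarrow> nat rpoly"
  define ren :: "('i \<Rightarrow>\<^sub>0 nat) \<Rightarrow> (nat \<Rightarrow>\<^sub>0 nat)"
    where "ren m = (\<Sum>i\<in>keys m. Poly_Mapping.single (f i) (lookup m i))" for m
  have ren: "mono_eval (\<lambda>i. var (f i)) m = Poly_Mapping.single (ren m) 1" for m :: "'i \<Rightarrow>\<^sub>0 nat"
    by (simp add: mono_eval_def var_power prod_single_1 ren_def)
  have lookup_ren: "lookup (ren m) (f i) = lookup m i"
    if "keys m \<subseteq> X" "i \<in> X" for m i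
  proof -
    have "lookup (ren m) (f i) =
        (\<Sum>j\<in>keys m. if j = i then lookup m j else 0)"
      unfolding ren_def lookup_sum lookup_single
      by (rule sum.cong) (use that f in \<open>auto simp: when_def inj_on_eq_iff subset_iff\<close>)
    also have "\<dots> = lookup m i"
      by (simp add: not_in_keys_iff_lookup_eq_zero)
    finally show ?thesis .
  qed
  have inj: "m = n" if "ren m = ren n" "keys m \<subseteq> X" "keys n \<subseteq> X" for m n
  proof (rule poly_mapping_eqI)
    fix i show "lookup m i = lookup n i"
    proof (cases "i \<in> X")
      case True
      then show ?thesis using lookup_ren[of m i] lookup_ren[of n i] that by simp
    next
      case False
      then show ?thesis using that by (metis in_keys_iff subsetD)
    qed
  qed
  \<comment> \<open>Monomials with support in \<open>X\<close> have distinct images, so no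
    coefficients merge: that of \<open>r\<close> at \<open>m\<close> survives at
    \<open>ren m\<close>.\<close>
  have nz: "?E r \<noteq> 0" if "r \<noteq> 0" "keys r \<subseteq> keys p \<union> keys q" for r
  proof -
    obtain m where m: "m \<in> keys r" using \<open>r \<noteq> 0\<close> by (metis all_not_in_conv keys_eq_empty)
    have X: "keys n \<subseteq> X" if "n \<in> keys r" for n
      using that \<open>keys r \<subseteq> _\<close> by (auto simp: X_def)
    have "lookup (?E r) (ren m) =
        (\<Sum>n\<in>keys r. if n = m then lookup r n else 0)"
      unfolding poly_eval_def lookup_sum ren mult_single lookup_single
      by (rule sum.cong) (use m X inj in \<open>auto simp: when_def\<close>)
    also have "\<dots> = lookup r m" using m by simp
    also have "\<dots> \<noteq> 0" using m by (simp add: in_keys_iff)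
    finally show ?thesis by auto
  qed
  have "?E p * ?E q = 0"
    using \<open>p * q = 0\<close> single_hom.poly_eval_mult[of "\<lambda>i. var (f i)" p q] by simp
  then show False using nz[of p] nz[of q] \<open>p \<noteq> 0\<close> \<open>q \<noteq> 0\<close> by simp
qed

lemma rpoly_mult_cancel:
  fixes a :: "'i rpoly"
  assumes "a * b = a * c" "a \<noteq> 0"
  shows "b = c"
  using rpoly_no_zero_divisors[of "b - c" a] assms by (simp add: algebra_simps)

lemma rpoly_dvd_mult_cancel:
  fixes a :: "'i rpoly"
  assumes "a * b dvd a * c" "a \<noteq> 0"
  shows "b dvd c"
  using assms rpoly_mult_cancel[of a c] by (auto simp: dvd_def mult.assoc)

lemma rpoly_prod_nonzero:
  fixes f :: "'j \<Rightarrow> 'i rpoly"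
  assumes "finite I" "\<And>i. i \<in> I \<Longrightarrow> f i \<noteq> 0"
  shows "(\<Prod>i\<in>I. f i) \<noteq> 0"
  using assms by (induction I rule: finite_induct) (auto dest: rpoly_no_zero_divisors)

text \<open>Polynomials respect congruence of their variables: a difference of products telescopes,
  and \<open>x^n - y^n\<close> is a multiple of \<open>x - y\<close>.\<close>

lemma dvd_poly_eval_diff:
  fixes \<phi> :: "'i \<Rightarrow> 'i rpoly"
  assumes "\<And>i. a dvd var i - \<phi> i"
  shows "a dvd p - poly_eval scalar \<phi> p"
proof -
  have prod: "a dvd (\<Prod>i\<in>I. f i) - (\<Prod>i\<in>I. g i)" if "\<And>i. a dvd f i - g i" for I and f g :: "'i \<Rightarrow> 'i rpoly"
  proof (induction I rule: infinite_finite_induct)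
    case (insert x I)
    have "(\<Prod>i\<in>insert x I. f i) - (\<Prod>i\<in>insert x I. g i)
        = (f x - g x) * (\<Prod>i\<in>I. f i) + g x * ((\<Prod>i\<in>I. f i) - (\<Prod>i\<in>I. g i))"
      using insert by (simp add: algebra_simps)
    then show ?case using insert that[of x] by (metis dvd_add dvd_mult dvd_mult2)
  qed simp_all
  have pow: "a dvd var i ^ n - \<phi> i ^ n" for i n
    using assms[of i] by (auto simp: power_diff_sumr2 intro: dvd_mult2)
  have "p - poly_eval scalar \<phi> p = (\<Sum>m\<in>keys p.
      scalar (lookup p m) * (mono_eval var m - mono_eval \<phi> m))"
    by (subst (1) poly_eval_id[of p, symmetric])
      (simp add: poly_eval_def right_diff_distrib sum_subtractf)
  also have "a dvd \<dots>"
    unfolding mono_eval_def by (intro dvd_sum dvd_mult prod pow)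
  finally show ?thesis .
qed

text \<open>Setting all other variables to 0 is a ring endomorphism that fixes the polynomials in
  \<open>X\<close>; it carries solutions of congruences into \<open>R[\<Delta>]\<close>.\<close>

definition restrict_vars :: "'i set \<Rightarrow> 'i rpoly \<Rightarrow> 'i rpoly" where
  "restrict_vars X = poly_eval scalar (\<lambda>i. if i \<in> X then var i else 0)"

lemma in_poly_ring_0 [simp]: "in_poly_ring X 0"
  and in_poly_ring_1 [simp]: "in_poly_ring X 1"
  and in_poly_ring_const [simp]: "in_poly_ring X (scalar c)"
  and in_poly_ring_var: "i \<in> X \<Longrightarrow> in_poly_ring X (var i)"
  by (auto simp: in_poly_ring_def var_def)

lemma in_poly_ring_add: "in_poly_ring X p \<Longrightarrow> in_poly_ring X q \<Longrightarrow> in_poly_ring X (p + q)"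
  using Poly_Mapping.keys_add[of p q] unfolding in_poly_ring_def by blast

lemma in_poly_ring_uminus: "in_poly_ring X p \<Longrightarrow> in_poly_ring X (- p)"
  unfolding in_poly_ring_def by (simp add: in_keys_iff)

lemma in_poly_ring_diff: "in_poly_ring X p \<Longrightarrow> in_poly_ring X q \<Longrightarrow> in_poly_ring X (p - q)"
  using in_poly_ring_add[of X p "- q"] in_poly_ring_uminus[of X q] by simp

lemma in_poly_ring_mult: "in_poly_ring X p \<Longrightarrow> in_poly_ring X q \<Longrightarrow> in_poly_ring X (p * q)"
proof -
  assume pq: "in_poly_ring X p" "in_poly_ring X q"
  show ?thesis
    unfolding in_poly_ring_def
  proof
    fix m assume "m \<in> keys (p * q)"
    then obtain a b where "a \<in> keys p" "b \<in> keys q" "m = a + b"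
      using keys_mult[of p q] by blast
    then show "keys m \<subseteq> X"
      using pq Poly_Mapping.keys_add[of a b] unfolding in_poly_ring_def by blast
  qed
qed

lemma in_poly_ring_sum: "(\<And>i. i \<in> I \<Longrightarrow> in_poly_ring X (f i)) \<Longrightarrow> in_poly_ring X (\<Sum>i\<in>I. f i)"
  by (induction I rule: infinite_finite_induct) (auto intro: in_poly_ring_add)

lemma in_poly_ring_prod: "(\<And>i. i \<in> I \<Longrightarrow> in_poly_ring X (f i)) \<Longrightarrow> in_poly_ring X (\<Prod>i\<in>I. f i)"
  by (induction I rule: infinite_finite_induct) (auto intro: in_poly_ring_mult)

lemma in_poly_ring_power: "in_poly_ring X p \<Longrightarrow> in_poly_ring X (p ^ n)"
  by (induction n) (auto intro: in_poly_ring_mult)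

lemma in_poly_ring_restrict_vars: "in_poly_ring X (restrict_vars X p)"
  unfolding restrict_vars_def poly_eval_def mono_eval_def
  by (auto intro!: in_poly_ring_sum in_poly_ring_mult in_poly_ring_prod in_poly_ring_power in_poly_ring_var)

lemma restrict_vars_id:
  assumes "in_poly_ring X p"
  shows "restrict_vars X p = p"
proof -
  have "restrict_vars X p = poly_eval scalar var p"
    unfolding restrict_vars_def poly_eval_def mono_eval_def using assms
    by (intro sum.cong prod.cong arg_cong2[where f = "(*)"]) (auto simp: in_poly_ring_def)
  then show ?thesis by (simp add: poly_eval_id)
qed

lemma restrict_vars_diff: "restrict_vars X (p - q) = restrict_vars X p - restrict_vars X q"
  and restrict_vars_mult: "restrict_vars X (p * q) = restrict_vars X p * restrict_vars X q"
  by (simp_all add: restrict_vars_def single_hom.poly_eval_diff single_hom.poly_eval_mult)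

section \<open>Homogeneous components\<close>

lemma scalar_hom_const_poly:
  "scalar_hom (\<lambda>c. [:scalar c:] :: 'i rpoly poly)"
  by unfold_locales (simp_all add: single_add mult_single mult.commute[of _ "_::real"] one_pCons)

interpretation grad_hom: scalar_hom "\<lambda>c. [:scalar c:] :: 'i rpoly poly"
  by (rule scalar_hom_const_poly)

text \<open>Substituting \<open>i \<mapsto> i t\<close> with a new variable \<open>t\<close> separates the homogeneous components.\<close>

definition grading :: "'i rpoly \<Rightarrow> 'i rpoly poly" where
  "grading = poly_eval (\<lambda>c. [:scalar c:]) (\<lambda>i. [:0, var i:])"

definition hom_comp :: "nat \<Rightarrow> 'i rpoly \<Rightarrow> 'i rpoly" where
  "hom_comp d p = coeff (grading p) d"

lemma hom_comp_eq:
  fixes p :: "'i rpoly"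
  shows "hom_comp d p = (\<Sum>m\<in>keys p.
     if monomial_degree m = d then Poly_Mapping.single m (lookup p m) else 0)"
proof -
  have prod: "(\<Prod>i\<in>I. monom (f i) (g i)) = monom (\<Prod>i\<in>I. f i) (\<Sum>i\<in>I. g i)"
    for I and f :: "'i \<Rightarrow> 'i rpoly" and g
    by (induction I rule: infinite_finite_induct) (simp_all add: mult_monom)
  have lin: "[:0, v:] = monom v 1" for v :: "'i rpoly"
    by (simp add: monom_Suc monom_0)
  have "mono_eval (\<lambda>i. [:0, var i:]) m = monom (mono_eval var m) (monomial_degree m)" for m :: "'i \<Rightarrow>\<^sub>0 nat"
    unfolding mono_eval_def monomial_degree_def lin by (simp add: monom_power prod)
  then show ?thesis
    unfolding hom_comp_def grading_def poly_eval_def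
    by (auto simp: coeff_sum mono_eval_var mult_single intro!: sum.cong)
qed

lemma keys_hom_comp: "keys (hom_comp d p) \<subseteq> {m \<in> keys p. monomial_degree m = d}"
proof
  fix k assume "k \<in> keys (hom_comp d p)"
  then obtain m where "m \<in> keys p"
    "k \<in> keys (if monomial_degree m = d then Poly_Mapping.single m (lookup p m) else 0)"
    unfolding hom_comp_eq using Poly_Mapping.keys_sum by fast
  then show "k \<in> {m \<in> keys p. monomial_degree m = d}"
    by (auto split: if_splits)
qed

lemma homogeneous_hom_comp: "homogeneous d (hom_comp d p)"
  using keys_hom_comp[of d p] by (auto simp: homogeneous_def)

lemma in_poly_ring_hom_comp: "in_poly_ring X p \<Longrightarrow> in_poly_ring X (hom_comp d p)"
  using keys_hom_comp[of d p] by (auto simp: in_poly_ring_def)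

lemma hom_comp_id:
  assumes "homogeneous d p"
  shows "hom_comp d p = p"
proof -
  have "hom_comp d p = (\<Sum>m\<in>keys p. Poly_Mapping.single m (lookup p m))"
    unfolding hom_comp_eq by (rule sum.cong) (use assms in \<open>auto simp: homogeneous_def\<close>)
  then show ?thesis by (simp flip: poly_mapping_sum_single)
qed

lemma homogeneous_0 [simp]: "homogeneous d 0"
  by (simp add: homogeneous_def)

text \<open>Degree bookkeeping becomes multiplication of monomials in the grading variable.\<close>

lemma homogeneous_iff_grading: "homogeneous d p \<longleftrightarrow> grading p = monom p d"
proof
  assume p: "homogeneous d p"
  show "grading p = monom p d"
  proof (rule poly_eqI)
    fix n show "coeff (grading p) n = coeff (monom p d) n"
      using hom_comp_id[OF p] p
      by (cases "n = d") (auto simp: hom_comp_def[symmetric] hom_comp_eq homogeneous_def intro!: sum.neutral)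
  qed
next
  assume "grading p = monom p d"
  then show "homogeneous d p"
    using homogeneous_hom_comp[of d p] by (simp add: hom_comp_def)
qed

lemma grading_mult: "grading (p * q) = grading p * grading q"
  and grading_diff: "grading (p - q) = grading p - grading q"
  by (simp_all add: grading_def grad_hom.poly_eval_mult grad_hom.poly_eval_diff)

lemma homogeneous_prod:
  assumes "finite I" "\<And>i. i \<in> I \<Longrightarrow> homogeneous 1 (f i)"
  shows "homogeneous (card I) (\<Prod>i\<in>I. f i)"
  using assms
proof (induction I rule: finite_induct)
  case empty
  then show ?case by (simp add: homogeneous_def monomial_degree_def)
next
  case (insert i I)
  then show ?case
    by (simp add: homogeneous_iff_grading grading_mult mult_monom)
qed

lemma hom_comp_diff: "hom_comp d (p - q) = hom_comp d p - hom_comp d q"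
  by (simp add: hom_comp_def grading_diff)

text \<open>Grading turns \<open>a\<close> into \<open>a t\<close>, so every coefficient in
  \<open>t\<close> of a graded multiple of \<open>a\<close> is again a multiple of
  \<open>a\<close>.\<close>

lemma dvd_hom_comp:
  assumes "homogeneous 1 a" "a dvd p"
  shows "a dvd hom_comp d p"
proof -
  obtain g where "p = a * g" using \<open>a dvd p\<close> by (auto simp: dvd_def)
  then have "hom_comp d p = coeff (monom a 1 * grading g) d"
    using \<open>homogeneous 1 a\<close> by (simp add: hom_comp_def grading_mult homogeneous_iff_grading)
  then show ?thesis by (cases d) (auto simp: monom_Suc monom_0)
qed

section \<open>Linear forms\<close>

lemma prime_elem_dvd_prod:
  fixes q :: "'p::comm_ring_1"
  assumes "prime_elem q" "finite I" "q dvd (\<Prod>i\<in>I. f i)"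
  shows "\<exists>i\<in>I. q dvd f i"
  using assms(2,3,1)
  by (induction I rule: finite_induct) (auto simp: prime_elem_def)

text \<open>The \<open>q k\<close> may be associated or equal, so divisibility by each of them would
  not suffice. They are split off one at a time: each divides the remaining cofactor, being prime
  and not dividing \<open>A\<close>.\<close>

lemma prod_dvd_cancel:
  fixes A :: "'i rpoly"
  assumes "finite K" "\<And>k. k \<in> K \<Longrightarrow> prime_elem (q k)" "\<And>k. k \<in> K \<Longrightarrow> \<not> q k dvd A"
    and "(\<Prod>k\<in>K. q k) dvd A * H"
  shows "(\<Prod>k\<in>K. q k) dvd H"
  using assms
proof (induction K rule: finite_induct)
  case (insert k K)
  have "(\<Prod>k\<in>K. q k) dvd A * H"
    using insert.prems(3) insert.hyps by (metis dvd_mult_right prod.insert)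
  with insert obtain H' where H': "H = (\<Prod>k\<in>K. q k) * H'" by (auto elim: dvdE)
  have nz: "(\<Prod>k\<in>K. q k) \<noteq> 0"
    using insert by (intro rpoly_prod_nonzero) (auto simp: prime_elem_def)
  have "(\<Prod>k\<in>K. q k) * q k dvd (\<Prod>k\<in>K. q k) * (A * H')"
    using insert.prems(3) insert.hyps by (simp add: H' mult_ac)
  then have "q k dvd A * H'" using nz rpoly_dvd_mult_cancel by blast
  then have "q k dvd H'"
    using insert.prems by (auto dest: prime_elem_dvd_multD)
  then show ?case using insert.hyps by (simp add: H' mult.commute mult_dvd_mono)
qed simp

text \<open>Here the classes \<open>{j \<in> I. R i j}\<close> collect the mutually associated primes.\<close>

lemma prod_dvd_by_classes:
  fixes G :: "'i rpoly"
  assumes "finite I" "\<And>i. i \<in> I \<Longrightarrow> prime_elem (q i)"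
    and "equivp R" "\<And>i j. i \<in> I \<Longrightarrow> j \<in> I \<Longrightarrow> q i dvd q j \<Longrightarrow> R i j"
    and "\<And>i. i \<in> I \<Longrightarrow> (\<Prod>j\<in>{j\<in>I. R i j}. q j) dvd G"
  shows "(\<Prod>i\<in>I. q i) dvd G"
  using assms(1,2,4,5)
proof (induction "card I" arbitrary: I rule: less_induct)
  case less
  show ?case
  proof (cases "I = {}")
    case False
    then obtain i where i: "i \<in> I" by blast
    define K J where "K = {j\<in>I. R i j}" and "J = I - K"
    have iK: "i \<in> K" using i \<open>equivp R\<close> by (simp add: K_def equivp_reflp)
    have fin: "finite K" "finite J" using less.prems(1) by (auto simp: K_def J_def)
    have cls: "{j\<in>J. R k j} = {j\<in>I. R k j}" if "k \<in> J" for k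
      using that \<open>equivp R\<close> by (auto simp: J_def K_def dest: equivp_symp equivp_transp)
    have "(\<Prod>j\<in>J. q j) dvd G"
    proof (rule less.hyps)
      show "card J < card I"
        using less.prems(1) i iK by (intro psubset_card_mono) (auto simp: J_def)
    next
      fix k assume k: "k \<in> J"
      then have "k \<in> I" by (simp add: J_def)
      from less.prems(4)[OF this] show "(\<Prod>j\<in>{j\<in>J. R k j}. q j) dvd G"
        by (simp only: cls[OF k])
    qed (use less.prems fin in \<open>auto simp: J_def\<close>)
    \<comment> \<open>A prime of the class \<open>K\<close> dividing the product over
      \<open>J\<close> would divide one of its factors and so be related to it. Hence the class has
      to divide the cofactor \<open>H\<close>.\<close>
    then obtain H where H: "G = (\<Prod>j\<in>J. q j) * H" by (auto elim: dvdE)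
    have "(\<Prod>k\<in>K. q k) dvd H"
    proof (rule prod_dvd_cancel)
      show "(\<Prod>k\<in>K. q k) dvd (\<Prod>j\<in>J. q j) * H"
        using less.prems(4)[OF i] by (simp add: H K_def)
    next
      fix k assume k: "k \<in> K"
      show "\<not> q k dvd (\<Prod>j\<in>J. q j)"
      proof
        assume "q k dvd (\<Prod>j\<in>J. q j)"
        then obtain j where j: "j \<in> J" "q k dvd q j"
          using prime_elem_dvd_prod[of "q k" J q] k less.prems fin by (auto simp: K_def)
        then have "R k j" using less.prems(3)[of k j] k by (auto simp: K_def J_def)
        then have "R i j" using k \<open>equivp R\<close> by (auto simp: K_def dest: equivp_transp)
        then show False using j by (auto simp: J_def K_def)
      qed
    qed (use fin less.prems in \<open>auto simp: K_def\<close>)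
    moreover have "(\<Prod>i\<in>I. q i) = (\<Prod>j\<in>J. q j) * (\<Prod>k\<in>K. q k)"
      using less.prems(1) by (subst prod.subset_diff[of K I]) (auto simp: K_def J_def)
    ultimately show ?thesis by (simp add: H mult_dvd_mono)
  qed simp
qed

section \<open>Linear forms in the coordinates of a base\<close>

locale base =
  fixes \<Delta> :: "'a::euclidean_space set"
  assumes indep: "independent \<Delta>"
begin

lemma finite_base: "finite \<Delta>"
  using indep by (rule independent_imp_finite)

lemma base_coord_eq:
  assumes "\<beta> \<in> span \<Delta>"
  shows "base_coord \<Delta> \<beta> = representation \<Delta> \<beta>"
  unfolding base_coord_def
proof (rule the_equality)
  show "(\<forall>\<delta>. \<delta> \<notin> \<Delta> \<longrightarrow> representation \<Delta> \<beta> \<delta> = 0) \<and>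
      \<beta> = (\<Sum>\<delta>\<in>\<Delta>. representation \<Delta> \<beta> \<delta> *\<^sub>R \<delta>)"
    using sum_representation_eq[OF indep assms finite_base order_refl] representation_ne_zero[of \<Delta> \<beta>]
    by auto
next
  fix c assume c: "(\<forall>\<delta>. \<delta> \<notin> \<Delta> \<longrightarrow> c \<delta> = 0) \<and> \<beta> = (\<Sum>\<delta>\<in>\<Delta>. c \<delta> *\<^sub>R \<delta>)"
  then have supp: "{\<delta>. c \<delta> \<noteq> 0} \<subseteq> \<Delta>" by auto
  have "(\<Sum>\<delta> | c \<delta> \<noteq> 0. c \<delta> *\<^sub>R \<delta>) = (\<Sum>\<delta>\<in>\<Delta>. c \<delta> *\<^sub>R \<delta>)"
    by (rule sum.mono_neutral_left) (use supp finite_base in auto)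
  then show "c = representation \<Delta> \<beta>"
    using c supp finite_base indep assms
    by (intro representation_eqI[symmetric]) (auto intro: finite_subset)
qed

abbreviation lf :: "'a \<Rightarrow> 'a rpoly" where "lf \<equiv> root_poly \<Delta>"

lemma root_poly_eq:
  "\<beta> \<in> span \<Delta> \<Longrightarrow> lf \<beta> = (\<Sum>\<delta>\<in>\<Delta>. scalar (representation \<Delta> \<beta> \<delta>) * var \<delta>)"
  by (simp add: root_poly_def base_coord_eq)

lemma root_poly_add: "x \<in> span \<Delta> \<Longrightarrow> y \<in> span \<Delta> \<Longrightarrow> lf (x + y) = lf x + lf y"
  by (simp add: root_poly_eq span_add representation_add[OF indep] single_add distrib_right sum.distrib)

lemma root_poly_scale: "x \<in> span \<Delta> \<Longrightarrow> lf (c *\<^sub>R x) = scalar c * lf x"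
  by (simp add: root_poly_eq span_scale representation_scale[OF indep] sum_distrib_left
      mult_single mult.assoc[symmetric])

lemma root_poly_minus: "x \<in> span \<Delta> \<Longrightarrow> lf (- x) = - lf x"
  using root_poly_scale[of x "- 1"] by (simp add: single_uminus)

lemma root_poly_diff: "x \<in> span \<Delta> \<Longrightarrow> y \<in> span \<Delta> \<Longrightarrow> lf (x - y) = lf x - lf y"
  using root_poly_add[of x "- y"] root_poly_minus[of y] by (simp add: span_neg)

lemma lookup_root_poly:
  assumes "\<beta> \<in> span \<Delta>" "\<delta> \<in> \<Delta>"
  shows "lookup (lf \<beta>) (Poly_Mapping.single \<delta> 1) = representation \<Delta> \<beta> \<delta>"
proof -
  have inj: "Poly_Mapping.single x (1::nat) = Poly_Mapping.single \<delta> 1 \<longleftrightarrow> x = \<delta>" for x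
    by (metis lookup_single_eq lookup_single_not_eq zero_neq_one)
  have "lookup (lf \<beta>) (Poly_Mapping.single \<delta> 1)
     = (\<Sum>x\<in>\<Delta>. if x = \<delta> then representation \<Delta> \<beta> x else 0)"
    using assms by (simp add: root_poly_eq lookup_sum var_def mult_single lookup_single inj when_def del: One_nat_def)
  then show ?thesis using assms finite_base by simp
qed

lemma root_poly_eq_0_iff:
  assumes "\<beta> \<in> span \<Delta>"
  shows "lf \<beta> = 0 \<longleftrightarrow> \<beta> = 0"
proof
  assume "lf \<beta> = 0"
  then have "representation \<Delta> \<beta> \<delta> = 0" if "\<delta> \<in> \<Delta>" for \<delta>
    using lookup_root_poly[OF assms that] by simp
  then show "\<beta> = 0"
    using sum_representation_eq[OF indep assms finite_base order_refl] by simp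
next
  assume "\<beta> = 0" then show "lf \<beta> = 0" using root_poly_scale[of 0 0] by (simp add: span_zero)
qed

lemma homogeneous_root_poly:
  assumes "\<beta> \<in> span \<Delta>"
  shows "homogeneous 1 (lf \<beta>)"
proof -
  have "grading (lf \<beta>) = (\<Sum>\<delta>\<in>\<Delta>. [:scalar (representation \<Delta> \<beta> \<delta>):] * [:0, var \<delta>:])"
    by (simp add: root_poly_eq[OF assms] grading_def grad_hom.poly_eval_sum grad_hom.poly_eval_mult)
  also have "\<dots> = (\<Sum>\<delta>\<in>\<Delta>. monom (scalar (representation \<Delta> \<beta> \<delta>) * var \<delta>) 1)"
    by (simp add: monom_Suc monom_0 mult.commute)
  also have "\<dots> = monom (lf \<beta>) 1"
    by (simp only: root_poly_eq[OF assms] monom_sum)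
  finally show ?thesis by (simp add: homogeneous_iff_grading)
qed

lemma in_poly_ring_root_poly: "in_poly_ring \<Delta> (lf \<beta>)"
  unfolding root_poly_def
  by (intro in_poly_ring_sum in_poly_ring_mult in_poly_ring_const in_poly_ring_var)

text \<open>Solving \<open>\<alpha> = 0\<close> for one variable identifies the quotient by \<open>lf \<alpha>\<close> with a subring.\<close>

lemma quotient_hom:
  assumes \<alpha>: "\<alpha> \<in> span \<Delta>" "\<alpha> \<noteq> 0"
  obtains \<phi> where
    "\<And>p. lf \<alpha> dvd p - poly_eval scalar \<phi> p"
    "\<And>p. lf \<alpha> dvd p \<longleftrightarrow> poly_eval scalar \<phi> p = 0"
    "\<And>\<beta>. \<beta> \<in> span \<Delta> \<Longrightarrow> \<exists>c. poly_eval scalar \<phi> (lf \<beta>) = lf (\<beta> - c *\<^sub>R \<alpha>)"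
proof -
  have "\<exists>\<delta>\<in>\<Delta>. representation \<Delta> \<alpha> \<delta> \<noteq> 0"
  proof (rule ccontr)
    assume "\<not> ?thesis"
    then show False
      using sum_representation_eq[OF indep \<alpha>(1) finite_base order_refl] \<alpha>(2) by simp
  qed
  then obtain \<delta> where \<delta>: "\<delta> \<in> \<Delta>" "representation \<Delta> \<alpha> \<delta> \<noteq> 0" by blast
  define a where "a = representation \<Delta> \<alpha> \<delta>"
  \<comment> \<open>The variable \<open>\<delta>\<close> is replaced by
    \<open>\<delta> - \<alpha> / a\<close>, a form in which \<open>\<delta>\<close> no longer
    occurs; this makes \<open>\<alpha>\<close> vanish.\<close>
  define \<phi> where "\<phi> = (\<lambda>i. var i - (if i = \<delta> then scalar (1 / a) * lf \<alpha> else 0))"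
  let ?\<sigma> = "poly_eval scalar \<phi>"
  have \<sigma>_root: "?\<sigma> (lf \<beta>) = lf (\<beta> - (representation \<Delta> \<beta> \<delta> / a) *\<^sub>R \<alpha>)" if \<beta>: "\<beta> \<in> span \<Delta>" for \<beta>
  proof -
    have "?\<sigma> (lf \<beta>) = (\<Sum>x\<in>\<Delta>. scalar (representation \<Delta> \<beta> x) * \<phi> x)"
      by (simp add: root_poly_eq[OF \<beta>] single_hom.poly_eval_sum single_hom.poly_eval_mult)
    also have "\<dots> = lf \<beta> - (\<Sum>x\<in>\<Delta>. if x = \<delta> then
        scalar (representation \<Delta> \<beta> \<delta>) * (scalar (1 / a) * lf \<alpha>) else 0)"
      unfolding root_poly_eq[OF \<beta>] sum_subtractf[symmetric]
      by (rule sum.cong) (simp_all add: \<phi>_def right_diff_distrib)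
    also have "\<dots> = lf \<beta> - scalar (representation \<Delta> \<beta> \<delta>) * (scalar (1 / a) * lf \<alpha>)"
      using \<delta>(1) finite_base by simp
    also have "\<dots> = lf \<beta> - lf ((representation \<Delta> \<beta> \<delta> / a) *\<^sub>R \<alpha>)"
      by (simp only: root_poly_scale[OF \<alpha>(1)] mult.assoc[symmetric] mult_single) simp
    also have "\<dots> = lf (\<beta> - (representation \<Delta> \<beta> \<delta> / a) *\<^sub>R \<alpha>)"
      using \<beta> \<alpha> by (simp add: root_poly_diff span_scale)
    finally show ?thesis .
  qed
  have dvd: "lf \<alpha> dvd p - ?\<sigma> p" for p
    by (rule dvd_poly_eval_diff) (simp add: \<phi>_def)
  have zero: "?\<sigma> (lf \<alpha>) = 0"
    using \<sigma>_root[OF \<alpha>(1)] \<delta>(2) by (simp add: a_def root_poly_eq_0_iff span_zero)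
  have iff: "lf \<alpha> dvd p \<longleftrightarrow> ?\<sigma> p = 0" for p
  proof
    assume "lf \<alpha> dvd p"
    then show "?\<sigma> p = 0" using zero by (auto simp: dvd_def single_hom.poly_eval_mult)
  next
    assume "?\<sigma> p = 0"
    then show "lf \<alpha> dvd p" using dvd[of p] by simp
  qed
  show thesis
    by (rule that[of \<phi>, OF dvd iff]) (use \<sigma>_root in blast)
qed

text \<open>The quotient by \<open>lf \<alpha>\<close> embeds into the polynomial ring through the
  substitution \<open>\<phi>\<close>, so it has no zero divisors.\<close>

lemma prime_root_poly:
  assumes \<alpha>: "\<alpha> \<in> span \<Delta>" "\<alpha> \<noteq> 0"
  shows "prime_elem (lf \<alpha>)"
proof (rule quotient_hom[OF \<alpha>])
  fix \<phi> :: "'a \<Rightarrow> 'a rpoly"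
  let ?\<sigma> = "poly_eval scalar \<phi>"
  assume \<phi>: "\<And>p. lf \<alpha> dvd p \<longleftrightarrow> ?\<sigma> p = 0"
  show ?thesis
  proof (rule prime_elemI)
    show "lf \<alpha> \<noteq> 0" using \<alpha> by (simp add: root_poly_eq_0_iff)
    show "\<not> lf \<alpha> dvd 1" by (simp add: \<phi>)
    show "lf \<alpha> dvd p \<or> lf \<alpha> dvd q" if "lf \<alpha> dvd p * q" for p q
      using that rpoly_no_zero_divisors[of "?\<sigma> p" "?\<sigma> q"]
      by (simp only: \<phi> single_hom.poly_eval_mult) blast
  qed
qed

text \<open>Modulo \<open>\<alpha>\<close> the form \<open>\<beta>\<close> becomes
  \<open>\<beta> - c \<alpha>\<close>, and a linear form vanishes only for the zero vector.\<close>

lemma root_poly_dvd_root_poly: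
  assumes "\<alpha> \<in> span \<Delta>" "\<alpha> \<noteq> 0" "\<beta> \<in> span \<Delta>" "lf \<alpha> dvd lf \<beta>"
  shows "\<exists>c. \<beta> = c *\<^sub>R \<alpha>"
proof (rule quotient_hom[OF assms(1,2)])
  fix \<phi> :: "'a \<Rightarrow> 'a rpoly"
  let ?\<sigma> = "poly_eval scalar \<phi>"
  assume \<phi>: "\<And>p. lf \<alpha> dvd p \<longleftrightarrow> ?\<sigma> p = 0"
    "\<And>\<beta>. \<beta> \<in> span \<Delta> \<Longrightarrow> \<exists>c. ?\<sigma> (lf \<beta>) = lf (\<beta> - c *\<^sub>R \<alpha>)"
  obtain c where "?\<sigma> (lf \<beta>) = lf (\<beta> - c *\<^sub>R \<alpha>)" using \<phi>(2)[OF assms(3)] by blast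
  moreover have "?\<sigma> (lf \<beta>) = 0" using assms(4) \<phi>(1) by blast
  ultimately have "\<beta> - c *\<^sub>R \<alpha> = 0"
    using assms by (simp add: root_poly_eq_0_iff span_diff span_scale)
  then show ?thesis by auto
qed

lemma root_poly_dvd_cancel:
  assumes "\<alpha> \<in> span \<Delta>" "\<alpha> \<noteq> 0" "\<beta> \<in> span \<Delta>" "\<nexists>c. \<beta> = c *\<^sub>R \<alpha>" "lf \<alpha> dvd lf \<beta> * x"
  shows "lf \<alpha> dvd x"
  using prime_elem_dvd_multD[OF prime_root_poly[OF assms(1,2)] assms(5)] root_poly_dvd_root_poly[OF assms(1-3)] assms(4)
  by blast

text \<open>By induction on \<open>I\<close> only one value \<open>G\<close>, at the linear form \<open>\<alpha>\<close>, is nonzero, and it has to be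
  divisible modulo \<open>\<alpha>\<close> by the product of the other forms. Modulo \<open>\<alpha>\<close> two of them are
  associated iff they span the same plane together with \<open>\<alpha>\<close>, so planes can be treated
  separately.\<close>

theorem lift_from_planes:
  fixes F :: "'a \<Rightarrow> 'a rpoly"
  assumes "finite I" "I \<subseteq> span \<Delta>" "0 \<notin> I"
    and "\<And>\<alpha> \<beta> c. \<alpha> \<in> I \<Longrightarrow> \<beta> \<in> I \<Longrightarrow> \<beta> = c *\<^sub>R \<alpha> \<Longrightarrow> \<alpha> = \<beta>"
    and "\<And>\<alpha> \<beta>. \<alpha> \<in> I \<Longrightarrow> \<beta> \<in> I \<Longrightarrow> \<alpha> \<noteq> \<beta> \<Longrightarrow> \<exists>f. \<forall>\<delta>\<in>I \<inter> span {\<alpha>, \<beta>}. lf \<delta> dvd f - F \<delta>"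
  shows "\<exists>f. \<forall>\<delta>\<in>I. lf \<delta> dvd f - F \<delta>"
  using assms
proof (induction I rule: finite_induct)
  case (insert \<alpha> I)
  have \<alpha>: "\<alpha> \<in> span \<Delta>" "\<alpha> \<noteq> 0" using insert.prems(1,2) by auto
  have I: "\<beta> \<in> span \<Delta>" "\<beta> \<noteq> 0" if "\<beta> \<in> I" for \<beta> using insert.prems(1,2) that by auto
  have "\<exists>f. \<forall>\<delta>\<in>I. lf \<delta> dvd f - F \<delta>"
  proof (rule insert.IH)
    fix \<beta> \<gamma> assume "\<beta> \<in> I" "\<gamma> \<in> I" "\<beta> \<noteq> \<gamma>"
    then show "\<exists>f. \<forall>\<delta>\<in>I \<inter> span {\<beta>, \<gamma>}. lf \<delta> dvd f - F \<delta>"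
      using insert.prems(4)[of \<beta> \<gamma>] by blast
  next
    fix \<beta> \<gamma> c assume "\<beta> \<in> I" "\<gamma> \<in> I" "\<gamma> = c *\<^sub>R \<beta>"
    then show "\<beta> = \<gamma>" using insert.prems(3)[of \<beta> \<gamma> c] by blast
  qed (use insert.prems(1,2) in auto)
  then obtain f where f: "\<And>\<delta>. \<delta> \<in> I \<Longrightarrow> lf \<delta> dvd f - F \<delta>" by blast
  define G where "G = F \<alpha> - f"
  obtain \<phi> where \<phi>: "\<And>p. lf \<alpha> dvd p - poly_eval scalar \<phi> p"
    "\<And>p. lf \<alpha> dvd p \<longleftrightarrow> poly_eval scalar \<phi> p = 0"
    "\<And>\<beta>. \<beta> \<in> span \<Delta> \<Longrightarrow> \<exists>c. poly_eval scalar \<phi> (lf \<beta>) = lf (\<beta> - c *\<^sub>R \<alpha>)"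
    by (rule quotient_hom[OF \<alpha>], rule that) auto
  let ?\<sigma> = "poly_eval scalar \<phi>"
  have nonprop: "\<beta> \<noteq> c *\<^sub>R \<alpha>" if "\<beta> \<in> I" for \<beta> c
    using insert.prems(3)[of \<alpha> \<beta> c] insert.hyps that by auto
  have "\<forall>\<beta>\<in>I. \<exists>c. ?\<sigma> (lf \<beta>) = lf (\<beta> - c *\<^sub>R \<alpha>)"
    using \<phi>(3) I(1) by blast
  from bchoice[OF this] obtain c
    where c: "\<And>\<beta>. \<beta> \<in> I \<Longrightarrow> ?\<sigma> (lf \<beta>) = lf (\<beta> - c \<beta> *\<^sub>R \<alpha>)" by blast
  have c_span: "\<beta> - c \<beta> *\<^sub>R \<alpha> \<in> span \<Delta>" "\<beta> - c \<beta> *\<^sub>R \<alpha> \<noteq> 0" if "\<beta> \<in> I" for \<beta>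
    using that I \<alpha> nonprop by (auto intro: span_diff span_scale)
  define R where "R \<beta> \<gamma> \<longleftrightarrow> span {\<alpha>, \<beta>} = span {\<alpha>, \<gamma>}" for \<beta> \<gamma>
  have "(\<Prod>\<beta>\<in>I. ?\<sigma> (lf \<beta>)) dvd ?\<sigma> G"
  proof (rule prod_dvd_by_classes[where R = R])
    show "equivp R" by (rule equivpI) (auto simp: R_def reflp_def symp_def transp_def)
  next
    fix \<beta> assume "\<beta> \<in> I"
    then show "prime_elem (?\<sigma> (lf \<beta>))" using c c_span by (simp add: prime_root_poly)
  next
    fix \<beta> \<gamma> assume \<beta>\<gamma>: "\<beta> \<in> I" "\<gamma> \<in> I" "?\<sigma> (lf \<beta>) dvd ?\<sigma> (lf \<gamma>)"
    then obtain k where "\<gamma> - c \<gamma> *\<^sub>R \<alpha> = k *\<^sub>R (\<beta> - c \<beta> *\<^sub>R \<alpha>)"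
      using root_poly_dvd_root_poly[of "\<beta> - c \<beta> *\<^sub>R \<alpha>" "\<gamma> - c \<gamma> *\<^sub>R \<alpha>"] c c_span by auto
    then have \<gamma>: "\<gamma> = k *\<^sub>R \<beta> + (c \<gamma> - k * c \<beta>) *\<^sub>R \<alpha>"
      by (simp add: algebra_simps)
    have "k \<noteq> 0" using \<gamma> nonprop[OF \<open>\<gamma> \<in> I\<close>, of "c \<gamma>"] by auto
    then have \<beta>: "\<beta> = (1 / k) *\<^sub>R \<gamma> + (- (c \<gamma> - k * c \<beta>) / k) *\<^sub>R \<alpha>"
      by (subst \<gamma>) (simp add: scaleR_add_right divide_simps flip: scaleR_add_left)
    have "\<gamma> \<in> span {\<alpha>, \<beta>}" "\<beta> \<in> span {\<alpha>, \<gamma>}"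
      by (subst \<gamma>, intro span_add span_scale span_base; simp)
        (subst \<beta>, intro span_add span_scale span_base; simp)
    then show "R \<beta> \<gamma>"
      unfolding R_def by (intro subset_antisym span_minimal subspace_span) (auto intro: span_base)
  next
    fix \<beta> assume \<beta>: "\<beta> \<in> I"
    define K where "K = {\<gamma>\<in>I. R \<beta> \<gamma>}"
    have K: "K \<subseteq> I" "finite K" using insert.hyps by (auto simp: K_def)
    have K_span: "K \<subseteq> span {\<alpha>, \<beta>}"
    proof
      fix \<gamma> assume "\<gamma> \<in> K"
      then have "span {\<alpha>, \<beta>} = span {\<alpha>, \<gamma>}" by (simp add: K_def R_def)
      then show "\<gamma> \<in> span {\<alpha>, \<beta>}" by (simp only:) (simp add: span_base)
    qed
    have "\<alpha> \<noteq> \<beta>" using \<beta> insert.hyps by blast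
    \<comment> \<open>On \<open>K\<close> both \<open>g\<close> and \<open>f\<close> have the
      residues \<open>F\<close>, so \<open>g - f\<close> is divisible by the product of these
      pairwise non-proportional forms. Modulo \<open>\<alpha>\<close>, where \<open>g\<close> agrees
      with \<open>F \<alpha>\<close>, this difference is \<open>G\<close>.\<close>
    then obtain g where "\<forall>\<delta>\<in>insert \<alpha> I \<inter> span {\<alpha>, \<beta>}. lf \<delta> dvd g - F \<delta>"
      using insert.prems(4)[of \<alpha> \<beta>] \<beta> by blast
    then have g: "lf \<delta> dvd g - F \<delta>" if "\<delta> \<in> insert \<alpha> I" "\<delta> \<in> span {\<alpha>, \<beta>}" for \<delta>
      using that by blast
    have "(\<Prod>\<delta>\<in>K. lf \<delta>) dvd g - f"
    proof (rule prod_dvd_by_classes[where R = "(=)"])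
      fix \<delta> assume "\<delta> \<in> K"
      then have "lf \<delta> dvd (g - F \<delta>) - (f - F \<delta>)"
        using g[of \<delta>] f[of \<delta>] K K_span by (intro dvd_diff[OF g f]) auto
      moreover have "{j \<in> K. \<delta> = j} = {\<delta>}" using \<open>\<delta> \<in> K\<close> by auto
      ultimately show "(\<Prod>j\<in>{j \<in> K. \<delta> = j}. lf j) dvd g - f" by simp
    next
      fix \<delta> \<gamma> assume "\<delta> \<in> K" "\<gamma> \<in> K" "lf \<delta> dvd lf \<gamma>"
      then show "\<delta> = \<gamma>"
        using root_poly_dvd_root_poly[of \<delta> \<gamma>] I K insert.prems(3)[of \<delta> \<gamma>] by blast
    qed (use K I in \<open>auto intro: prime_root_poly identity_equivp\<close>)
    then have "?\<sigma> (\<Prod>\<delta>\<in>K. lf \<delta>) dvd ?\<sigma> (g - f)"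
      by (rule single_hom.poly_eval_dvd)
    moreover have "?\<sigma> (g - F \<alpha>) = 0"
      using g[of \<alpha>] \<phi>(2) by (simp add: span_base)
    ultimately show "(\<Prod>j\<in>{j \<in> I. R \<beta> j}. ?\<sigma> (lf j)) dvd ?\<sigma> G"
      by (simp add: K_def G_def single_hom.poly_eval_prod single_hom.poly_eval_diff)
  qed (use insert.hyps in simp)
  \<comment> \<open>Adding \<open>d\<close> times the product of the forms in \<open>I\<close>
    corrects the residue at \<open>\<alpha>\<close> and leaves those at \<open>I\<close>
    unchanged.\<close>
  then obtain d where d: "?\<sigma> G = (\<Prod>\<beta>\<in>I. ?\<sigma> (lf \<beta>)) * d" by (auto elim: dvdE)
  have "lf \<alpha> dvd (\<Prod>\<beta>\<in>I. lf \<beta>) * d - ?\<sigma> G"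
  proof -
    let ?Q = "\<Prod>\<beta>\<in>I. lf \<beta>"
    have "?Q * d - ?\<sigma> G = (?Q - ?\<sigma> ?Q) * d"
      by (simp add: d single_hom.poly_eval_prod left_diff_distrib)
    then show ?thesis using \<phi>(1) by simp
  qed
  then have "lf \<alpha> dvd ((\<Prod>\<beta>\<in>I. lf \<beta>) * d - ?\<sigma> G) - (G - ?\<sigma> G)"
    using \<phi>(1) by (rule dvd_diff)
  then have "lf \<alpha> dvd f + (\<Prod>\<beta>\<in>I. lf \<beta>) * d - F \<alpha>"
    by (simp add: G_def algebra_simps)
  moreover have "lf \<delta> dvd f + (\<Prod>\<beta>\<in>I. lf \<beta>) * d - F \<delta>" if "\<delta> \<in> I" for \<delta>
  proof -
    have "lf \<delta> dvd (\<Prod>\<beta>\<in>I. lf \<beta>)" using that insert.hyps by (intro dvd_prodI)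
    then have "lf \<delta> dvd (f - F \<delta>) + (\<Prod>\<beta>\<in>I. lf \<beta>) * d"
      using f[OF that] by (intro dvd_add) auto
    then show ?thesis by (simp add: algebra_simps)
  qed
  ultimately show ?case by (intro exI[of _ "f + (\<Prod>\<beta>\<in>I. lf \<beta>) * d"]) auto
qed simp

end

section \<open>Reflections and the Weyl group\<close>

lemma linear_refl: "linear (refl \<alpha>)"
  unfolding refl_def
  by (rule linearI) (simp_all add: inner_add_left algebra_simps add_divide_distrib flip: scaleR_add_left)

lemma refl_add: "refl \<alpha> (x + y) = refl \<alpha> x + refl \<alpha> y"
  and refl_scale: "refl \<alpha> (c *\<^sub>R x) = c *\<^sub>R refl \<alpha> x"
  using linear_refl[of \<alpha>] by (simp_all add: linear_add linear_scale)

lemma refl_self [simp]: "refl \<alpha> \<alpha> = - \<alpha>"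
  by (cases "\<alpha> = 0") (simp_all add: refl_def scaleR_2)

lemma refl_uminus: "refl (- \<alpha>) = refl \<alpha>"
  by (simp add: refl_def fun_eq_iff)

lemma inner_refl_self: "refl \<alpha> x \<bullet> \<alpha> = - (x \<bullet> \<alpha>)"
  by (cases "\<alpha> = 0") (simp_all add: refl_def inner_diff_left)

lemma refl_refl [simp]: "refl \<alpha> (refl \<alpha> x) = x"
  by (simp add: refl_def[of \<alpha> "refl \<alpha> x"] inner_refl_self) (simp add: refl_def)

lemma refl_comp_refl_comp [simp]: "w \<circ> refl \<alpha> \<circ> refl \<alpha> = w" "refl \<alpha> \<circ> (refl \<alpha> \<circ> w) = w"
  by (simp_all add: fun_eq_iff)

lemma refl_inner_refl: "refl \<alpha> x \<bullet> refl \<alpha> y = x \<bullet> y"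
proof -
  have "refl \<alpha> x \<bullet> refl \<alpha> y = refl \<alpha> x \<bullet> y - (2 * (y \<bullet> \<alpha>) / (\<alpha> \<bullet> \<alpha>)) * (refl \<alpha> x \<bullet> \<alpha>)"
    unfolding refl_def[of \<alpha> y] by (simp add: inner_diff_right)
  also have "\<dots> = x \<bullet> y"
    unfolding inner_refl_self by (simp add: refl_def inner_diff_left) (simp add: inner_commute)
  finally show ?thesis .
qed

lemma orthogonal_refl: "orthogonal_transformation (refl \<alpha>)"
  by (simp add: orthogonal_transformation_def linear_refl refl_inner_refl)

lemma orthogonal_refl_conj:
  assumes "orthogonal_transformation g"
  shows "g (refl \<beta> x) = refl (g \<beta>) (g x)"
  using assms by (simp add: orthogonal_transformation_def refl_def linear_diff linear_scale)

lemma orthogonal_comp_refl: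
  "orthogonal_transformation g \<Longrightarrow> g \<circ> refl \<beta> = refl (g \<beta>) \<circ> g"
  by (simp add: fun_eq_iff orthogonal_refl_conj)

section \<open>Positive roots, the height functional and the group\<close>

locale root_system = base \<Delta> for \<Delta> :: "'a::euclidean_space set" +
  fixes \<Phi> :: "'a set"
  assumes crys: "crystallographic_root_system \<Phi>" and is_base: "is_base \<Phi> \<Delta>"
begin

abbreviation "W \<equiv> weyl_group \<Delta>"
abbreviation "\<Phi>p \<equiv> positive_roots \<Phi> \<Delta>"

lemma finite_roots: "finite \<Phi>" and zero_not_root: "0 \<notin> \<Phi>"
  and root_multiple: "\<alpha> \<in> \<Phi> \<Longrightarrow> c *\<^sub>R \<alpha> \<in> \<Phi> \<Longrightarrow> c = 1 \<or> c = - 1"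
  and refl_root: "\<alpha> \<in> \<Phi> \<Longrightarrow> \<beta> \<in> \<Phi> \<Longrightarrow> refl \<alpha> \<beta> \<in> \<Phi>"
  and cartan_int: "\<alpha> \<in> \<Phi> \<Longrightarrow> \<beta> \<in> \<Phi> \<Longrightarrow> 2 * (\<beta> \<bullet> \<alpha>) / (\<alpha> \<bullet> \<alpha>) \<in> \<int>"
  using crys unfolding crystallographic_root_system_def by blast+

lemma base_root: "\<delta> \<in> \<Delta> \<Longrightarrow> \<delta> \<in> \<Phi>"
  using is_base unfolding is_base_def by blast

lemma neg_root: "\<beta> \<in> \<Phi> \<Longrightarrow> - \<beta> \<in> \<Phi>"
  using refl_root[of \<beta> \<beta>] by simp

lemma root_span: "\<beta> \<in> \<Phi> \<Longrightarrow> \<beta> \<in> span \<Delta>"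
proof -
  assume "\<beta> \<in> \<Phi>"
  then obtain c where "\<beta> = (\<Sum>\<delta>\<in>\<Delta>. c \<delta> *\<^sub>R \<delta>)" using is_base unfolding is_base_def by blast
  then show ?thesis by (simp add: span_sum span_scale span_base)
qed

lemma representation_lincomb:
  assumes "\<beta> = (\<Sum>\<delta>\<in>\<Delta>. c \<delta> *\<^sub>R \<delta>)" "\<delta> \<in> \<Delta>"
  shows "representation \<Delta> \<beta> \<delta> = c \<delta>"
proof -
  have "representation \<Delta> \<beta> \<delta> = (\<Sum>x\<in>\<Delta>. if x = \<delta> then c x else 0)"
    unfolding assms(1) using indep
    by (subst representation_sum)
      (auto simp: representation_scale representation_basis span_scale span_base intro!: sum.cong)
  then show ?thesis using assms(2) finite_base by simp
qed

lemma root_coords: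
  assumes "\<beta> \<in> \<Phi>"
  shows "(\<forall>\<delta>\<in>\<Delta>. representation \<Delta> \<beta> \<delta> \<ge> 0) \<or> (\<forall>\<delta>\<in>\<Delta>. representation \<Delta> \<beta> \<delta> \<le> 0)"
proof -
  obtain c where "\<beta> = (\<Sum>\<delta>\<in>\<Delta>. c \<delta> *\<^sub>R \<delta>)" "(\<forall>\<delta>\<in>\<Delta>. c \<delta> \<ge> 0) \<or> (\<forall>\<delta>\<in>\<Delta>. c \<delta> \<le> 0)"
    using is_base assms unfolding is_base_def by blast
  then show ?thesis by (simp add: representation_lincomb)
qed

lemma sum_representation: "\<beta> \<in> span \<Delta> \<Longrightarrow> (\<Sum>\<delta>\<in>\<Delta>. representation \<Delta> \<beta> \<delta> *\<^sub>R \<delta>) = \<beta>"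
  using sum_representation_eq[OF indep _ finite_base order_refl] by simp

text \<open>The pairing with this vector is the height, not the pairing with the half sum of the
  positive roots. Its sign on a root decides positivity.\<close>

definition \<rho> :: 'a where "\<rho> = (SOME r. \<forall>\<delta>\<in>\<Delta>. \<delta> \<bullet> r = 1)"

lemma rho_base: "\<delta> \<in> \<Delta> \<Longrightarrow> \<delta> \<bullet> \<rho> = 1"
proof -
  obtain f :: "'a \<Rightarrow> real" where f: "linear f" "\<And>x. x \<in> \<Delta> \<Longrightarrow> f x = 1"
    using linear_independent_extend[OF indep, of "\<lambda>_. 1::real"] by auto
  have "\<delta> \<bullet> adjoint f 1 = 1" if "\<delta> \<in> \<Delta>" for \<delta>
    using adjoint_works[OF f(1), of \<delta> 1] f(2)[OF that] by (simp add: inner_commute)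
  then have "\<exists>r. \<forall>\<delta>\<in>\<Delta>. \<delta> \<bullet> r = 1" by blast
  then have "\<forall>\<delta>\<in>\<Delta>. \<delta> \<bullet> \<rho> = 1" unfolding \<rho>_def by (rule someI_ex)
  then show "\<delta> \<in> \<Delta> \<Longrightarrow> \<delta> \<bullet> \<rho> = 1" by blast
qed

lemma inner_rho: "\<beta> \<in> span \<Delta> \<Longrightarrow> \<beta> \<bullet> \<rho> = (\<Sum>\<delta>\<in>\<Delta>. representation \<Delta> \<beta> \<delta>)"
  by (subst sum_representation[symmetric], assumption) (simp add: inner_sum_left rho_base)

text \<open>The coordinates of a root have one sign and do not all vanish, so the sign of their sum
  determines them.\<close>

lemma positive_root_iff: "\<beta> \<in> \<Phi>p \<longleftrightarrow> \<beta> \<in> \<Phi> \<and> \<beta> \<bullet> \<rho> > 0"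
proof -
  have pos: "\<beta> \<bullet> \<rho> > 0" if "\<beta> \<in> \<Phi>" "\<forall>\<delta>\<in>\<Delta>. representation \<Delta> \<beta> \<delta> \<ge> 0" for \<beta>
  proof -
    have "(\<Sum>\<delta>\<in>\<Delta>. representation \<Delta> \<beta> \<delta>) \<noteq> 0"
    proof
      assume "(\<Sum>\<delta>\<in>\<Delta>. representation \<Delta> \<beta> \<delta>) = 0"
      then have "\<forall>\<delta>\<in>\<Delta>. representation \<Delta> \<beta> \<delta> = 0"
        using that finite_base by (simp add: sum_nonneg_eq_0_iff)
      then have "\<beta> = 0" using sum_representation[OF root_span[OF that(1)]] by simp
      then show False using that zero_not_root by simp
    qed
    moreover have "(\<Sum>\<delta>\<in>\<Delta>. representation \<Delta> \<beta> \<delta>) \<ge> 0" using that by (simp add: sum_nonneg)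
    ultimately show ?thesis using that by (simp add: inner_rho root_span)
  qed
  show ?thesis
  proof
    assume "\<beta> \<in> \<Phi>p"
    then show "\<beta> \<in> \<Phi> \<and> \<beta> \<bullet> \<rho> > 0"
      using pos unfolding positive_roots_def by (auto simp: representation_lincomb)
  next
    assume \<beta>: "\<beta> \<in> \<Phi> \<and> \<beta> \<bullet> \<rho> > 0"
    have "\<not> (\<forall>\<delta>\<in>\<Delta>. representation \<Delta> \<beta> \<delta> \<le> 0)"
      using \<beta> inner_rho[OF root_span] sum_nonpos[of \<Delta> "representation \<Delta> \<beta>"] by force
    then have "\<forall>\<delta>\<in>\<Delta>. representation \<Delta> \<beta> \<delta> \<ge> 0" using root_coords \<beta> by blast
    then show "\<beta> \<in> \<Phi>p"
      unfolding positive_roots_def using \<beta> sum_representation[OF root_span, of \<beta>] by force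
  qed
qed

lemma positive_root: "\<beta> \<in> \<Phi>p \<Longrightarrow> \<beta> \<in> \<Phi>" "\<beta> \<in> \<Phi>p \<Longrightarrow> \<beta> \<bullet> \<rho> > 0"
  by (simp_all add: positive_root_iff)

lemma root_cases: "\<beta> \<in> \<Phi> \<Longrightarrow> \<beta> \<in> \<Phi>p \<or> - \<beta> \<in> \<Phi>p"
proof -
  assume \<beta>: "\<beta> \<in> \<Phi>"
  consider "\<forall>\<delta>\<in>\<Delta>. representation \<Delta> \<beta> \<delta> \<ge> 0" | "\<forall>\<delta>\<in>\<Delta>. representation \<Delta> (- \<beta>) \<delta> \<ge> 0"
    using root_coords[OF \<beta>] representation_neg[OF indep root_span[OF \<beta>]] by force
  then show ?thesis
    using \<beta> neg_root[OF \<beta>] sum_representation[OF root_span[OF \<beta>], symmetric]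
      sum_representation[OF root_span[OF neg_root[OF \<beta>]], symmetric]
    unfolding positive_roots_def by cases blast+
qed

lemma root_inner_rho_nonzero: "\<beta> \<in> \<Phi> \<Longrightarrow> \<beta> \<bullet> \<rho> \<noteq> 0"
  using root_cases[of \<beta>] positive_root(2)[of \<beta>] positive_root(2)[of "- \<beta>"] by auto

lemma weyl_orthogonal: "w \<in> W \<Longrightarrow> orthogonal_transformation w"
proof (induction rule: weyl_group.induct)
  case weyl_id
  then show ?case by (simp add: orthogonal_transformation_def linear_id)
next
  case (weyl_step w \<delta>)
  then show ?case by (intro orthogonal_transformation_compose orthogonal_refl)
qed

lemma weyl_linear: "w \<in> W \<Longrightarrow> linear w"
  using weyl_orthogonal orthogonal_transformation_linear by blast

lemma weyl_inner: "w \<in> W \<Longrightarrow> w x \<bullet> w y = x \<bullet> y"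
  using weyl_orthogonal orthogonal_transformation_def by blast

lemma weyl_root: "w \<in> W \<Longrightarrow> \<beta> \<in> \<Phi> \<Longrightarrow> w \<beta> \<in> \<Phi>"
  by (induction rule: weyl_group.induct) (auto intro: refl_root base_root)

lemma weyl_comp: "v \<in> W \<Longrightarrow> w \<in> W \<Longrightarrow> v \<circ> w \<in> W"
  by (induction rule: weyl_group.induct) (auto simp: comp_assoc intro: weyl_group.intros)

text \<open>A positive root that is not simple has positive inner product with some simple
  \<open>\<delta>\<close>. Then \<open>s_\<delta>\<close> makes it a positive root of smaller
  height, and the two reflections are conjugate by \<open>s_\<delta>\<close>.\<close>

lemma refl_weyl_positive: "\<beta> \<in> \<Phi>p \<Longrightarrow> refl \<beta> \<in> W"
proof (induction "card {\<gamma>\<in>\<Phi>p. \<gamma> \<bullet> \<rho> < \<beta> \<bullet> \<rho>}" arbitrary: \<beta> rule: less_induct)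
  case less
  note \<beta> = positive_root[OF less.prems]
  note span = root_span[OF \<beta>(1)]
  show ?case
  proof (cases "\<beta> \<in> \<Delta>")
    case True
    then show ?thesis using weyl_step[OF weyl_id, of \<beta> \<Delta>] by simp
  next
    case False
    have nonneg: "\<forall>\<delta>\<in>\<Delta>. representation \<Delta> \<beta> \<delta> \<ge> 0"
      using less.prems unfolding positive_roots_def by (auto simp: representation_lincomb)
    have "\<exists>\<delta>\<in>\<Delta>. \<beta> \<bullet> \<delta> > 0"
    proof (rule ccontr)
      assume neg: "\<not> ?thesis"
      have "\<beta> \<bullet> \<beta> = (\<Sum>\<delta>\<in>\<Delta>. representation \<Delta> \<beta> \<delta> * (\<beta> \<bullet> \<delta>))"
        by (subst (2) sum_representation[OF span, symmetric]) (simp add: inner_sum_right)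
      also have "\<dots> \<le> 0"
        using neg nonneg by (intro sum_nonpos mult_nonneg_nonpos) (auto simp: not_less)
      finally have "\<beta> = 0" using inner_ge_zero[of \<beta>] by (metis inner_eq_zero_iff order_antisym)
      then show False using \<beta> zero_not_root by simp
    qed
    then obtain \<delta> where \<delta>: "\<delta> \<in> \<Delta>" "\<beta> \<bullet> \<delta> > 0" by blast
    define k where "k = 2 * (\<beta> \<bullet> \<delta>) / (\<delta> \<bullet> \<delta>)"
    have "\<delta> \<noteq> 0" using \<delta> by auto
    then have "k > 0" using \<delta> by (simp add: k_def)
    define \<gamma> where "\<gamma> = refl \<delta> \<beta>"
    have \<gamma>: "\<gamma> = \<beta> - k *\<^sub>R \<delta>" by (simp add: \<gamma>_def refl_def k_def)
    have \<gamma>_root: "\<gamma> \<in> \<Phi>" unfolding \<gamma>_def by (rule refl_root[OF base_root[OF \<delta>(1)] \<beta>(1)])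
    \<comment> \<open>Some other simple root occurs in \<open>\<beta>\<close>; its coefficient is
      untouched by \<open>s_\<delta>\<close> and keeps \<open>\<gamma>\<close> positive.\<close>
    have "\<exists>\<epsilon>\<in>\<Delta>. \<epsilon> \<noteq> \<delta> \<and> representation \<Delta> \<beta> \<epsilon> \<noteq> 0"
    proof (rule ccontr)
      assume "\<not> ?thesis"
      then have "(\<Sum>\<epsilon>\<in>\<Delta>. representation \<Delta> \<beta> \<epsilon> *\<^sub>R \<epsilon>)
          = (\<Sum>\<epsilon>\<in>\<Delta>. if \<epsilon> = \<delta> then representation \<Delta> \<beta> \<delta> *\<^sub>R \<delta> else 0)"
        by (intro sum.cong) auto
      then have eq: "\<beta> = representation \<Delta> \<beta> \<delta> *\<^sub>R \<delta>"
        using \<delta> finite_base by (simp add: sum_representation[OF span])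
      then have "representation \<Delta> \<beta> \<delta> = 1 \<or> representation \<Delta> \<beta> \<delta> = - 1"
        using root_multiple[OF base_root[OF \<delta>(1)]] \<beta>(1) by metis
      then show False using eq nonneg \<delta> False by (metis neg_0_le_iff_le not_one_le_zero scaleR_one)
    qed
    then obtain \<epsilon> where \<epsilon>: "\<epsilon> \<in> \<Delta>" "\<epsilon> \<noteq> \<delta>" "representation \<Delta> \<beta> \<epsilon> \<noteq> 0" by blast
    have "representation \<Delta> \<gamma> \<epsilon> = representation \<Delta> \<beta> \<epsilon>"
      using \<epsilon> \<delta> span
      by (simp add: \<gamma> representation_diff[OF indep] representation_scale[OF indep] span_scale
          span_base representation_basis[OF indep])
    then have "\<not> (\<forall>\<delta>\<in>\<Delta>. representation \<Delta> \<gamma> \<delta> \<le> 0)"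
      using \<epsilon> nonneg by force
    then have "\<forall>\<delta>\<in>\<Delta>. representation \<Delta> \<gamma> \<delta> \<ge> 0" using root_coords[OF \<gamma>_root] by blast
    then have \<gamma>_pos: "\<gamma> \<in> \<Phi>p"
      unfolding positive_roots_def using \<gamma>_root sum_representation[OF root_span[OF \<gamma>_root]] by force
    have lt: "\<gamma> \<bullet> \<rho> < \<beta> \<bullet> \<rho>"
      using \<open>k > 0\<close> \<delta> by (simp add: \<gamma> inner_diff_left rho_base)
    have "card {\<eta>\<in>\<Phi>p. \<eta> \<bullet> \<rho> < \<gamma> \<bullet> \<rho>} < card {\<eta>\<in>\<Phi>p. \<eta> \<bullet> \<rho> < \<beta> \<bullet> \<rho>}"
    proof (rule psubset_card_mono)
      show "finite {\<eta>\<in>\<Phi>p. \<eta> \<bullet> \<rho> < \<beta> \<bullet> \<rho>}"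
        by (rule finite_subset[OF _ finite_roots]) (auto simp: positive_root_iff)
      show "{\<eta>\<in>\<Phi>p. \<eta> \<bullet> \<rho> < \<gamma> \<bullet> \<rho>} \<subset> {\<eta>\<in>\<Phi>p. \<eta> \<bullet> \<rho> < \<beta> \<bullet> \<rho>}"
        using lt \<gamma>_pos by force
    qed
    then have "refl \<gamma> \<in> W" using less.hyps \<gamma>_pos by blast
    moreover have "refl \<delta> \<in> W" using weyl_step[OF weyl_id \<delta>(1)] by simp
    moreover have "refl \<beta> = refl \<delta> \<circ> (refl \<gamma> \<circ> refl \<delta>)"
      using orthogonal_comp_refl[OF orthogonal_refl, of \<delta> \<beta>] by (simp add: \<gamma>_def flip: comp_assoc)
        (metis comp_assoc refl_comp_refl_comp(2))
    ultimately show ?thesis by (simp add: weyl_comp)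
  qed
qed

lemma refl_weyl: "\<beta> \<in> \<Phi> \<Longrightarrow> refl \<beta> \<in> W"
  using root_cases[of \<beta>] refl_weyl_positive[of \<beta>] refl_weyl_positive[of "- \<beta>"] refl_uminus[of \<beta>] by auto

lemma weyl_comp_refl: "w \<in> W \<Longrightarrow> \<beta> \<in> \<Phi> \<Longrightarrow> w \<circ> refl \<beta> \<in> W"
  by (intro weyl_comp refl_weyl)

lemma weyl_image_roots: "w \<in> W \<Longrightarrow> w ` \<Phi> = \<Phi>"
  by (rule card_subset_eq[OF finite_roots])
    (auto intro: weyl_root card_image inj_on_subset[OF orthogonal_transformation_inj] weyl_orthogonal)

lemma weyl_span: "w \<in> W \<Longrightarrow> v \<in> span \<Delta> \<Longrightarrow> w v \<in> span \<Delta>"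
  by (subst sum_representation[symmetric], assumption)
    (simp add: linear_sum[OF weyl_linear] linear_scale[OF weyl_linear] span_sum span_scale root_span
      weyl_root base_root)

lemma weyl_diff_span: "w \<in> W \<Longrightarrow> w v - v \<in> span \<Delta>"
proof (induction rule: weyl_group.induct)
  case (weyl_step w \<delta>)
  have "(refl \<delta> \<circ> w) v - v = (w v - v) - (2 * (w v \<bullet> \<delta>) / (\<delta> \<bullet> \<delta>)) *\<^sub>R \<delta>"
    by (simp add: refl_def)
  then show ?case 
    using span_diff[OF weyl_step.IH span_scale[OF span_base[OF weyl_step.hyps(2)]]] by (simp only:)
qed (simp add: span_zero)

text \<open>The roots need not span the space. But \<open>u v - w v\<close> lies in
  \<open>span \<Delta>\<close>, and it is orthogonal to every root
  \<open>u \<gamma> = w \<gamma>\<close>, since \<open>u\<close> and \<open>w\<close> are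
  isometries.\<close>

lemma weyl_eqI:
  assumes "u \<in> W" "w \<in> W" "\<And>\<beta>. \<beta> \<in> \<Phi> \<Longrightarrow> u \<beta> = w \<beta>"
  shows "u = w"
proof
  fix v
  define x where "x = u v - w v"
  have "x \<in> span \<Delta>"
    using span_diff[OF weyl_diff_span[OF assms(1)] weyl_diff_span[OF assms(2)], of v v] by (simp add: x_def)
  have "x \<bullet> \<beta> = 0" if "\<beta> \<in> \<Phi>" for \<beta>
  proof -
    have "\<beta> \<in> u ` \<Phi>" using that by (simp only: weyl_image_roots[OF assms(1)])
    then obtain \<gamma> where \<gamma>: "\<gamma> \<in> \<Phi>" "\<beta> = u \<gamma>" by (rule imageE)
    have "x \<bullet> \<beta> = u v \<bullet> u \<gamma> - w v \<bullet> w \<gamma>"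
      unfolding \<gamma>(2) x_def inner_diff_left by (simp only: assms(3)[OF \<gamma>(1)])
    then show ?thesis by (simp only: weyl_inner[OF assms(1)] weyl_inner[OF assms(2)] diff_self)
  qed
  then have "x \<bullet> (\<Sum>\<delta>\<in>\<Delta>. representation \<Delta> x \<delta> *\<^sub>R \<delta>) = 0"
    by (simp add: inner_sum_right base_root)
  then have "x \<bullet> x = 0" by (simp only: sum_representation[OF \<open>x \<in> span \<Delta>\<close>])
  then show "u v = w v" by (simp add: x_def)
qed

lemma finite_weyl: "finite W"
proof (rule finite_imageD)
  show "finite ((\<lambda>w. restrict w \<Phi>) ` W)"
    by (rule finite_subset[of _ "\<Phi> \<rightarrow>\<^sub>E \<Phi>"]) (auto intro: weyl_root finite_PiE finite_roots)
  show "inj_on (\<lambda>w. restrict w \<Phi>) W"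
    by (rule inj_onI, rule weyl_eqI) (auto dest: fun_cong simp: restrict_def split: if_splits)
qed

abbreviation neg :: "'a \<Rightarrow> bool" where "neg x \<equiv> x \<bullet> \<rho> < 0"

text \<open>A real-valued substitute for the length, in the opposite direction: the maximum is
  attained at the identity.\<close>

definition \<psi> :: "('a \<Rightarrow> 'a) \<Rightarrow> real" where "\<psi> w = w \<rho> \<bullet> \<rho>"

text \<open>The reflection changes \<open>\<psi>\<close> by minus the product of the coroot pairing
  of \<open>\<rho>\<close> with \<open>\<beta>\<close>, which is positive, and the height of
  \<open>w \<beta>\<close>, which is negative.\<close>

lemma psi_less:
  assumes "w \<in> W" "\<beta> \<in> \<Phi>p" "neg (w \<beta>)"
  shows "\<psi> w < \<psi> (w \<circ> refl \<beta>)"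
proof -
  have "\<beta> \<bullet> \<beta> > 0" using positive_root[OF assms(2)] zero_not_root by (auto simp: inner_gt_zero_iff)
  then have k: "2 * (\<rho> \<bullet> \<beta>) / (\<beta> \<bullet> \<beta>) > 0"
    using positive_root(2)[OF assms(2)] by (simp add: inner_commute)
  have "\<psi> (w \<circ> refl \<beta>) = \<psi> w - 2 * (\<rho> \<bullet> \<beta>) / (\<beta> \<bullet> \<beta>) * (w \<beta> \<bullet> \<rho>)"
    using weyl_linear[OF assms(1)]
    by (simp add: \<psi>_def refl_def linear_diff linear_scale inner_diff_left)
  then show ?thesis using mult_pos_neg[OF k assms(3)] by simp
qed

end

section \<open>Extension across a vertex in rank two\<close>

lemma span_pair_iff:
  fixes u v :: "'b::real_vector"
  shows "x \<in> span {u, v} \<longleftrightarrow> (\<exists>p q. x = p *\<^sub>R u + q *\<^sub>R v)"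
proof
  assume "x \<in> span {u, v}"
  then show "\<exists>p q. x = p *\<^sub>R u + q *\<^sub>R v"
    unfolding span_insert[of u] span_singleton by (auto simp: diff_eq_eq) (metis add.commute)
qed (auto intro: span_add span_scale span_base)

lemma scaleR_eqD: "p *\<^sub>R x = y \<Longrightarrow> p \<noteq> 0 \<Longrightarrow> x = (1 / p) *\<^sub>R (y :: 'b::real_vector)"
  by auto

section \<open>Congruences at the vertices below a given one\<close>

context root_system
begin

lemma weyl_psi_induct [consumes 1, case_names less]:
  assumes "w \<in> W" and "\<And>w. w \<in> W \<Longrightarrow> (\<And>z. z \<in> W \<Longrightarrow> \<psi> w < \<psi> z \<Longrightarrow> Q z) \<Longrightarrow> Q w"
  shows "Q w"
  using assms(1)
proof (induction "card {z\<in>W. \<psi> w < \<psi> z}" arbitrary: w rule: less_induct)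
  case less
  show ?case
  proof (rule assms(2)[OF less.prems])
    fix z assume z: "z \<in> W" "\<psi> w < \<psi> z"
    have "card {v\<in>W. \<psi> z < \<psi> v} < card {v\<in>W. \<psi> w < \<psi> v}"
      by (rule psubset_card_mono) (use z finite_weyl in force)+
    then show "Q z" using less.hyps z by blast
  qed
qed

text \<open>A step to a smaller element in the Bruhat order, so \<open>below T\<close> leads
  downwards in that order while \<open>\<psi>\<close> grows.\<close>

definition descent :: "'a set \<Rightarrow> ('a \<Rightarrow> 'a) \<Rightarrow> ('a \<Rightarrow> 'a) \<Rightarrow> bool" where
  "descent T u z \<longleftrightarrow> (\<exists>\<beta>\<in>T. neg (u \<beta>) \<and> z = u \<circ> refl \<beta>)"

abbreviation below :: "'a set \<Rightarrow> ('a \<Rightarrow> 'a) \<Rightarrow> ('a \<Rightarrow> 'a) \<Rightarrow> bool" where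
  "below T \<equiv> (descent T)\<^sup>+\<^sup>+"

text \<open>Two sets occur because paths may use all of \<open>T\<close>, whereas congruences hold
  only for the roots in \<open>J\<close>.\<close>

definition gkm_below :: "'a set \<Rightarrow> 'a set \<Rightarrow> ('a \<Rightarrow> 'a) \<Rightarrow> (('a \<Rightarrow> 'a) \<Rightarrow> 'a rpoly) \<Rightarrow> bool" where
  "gkm_below T J w P \<longleftrightarrow>
     (\<forall>z \<beta>. below T w z \<longrightarrow> \<beta> \<in> J \<longrightarrow> neg (z \<beta>) \<longrightarrow> lf (z \<beta>) dvd P z - P (z \<circ> refl \<beta>))"

abbreviation lifts :: "'a set \<Rightarrow> ('a \<Rightarrow> 'a) \<Rightarrow> (('a \<Rightarrow> 'a) \<Rightarrow> 'a rpoly) \<Rightarrow> 'a rpoly \<Rightarrow> bool" where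
  "lifts J w P f \<equiv> (\<forall>\<beta>\<in>J. neg (w \<beta>) \<longrightarrow> lf (w \<beta>) dvd f - P (w \<circ> refl \<beta>))"

definition extendable :: "'a set \<Rightarrow> 'a set \<Rightarrow> ('a \<Rightarrow> 'a) \<Rightarrow> bool" where
  "extendable T J w \<longleftrightarrow> (\<forall>P. gkm_below T J w P \<longrightarrow>
     (\<exists>f. lifts J w P f))"

text \<open>These properties are all that is used of the positive roots of a plane. They are stated
  for an arbitrary set \<open>T\<close>, so that they also apply to the subsystem of short roots in
  G_2.\<close>

definition rank2_base :: "'a set \<Rightarrow> 'a \<Rightarrow> 'a \<Rightarrow> bool" where
  "rank2_base T a b \<longleftrightarrow> T \<subseteq> \<Phi>p \<and> a \<in> T \<and> b \<in> T \<and>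
     (\<forall>p q. p *\<^sub>R a + q *\<^sub>R b = 0 \<longrightarrow> p = 0 \<and> q = 0) \<and>
     (\<forall>\<beta>\<in>T. \<exists>p q. p \<ge> 0 \<and> q \<ge> 0 \<and> \<beta> = p *\<^sub>R a + q *\<^sub>R b) \<and>
     (\<forall>\<beta>\<in>T. \<beta> \<noteq> a \<longrightarrow> refl a \<beta> \<in> T) \<and> (\<forall>\<beta>\<in>T. \<beta> \<noteq> b \<longrightarrow> refl b \<beta> \<in> T)"

lemma rank2_base_commute: "rank2_base T a b \<Longrightarrow> rank2_base T b a"
  unfolding rank2_base_def by (metis add.commute)

lemma below_weyl: "below T w z \<Longrightarrow> w \<in> W \<Longrightarrow> T \<subseteq> \<Phi>p \<Longrightarrow> z \<in> W"
  by (induction rule: tranclp_induct) (auto simp: descent_def intro!: weyl_comp_refl positive_root)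

lemma descent_psi: "descent T w z \<Longrightarrow> w \<in> W \<Longrightarrow> T \<subseteq> \<Phi>p \<Longrightarrow> \<psi> w < \<psi> z"
  unfolding descent_def using psi_less by blast

lemma below_psi: "below T w z \<Longrightarrow> w \<in> W \<Longrightarrow> T \<subseteq> \<Phi>p \<Longrightarrow> \<psi> w < \<psi> z"
proof (induction rule: tranclp_induct)
  case (step y z)
  then have "\<psi> w < \<psi> y" "\<psi> y < \<psi> z" using below_weyl descent_psi by blast+
  then show ?case by simp
qed (rule descent_psi)

lemma below_mono:
  assumes "below T w z" "T \<subseteq> T'"
  shows "below T' w z"
  using assms(1)
proof (induction rule: tranclp_induct)
  case (base y)
  then have "descent T' w y" using assms(2) unfolding descent_def by blast
  then show ?case by (rule tranclp.r_into_trancl[of "descent T'"])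
next
  case (step y z)
  then have "descent T' y z" using assms(2) unfolding descent_def by blast
  with step.IH show ?case by (rule tranclp.trancl_into_trancl[of "descent T'"])
qed

lemma descentI: "\<beta> \<in> T \<Longrightarrow> neg (u \<beta>) \<Longrightarrow> descent T u (u \<circ> refl \<beta>)"
  by (auto simp: descent_def)

lemma belowI: "\<beta> \<in> T \<Longrightarrow> neg (u \<beta>) \<Longrightarrow> below T u (u \<circ> refl \<beta>)"
  by (intro tranclp.r_into_trancl descentI)

lemma below_neg_ex: "below T w z \<Longrightarrow> \<exists>\<beta>\<in>T. neg (w \<beta>)"
  using tranclpD[of "descent T" w z] unfolding descent_def by blast

lemma below_stepI: "below T w u \<Longrightarrow> \<beta> \<in> T \<Longrightarrow> neg (u \<beta>) \<Longrightarrow> below T w (u \<circ> refl \<beta>)"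
  by (erule tranclp.trancl_into_trancl) (rule descentI)

lemma refl_conj: "refl \<alpha> \<circ> refl \<beta> = refl (refl \<alpha> \<beta>) \<circ> refl \<alpha>"
  by (rule orthogonal_comp_refl[OF orthogonal_refl])

lemma comp_refl_conj: "z \<circ> refl \<beta> \<circ> refl c = z \<circ> refl c \<circ> refl (refl c \<beta>)"
  using refl_conj[of c "refl c \<beta>"] by (simp add: comp_assoc)

text \<open>The vertex \<open>z s_c\<close> sends \<open>refl c \<beta>\<close> to the same label
  \<open>z \<beta>\<close>, hence with the same sign.\<close>

lemma descent_conj:
  assumes "\<beta> \<in> T" "refl c \<beta> \<in> T" "neg (z \<beta>)"
  shows "descent T (z \<circ> refl c) (z \<circ> refl \<beta> \<circ> refl c)"
  by (subst comp_refl_conj) (use assms in \<open>intro descentI; simp\<close>)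

text \<open>One half of the lifting property of the Bruhat order: the path is conjugated by
  \<open>s_c\<close> step by step.\<close>

lemma below_refl_simple:
  assumes simple: "\<And>\<beta>. \<beta> \<in> T \<Longrightarrow> \<beta> \<noteq> c \<Longrightarrow> refl c \<beta> \<in> T" and "c \<in> T" "w \<in> W" "neg (w c)"
    and "below T (w \<circ> refl c) z"
  shows "below T w z \<and> below T w (z \<circ> refl c)"
  using assms(5)
proof (induction rule: tranclp_induct)
  case (base z)
  then obtain \<beta> where \<beta>: "\<beta> \<in> T" "neg ((w \<circ> refl c) \<beta>)" "z = w \<circ> refl c \<circ> refl \<beta>"
    unfolding descent_def by blast
  have "\<beta> \<noteq> c"
    using \<beta>(2) \<open>w c \<bullet> \<rho> < 0\<close> weyl_linear[OF \<open>w \<in> W\<close>] by (auto simp: linear_neg)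
  then have "below T w (w \<circ> refl (refl c \<beta>))"
    using \<beta> simple by (intro belowI) auto
  moreover have "z \<circ> refl c = w \<circ> refl (refl c \<beta>)"
    using comp_refl_conj[of "w \<circ> refl c" \<beta> c] by (simp add: \<beta>(3))
  moreover have "below T w z"
    unfolding \<beta>(3) using below_stepI belowI \<open>c \<in> T\<close> \<open>w c \<bullet> \<rho> < 0\<close> \<beta>(1,2) by blast
  ultimately show ?case by (simp only:)
next
  case (step y z)
  then obtain \<beta> where \<beta>: "\<beta> \<in> T" "neg (y \<beta>)" "z = y \<circ> refl \<beta>"
    unfolding descent_def by blast
  have "below T w (z \<circ> refl c)"
  proof (cases "\<beta> = c")
    case True
    then show ?thesis using \<beta> step.IH by simp
  next
    case False
    then have "descent T (y \<circ> refl c) (z \<circ> refl c)"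
      unfolding \<beta>(3) using descent_conj \<beta> simple by blast
    with step.IH show ?thesis by (meson tranclp.trancl_into_trancl)
  qed
  then show ?case unfolding \<beta>(3) using below_stepI \<beta>(1,2) step.IH by blast
qed

text \<open>The other half of the lifting property, by the same conjugation; a step through
  \<open>c\<close> itself exchanges the last two alternatives or is absorbed.\<close>

lemma below_cases_simple:
  assumes simple: "\<And>\<beta>. \<beta> \<in> T \<Longrightarrow> \<beta> \<noteq> c \<Longrightarrow> refl c \<beta> \<in> T"
    and "below T w z"
  shows "z = w \<circ> refl c \<or> below T (w \<circ> refl c) z \<or> below T (w \<circ> refl c) (z \<circ> refl c)"
  using assms(2)
proof (induction rule: tranclp_induct)
  case (base z)
  then obtain \<beta> where \<beta>: "\<beta> \<in> T" "neg (w \<beta>)" "z = w \<circ> refl \<beta>"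
    unfolding descent_def by blast
  show ?case
  proof (cases "\<beta> = c")
    case False
    then have "descent T (w \<circ> refl c) (z \<circ> refl c)"
      unfolding \<beta>(3) using descent_conj \<beta> simple by blast
    then have "below T (w \<circ> refl c) (z \<circ> refl c)" by (rule tranclp.r_into_trancl[of "descent T"])
    then show ?thesis by blast
  qed (simp add: \<beta>(3))
next
  case (step y z)
  then obtain \<beta> where \<beta>: "\<beta> \<in> T" "neg (y \<beta>)" "z = y \<circ> refl \<beta>"
    unfolding descent_def by blast
  from step.IH show ?case
  proof (elim disjE)
    assume "y = w \<circ> refl c"
    then show ?thesis unfolding \<beta>(3) using belowI \<beta>(1,2) by blast
  next
    assume "below T (w \<circ> refl c) y"
    then show ?thesis unfolding \<beta>(3) using below_stepI \<beta>(1,2) by blast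
  next
    assume y: "below T (w \<circ> refl c) (y \<circ> refl c)"
    show ?thesis
    proof (cases "\<beta> = c")
      case True
      then have "z = y \<circ> refl c" using \<beta>(3) by blast
      then show ?thesis using y by blast
    next
      case False
      then have "descent T (y \<circ> refl c) (z \<circ> refl c)"
        unfolding \<beta>(3) using descent_conj \<beta> simple by blast
      with y show ?thesis by (meson tranclp.trancl_into_trancl)
    qed
  qed
qed

lemma gkm_below_mono: "gkm_below T J w P \<Longrightarrow> below T w z \<Longrightarrow> gkm_below T J z P"
  unfolding gkm_below_def by (meson tranclp_trans)

lemma weyl_pos_span: "w \<in> W \<Longrightarrow> \<beta> \<in> \<Phi>p \<Longrightarrow> w \<beta> \<in> span \<Delta>"
  by (rule root_span[OF weyl_root[OF _ positive_root(1)]])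

lemma weyl_pos_nonzero:
  assumes "w \<in> W" "\<beta> \<in> \<Phi>p"
  shows "w \<beta> \<noteq> 0"
  using weyl_root[OF assms(1) positive_root(1)[OF assms(2)]] zero_not_root by auto

lemma weyl_neg_apply: "w \<in> W \<Longrightarrow> w (- x) = - w x"
  by (rule linear_neg[OF weyl_linear])

lemma positive_nonprop:
  assumes "\<beta> \<in> \<Phi>p" "\<gamma> \<in> \<Phi>p" "\<gamma> = c *\<^sub>R \<beta>"
  shows "\<beta> = \<gamma>"
proof -
  have "c *\<^sub>R \<beta> \<in> \<Phi>" using positive_root(1)[OF assms(2)] by (simp only: assms(3))
  then have "c = 1 \<or> c = - 1" by (rule root_multiple[OF positive_root(1)[OF assms(1)]])
  moreover have "c * (\<beta> \<bullet> \<rho>) > 0" using positive_root(2)[OF assms(2)] by (simp add: assms(3))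
  then have "c \<noteq> - 1" using positive_root(2)[OF assms(1)] by auto
  ultimately show ?thesis using assms(3) by simp
qed

lemma weyl_positive_nonprop:
  assumes "w \<in> W" "\<beta> \<in> \<Phi>p" "\<gamma> \<in> \<Phi>p" "\<beta> \<noteq> \<gamma>"
  shows "w \<gamma> \<noteq> c *\<^sub>R w \<beta>"
proof
  assume "w \<gamma> = c *\<^sub>R w \<beta>"
  then have "w \<gamma> = w (c *\<^sub>R \<beta>)" by (simp only: linear_scale[OF weyl_linear[OF assms(1)]])
  then have "\<gamma> = c *\<^sub>R \<beta>"
    by (rule injD[OF orthogonal_transformation_inj[OF weyl_orthogonal[OF assms(1)]]])
  then show False using positive_nonprop[OF assms(2,3)] assms(4) by blast
qed

lemma lf_dvd_cancel:
  assumes "w \<in> W" "\<beta> \<in> \<Phi>p" "\<gamma> \<in> \<Phi>p" "\<beta> \<noteq> \<gamma>" "lf (w \<beta>) dvd lf (w \<gamma>) * x"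
  shows "lf (w \<beta>) dvd x"
proof (rule root_poly_dvd_cancel)
  show "\<nexists>c. w \<gamma> = c *\<^sub>R w \<beta>" using weyl_positive_nonprop[OF assms(1-4)] by simp
qed (fact weyl_pos_span[OF assms(1,2)] weyl_pos_nonzero[OF assms(1,2)] weyl_pos_span[OF assms(1,3)] assms(5))+

text \<open>A reflection moves \<open>\<gamma>\<close> by a multiple of \<open>\<beta>\<close>, so
  labels at the two ends of an edge agree modulo the label of that edge.\<close>

lemma lf_refl_cong:
  assumes "w \<in> W" "\<beta> \<in> \<Phi>p" "\<gamma> \<in> span \<Delta>"
  shows "lf (w \<beta>) dvd lf (w (refl \<beta> \<gamma>)) - lf (w \<gamma>)"
proof -
  have "w (refl \<beta> \<gamma>) = w \<gamma> - (2 * (\<gamma> \<bullet> \<beta>) / (\<beta> \<bullet> \<beta>)) *\<^sub>R w \<beta>"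
    using weyl_linear[OF assms(1)] by (simp add: refl_def linear_diff linear_scale)
  then show ?thesis
    using weyl_span[OF assms(1,3)] weyl_pos_span[OF assms(1,2)]
    by (simp add: root_poly_diff root_poly_scale span_scale)
qed

text \<open>Exchanging the ends of an edge only changes the sign of its label, so the orientation
  does not matter once both ends are below \<open>w\<close>.\<close>

lemma gkm_below_edge:
  assumes "gkm_below T J w P" "w \<in> W" "T \<subseteq> \<Phi>p" "J \<subseteq> T" "\<beta> \<in> J"
    and "below T w z" "below T w (z \<circ> refl \<beta>)"
  shows "lf (z \<beta>) dvd P z - P (z \<circ> refl \<beta>)"
proof (cases "neg (z \<beta>)")
  case True
  then show ?thesis using assms unfolding gkm_below_def by blast
next
  case False
  have z: "z \<in> W" and \<beta>: "\<beta> \<in> \<Phi>p" using assms below_weyl by blast+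
  have "z \<beta> \<bullet> \<rho> \<noteq> 0" using root_inner_rho_nonzero weyl_root z \<beta> positive_root by blast
  then have "neg ((z \<circ> refl \<beta>) \<beta>)" using False by (simp add: weyl_neg_apply[OF z])
  then have "lf ((z \<circ> refl \<beta>) \<beta>) dvd P (z \<circ> refl \<beta>) - P (z \<circ> refl \<beta> \<circ> refl \<beta>)"
    using assms unfolding gkm_below_def by blast
  then have "lf (z \<beta>) dvd - (P z - P (z \<circ> refl \<beta>))"
    by (simp add: weyl_neg_apply[OF z] root_poly_minus weyl_pos_span[OF z \<beta>])
  then show ?thesis by (simp only: dvd_minus_iff)
qed

text \<open>Larger sets only strengthen what is known below \<open>w\<close>, and no new congruence
  is asked at \<open>w\<close> itself.\<close>

lemma extendable_mono:
  assumes "extendable T' J' w" "T' \<subseteq> T" "J' \<subseteq> J" "{\<beta>\<in>J. neg (w \<beta>)} \<subseteq> J'"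
  shows "extendable T J w"
  unfolding extendable_def
proof (intro allI impI)
  fix P assume "gkm_below T J w P"
  then have "gkm_below T' J' w P"
    using assms(2,3) below_mono unfolding gkm_below_def by blast
  then obtain f where "lifts J' w P f"
    using assms(1) unfolding extendable_def by blast
  then show "\<exists>f. lifts J w P f"
    using assms(4) by blast
qed

text \<open>The right divided difference \<open>R z = (P z - P (z s\<^sub>c)) / z c\<close> satisfies the edge conditions below
  \<open>w s\<^sub>c\<close>, and a value \<open>r\<close> of \<open>R\<close> at \<open>w s\<^sub>c\<close> yields the value \<open>P (w s\<^sub>c) + (w c) r\<close> of \<open>P\<close> at \<open>w\<close>.\<close>

lemma extendable_divided_difference:
  assumes "w \<in> W" "T \<subseteq> \<Phi>p" "J \<subseteq> T" "c \<in> J" "neg (w c)"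
    and simple: "\<And>\<beta>. \<beta> \<in> T \<Longrightarrow> \<beta> \<noteq> c \<Longrightarrow> refl c \<beta> \<in> T"
    and stable: "\<And>\<beta>. \<beta> \<in> J \<Longrightarrow> \<beta> \<noteq> c \<Longrightarrow> refl c \<beta> \<in> J"
    and ext: "extendable T J (w \<circ> refl c)"
  shows "extendable T J w"
  unfolding extendable_def
proof (intro allI impI)
  fix P assume P: "gkm_below T J w P"
  note edge = gkm_below_edge[OF P assms(1-3)]
  have c: "c \<in> \<Phi>p" "c \<in> T" using assms by auto
  have J: "\<beta> \<in> \<Phi>p" if "\<beta> \<in> J" for \<beta> using assms that by auto
  have J_span: "\<beta> \<in> span \<Delta>" if "\<beta> \<in> J" for \<beta> using root_span[OF positive_root(1)[OF J[OF that]]] .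
  define R where "R z = (SOME r. P z - P (z \<circ> refl c) = lf (z c) * r)" for z
  have R: "P z - P (z \<circ> refl c) = lf (z c) * R z" if "below T w z" "below T w (z \<circ> refl c)" for z
  proof -
    have "\<exists>r. P z - P (z \<circ> refl c) = lf (z c) * r"
      using edge[OF assms(4) that] unfolding dvd_def .
    then show ?thesis unfolding R_def by (rule someI_ex)
  qed
  \<comment> \<open>Numerator and denominator both change sign under \<open>s_c\<close>.\<close>
  have R_inv: "R (z \<circ> refl c) = R z" if z: "below T w z" "below T w (z \<circ> refl c)" for z
  proof (rule rpoly_mult_cancel)
    have zW: "z \<in> W" using below_weyl z assms by blast
    show "lf (z c) \<noteq> 0"
      using zW c weyl_pos_span weyl_pos_nonzero by (simp add: root_poly_eq_0_iff)
    have "- (lf (z c) * R (z \<circ> refl c)) = P (z \<circ> refl c) - P z"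
      using R[of "z \<circ> refl c"] z weyl_pos_span[OF zW c(1)]
      by (simp add: weyl_neg_apply[OF zW] root_poly_minus)
    then show "lf (z c) * R (z \<circ> refl c) = lf (z c) * R z"
      using R[OF z] by (simp add: algebra_simps)
  qed
  have low: "below T w z" "below T w (z \<circ> refl c)" if "below T (w \<circ> refl c) z" for z
    using below_refl_simple[OF simple c(2) assms(1,5) that] by auto
  have w': "below T w (w \<circ> refl c)" by (rule belowI) (fact c(2) assms(5))+
  \<comment> \<open>Three congruences modulo \<open>z \<beta>\<close> are combined: the given one,
    the edge from \<open>z s_c\<close> to \<open>z s_\<beta> s_c\<close>, which is the reflection in
    \<open>refl c \<beta>\<close> and has the same label, and the change of the factor
    \<open>z c\<close> into \<open>z s_\<beta> c\<close>.\<close>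
  have key: "lf (z \<beta>) dvd lf (z c) * R z - lf (z c) * R (z \<circ> refl \<beta>)"
    if z: "z \<in> W" "below T w (z \<circ> refl c)" "below T w (z \<circ> refl \<beta>)" "below T w (z \<circ> refl \<beta> \<circ> refl c)"
      and \<beta>: "\<beta> \<in> J" "\<beta> \<noteq> c"
      and dvd: "lf (z \<beta>) dvd lf (z c) * R z + P (z \<circ> refl c) - P (z \<circ> refl \<beta>)" for z \<beta>
  proof -
    let ?z' = "z \<circ> refl \<beta>"
    have R': "P ?z' - P (?z' \<circ> refl c) = lf (?z' c) * R ?z'" using R z by blast
    have e1: "lf (z \<beta>) dvd P (z \<circ> refl c) - P (?z' \<circ> refl c)"
      using edge[OF stable[OF \<beta>] z(2)] z(4) by (simp add: comp_refl_conj[of z \<beta> c])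
    have e2: "lf (z \<beta>) dvd (lf (?z' c) - lf (z c)) * R ?z'"
      using lf_refl_cong[OF z(1) J[OF \<beta>(1)] J_span[OF assms(4)]] by simp
    have "lf (z \<beta>) dvd (lf (z c) * R z + P (z \<circ> refl c) - P ?z')
        - (P (z \<circ> refl c) - P (?z' \<circ> refl c)) + (lf (?z' c) - lf (z c)) * R ?z'"
      by (rule dvd_add[OF dvd_diff[OF dvd e1] e2])
    also have "\<dots> = lf (z c) * R z - lf (z c) * R ?z' - (P ?z' - P (?z' \<circ> refl c) - lf (?z' c) * R ?z')"
      by (simp only: ring_distribs) simp
    finally show ?thesis by (simp only: R' diff_self diff_zero)
  qed
  have "gkm_below T J (w \<circ> refl c) R"
    unfolding gkm_below_def
  proof (intro allI impI)
    fix z \<beta> assume z: "below T (w \<circ> refl c) z" and \<beta>: "\<beta> \<in> J" "neg (z \<beta>)"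
    have zW: "z \<in> W" using below_weyl low z assms by blast
    have z': "below T (w \<circ> refl c) (z \<circ> refl \<beta>)"
      using below_stepI z \<beta> assms(3) by blast
    show "lf (z \<beta>) dvd R z - R (z \<circ> refl \<beta>)"
    proof (cases "\<beta> = c")
      case True
      then show ?thesis using R_inv low z by simp
    next
      case False
      have "lf (z \<beta>) dvd P z - P (z \<circ> refl \<beta>)"
        using edge \<beta>(1) low z z' by blast
      then have "lf (z \<beta>) dvd lf (z c) * R z + P (z \<circ> refl c) - P (z \<circ> refl \<beta>)"
        using R[of z] low z by (simp add: algebra_simps)
      then have "lf (z \<beta>) dvd lf (z c) * (R z - R (z \<circ> refl \<beta>))"
        using key[OF zW] low z z' \<beta> False by (simp add: right_diff_distrib)
      then show ?thesis using lf_dvd_cancel[OF zW] J \<beta> c(1) False by blast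
    qed
  qed
  then obtain r where r: "\<And>\<beta>. \<beta> \<in> J \<Longrightarrow> neg ((w \<circ> refl c) \<beta>) \<Longrightarrow>
      lf ((w \<circ> refl c) \<beta>) dvd r - R (w \<circ> refl c \<circ> refl \<beta>)"
    using ext unfolding extendable_def by blast
  define f where "f = P (w \<circ> refl c) + lf (w c) * r"
  have "lf (w \<beta>) dvd f - P (w \<circ> refl \<beta>)" if \<beta>: "\<beta> \<in> J" "neg (w \<beta>)" for \<beta>
  proof (cases "\<beta> = c")
    case True
    then show ?thesis by (simp add: f_def)
  next
    case False
    let ?z = "w \<circ> refl \<beta>"
    have \<beta>': "refl c \<beta> \<in> J" using stable \<beta> False by blast
    have z: "below T w ?z" using \<beta> assms(3) by (intro belowI) auto
    have z': "below T w (?z \<circ> refl c)"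
      using belowI[of "refl c \<beta>" T "w \<circ> refl c"] \<beta>' \<beta> assms(3) low by (auto simp: comp_refl_conj[of w \<beta> c])
    have "lf (w \<beta>) dvd r - R (?z \<circ> refl c)"
      using r[OF \<beta>'] \<beta> by (simp add: comp_refl_conj[of w \<beta> c])
    then have e1: "lf (w \<beta>) dvd lf (w c) * (r - R ?z)"
      unfolding R_inv[OF z z'] by (rule dvd_mult)
    have e2: "lf (w \<beta>) dvd P (w \<circ> refl c) - P (?z \<circ> refl c)"
      using edge[OF \<beta>' w'] z' by (simp add: comp_refl_conj[of w \<beta> c])
    have e3: "lf (w \<beta>) dvd (lf (?z c) - lf (w c)) * R ?z"
      using lf_refl_cong[OF assms(1) J[OF \<beta>(1)] J_span[OF assms(4)]] by simp
    have "lf (w \<beta>) dvd lf (w c) * (r - R ?z) + (P (w \<circ> refl c) - P (?z \<circ> refl c))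
        - (lf (?z c) - lf (w c)) * R ?z"
      by (rule dvd_diff[OF dvd_add[OF e1 e2] e3])
    also have "\<dots> = f - P ?z + (P ?z - P (?z \<circ> refl c) - lf (?z c) * R ?z)"
      unfolding f_def by (simp only: ring_distribs) simp
    finally show ?thesis by (simp only: R[OF z z'] diff_self add_0_right)
  qed
  then show "\<exists>f. lifts J w P f" by blast
qed

lemma rank2_simple_neg:
  assumes "rank2_base T a b" "w \<in> W" "\<beta> \<in> T" "neg (w \<beta>)"
  shows "neg (w a) \<or> neg (w b)"
proof -
  obtain p q where pq: "p \<ge> 0" "q \<ge> 0" "\<beta> = p *\<^sub>R a + q *\<^sub>R b"
    using assms(1,3) unfolding rank2_base_def by blast
  have "w \<beta> \<bullet> \<rho> = p * (w a \<bullet> \<rho>) + q * (w b \<bullet> \<rho>)"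
    using weyl_linear[OF assms(2)] by (simp add: pq(3) linear_add linear_scale inner_add_left)
  then have sum_neg: "p * (w a \<bullet> \<rho>) + q * (w b \<bullet> \<rho>) < 0" using assms(4) by simp
  show ?thesis
  proof (rule ccontr)
    assume "\<not> ?thesis"
    then have "p * (w a \<bullet> \<rho>) \<ge> 0" "q * (w b \<bullet> \<rho>) \<ge> 0" using pq by simp_all
    then show False using sum_neg by simp
  qed
qed

text \<open>Here both simple reflections are available for divided differences, and any element with
  an inversion in \<open>T\<close> has a simple one.\<close>

lemma extendable_full:
  assumes "rank2_base T a b" "w \<in> W"
  shows "extendable T T w"
  using assms(2)
proof (induction rule: weyl_psi_induct)
  case (less w)
  have T: "T \<subseteq> \<Phi>p" using assms(1) unfolding rank2_base_def by blast
  have step: "extendable T T w"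
    if c: "c \<in> T" "neg (w c)" and simple: "\<And>\<beta>. \<beta> \<in> T \<Longrightarrow> \<beta> \<noteq> c \<Longrightarrow> refl c \<beta> \<in> T" for c
  proof (rule extendable_divided_difference[OF less.hyps T order_refl c simple simple])
    have "c \<in> \<Phi>p" using c(1) T by blast
    then show "extendable T T (w \<circ> refl c)"
      using less.IH psi_less[OF less.hyps _ c(2)] weyl_comp_refl[OF less.hyps] positive_root(1) by blast
  qed
  show ?case
  proof (cases "\<exists>\<beta>\<in>T. neg (w \<beta>)")
    case True
    then have "neg (w a) \<or> neg (w b)" using rank2_simple_neg assms(1) less.hyps by blast
    then show ?thesis using step[of a] step[of b] assms(1) unfolding rank2_base_def by blast
  qed (auto simp: extendable_def)
qed

text \<open>If \<open>c\<close> is simple with \<open>w c < 0\<close>, then each vertex \<open>z\<close> below \<open>w\<close>, or else its neighbour \<open>z s\<^sub>c\<close>,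
  is at most \<open>w s\<^sub>c\<close>; so induction on \<open>w\<close> applies.\<close>

lemma gkm_below_connected:
  assumes base2: "rank2_base T a b" and J: "a \<in> J" "b \<in> J" "J \<subseteq> T"
    and uv: "u \<in> span \<Delta>" "v \<in> span \<Delta>" and "w \<in> W"
    and "w a \<in> span {u, v}" "w b \<in> span {u, v}" "gkm_below T J w P" "below T w z" "below T w z'"
  shows "\<exists>r s. P z - P z' = lf u * r + lf v * s"
  using assms(7-)
proof (induction arbitrary: z z' rule: weyl_psi_induct)
  case (less w)
  have T: "T \<subseteq> \<Phi>p" using base2 unfolding rank2_base_def by blast
  \<comment> \<open>Congruence modulo the ideal generated by \<open>lf u\<close> and
    \<open>lf v\<close>, which contains every label in their plane.\<close>
  define eqv where "eqv f g \<longleftrightarrow> (\<exists>r s. f - g = lf u * r + lf v * s)" for f g :: "'a rpoly"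
  have eqv_refl: "eqv f f" for f by (auto simp: eqv_def intro!: exI[of _ 0])
  have eqv_sym: "eqv g f" if "eqv f g" for f g
  proof -
    from that obtain r s where "f - g = lf u * r + lf v * s" by (auto simp: eqv_def)
    then have "g - f = lf u * (- r) + lf v * (- s)" by (simp add: algebra_simps)
    then show ?thesis unfolding eqv_def by blast
  qed
  have eqv_trans: "eqv f h" if "eqv f g" "eqv g h" for f g h
  proof -
    from that obtain r s r' s' where "f - g = lf u * r + lf v * s" "g - h = lf u * r' + lf v * s'"
      by (auto simp: eqv_def)
    then have "f - h = lf u * (r + r') + lf v * (s + s')" by (simp add: algebra_simps)
    then show ?thesis unfolding eqv_def by blast
  qed
  have eqv_dvd: "eqv f g" if x: "x \<in> span {u, v}" and dvd: "lf x dvd f - g" for x f g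
  proof -
    obtain p q where x': "x = p *\<^sub>R u + q *\<^sub>R v"
      using x unfolding span_pair_iff by blast
    obtain k where "f - g = lf x * k" using dvd by (rule dvdE)
    also have "lf x = scalar p * lf u + scalar q * lf v"
      using uv by (simp add: x' root_poly_add root_poly_scale span_scale)
    finally have "f - g = lf u * (scalar p * k) + lf v * (scalar q * k)"
      by (simp add: algebra_simps)
    then show ?thesis unfolding eqv_def by blast
  qed
  have T_span: "\<beta> \<in> span {a, b}" if "\<beta> \<in> T" for \<beta>
  proof -
    have "\<exists>p q. \<beta> = p *\<^sub>R a + q *\<^sub>R b" using base2 that unfolding rank2_base_def by blast
    then show ?thesis unfolding span_pair_iff .
  qed
  have plane: "y x \<in> span {u, v}"
    if "y \<in> W" and uv: "y a \<in> span {u, v}" "y b \<in> span {u, v}" and x: "x \<in> span {a, b}" for y x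
  proof -
    obtain p q where "x = p *\<^sub>R a + q *\<^sub>R b" using x unfolding span_pair_iff by blast
    then have "y x = p *\<^sub>R y a + q *\<^sub>R y b"
      using weyl_linear[OF that(1)] by (simp add: linear_add linear_scale)
    then show ?thesis using span_add[OF span_scale[OF uv(1)] span_scale[OF uv(2)]] by (simp only:)
  qed
  have plane_refl: "refl \<beta> x \<in> span {a, b}" if "\<beta> \<in> T" "x \<in> span {a, b}" for \<beta> x
    unfolding refl_def by (intro span_diff span_scale T_span that)
  have ab: "a \<in> span {a, b}" "b \<in> span {a, b}" by (simp_all add: span_base)
  have below_plane: "y a \<in> span {u, v} \<and> y b \<in> span {u, v}" if "below T w y" for y
    using that
  proof (induction rule: tranclp_induct)
    case (base y)
    then obtain \<beta> where "\<beta> \<in> T" "y = w \<circ> refl \<beta>" unfolding descent_def by blast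
    then show ?case
      using plane[OF less.hyps less.prems(1,2) plane_refl[OF _ ab(1)]]
        plane[OF less.hyps less.prems(1,2) plane_refl[OF _ ab(2)]] by simp
  next
    case (step y y')
    then obtain \<beta> where \<beta>: "\<beta> \<in> T" "y' = y \<circ> refl \<beta>" unfolding descent_def by blast
    have "y \<in> W" using below_weyl step.hyps less.hyps T by blast
    then show ?case
      using plane[of y "refl \<beta> a"] plane[of y "refl \<beta> b"] step.IH plane_refl[OF \<beta>(1)] ab \<beta>(2) by simp
  qed
  have edge: "eqv (P y) (P (y \<circ> refl c))"
    if "c \<in> {a, b}" "below T w y" "below T w (y \<circ> refl c)" for y c
    using eqv_dvd gkm_below_edge[OF less.prems(3) less.hyps T J(3) _ that(2,3)] below_plane that J by blast
  have "\<exists>\<beta>\<in>T. neg (w \<beta>)"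
    using below_neg_ex less.prems(4) .
  then have "neg (w a) \<or> neg (w b)" using rank2_simple_neg base2 less.hyps by blast
  then obtain c where c: "c \<in> {a, b}" "neg (w c)" by blast
  have cT: "c \<in> T" and simple: "\<And>\<beta>. \<beta> \<in> T \<Longrightarrow> \<beta> \<noteq> c \<Longrightarrow> refl c \<beta> \<in> T"
    using c(1) base2 unfolding rank2_base_def by auto
  define w' where "w' = w \<circ> refl c"
  have w': "below T w w'" "w' \<in> W" unfolding w'_def
    using belowI cT c(2) below_weyl less.hyps T by blast+
  \<comment> \<open>As \<open>w'\<close> is not below itself, the induction hypothesis at
    \<open>w'\<close> compares \<open>y\<close> with a neighbour \<open>w' s_c'\<close> instead. A
    simple inversion \<open>c'\<close> exists since something lies below \<open>w'\<close>, and one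
    more edge leads back to \<open>w'\<close>.\<close>
  have lower: "eqv (P y) (P w')" if "below T w' y" for y
  proof -
    have "\<exists>\<beta>\<in>T. neg (w' \<beta>)" using below_neg_ex that .
    then obtain c' where c': "c' \<in> {a, b}" "neg (w' c')" using rank2_simple_neg base2 w'(2) by blast
    have "c' \<in> T" using c' base2 unfolding rank2_base_def by blast
    then have b: "below T w' (w' \<circ> refl c')" using belowI c' by blast
    have "eqv (P y) (P (w' \<circ> refl c'))"
      unfolding eqv_def
    proof (rule less.IH)
      show "\<psi> w < \<psi> w'" using below_psi[OF w'(1) less.hyps T] .
      show "gkm_below T J w' P" using gkm_below_mono less.prems(3) w'(1) by blast
    qed (use that b w' below_plane in blast)+
    moreover have "eqv (P w') (P (w' \<circ> refl c'))"
      using edge c' w' b by (meson tranclp_trans)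
    ultimately show ?thesis using eqv_sym eqv_trans by blast
  qed
  have all: "eqv (P y) (P w')" if "below T w y" for y
  proof -
    have "y = w \<circ> refl c \<or> below T (w \<circ> refl c) y \<or> below T (w \<circ> refl c) (y \<circ> refl c)"
      by (rule below_cases_simple) (use simple that in blast)+
    then show ?thesis
    proof (elim disjE)
    assume "below T (w \<circ> refl c) (y \<circ> refl c)"
    then have "eqv (P (y \<circ> refl c)) (P w')" "below T w (y \<circ> refl c)"
      using lower tranclp_trans[OF w'(1)] unfolding w'_def by blast+
    then show ?thesis using edge[OF c(1) that] eqv_trans by blast
    qed (use lower eqv_refl w'_def in blast)+
  qed
  have "eqv (P z) (P z')" using all less.prems(4,5) eqv_sym eqv_trans by blast
  then show ?case by (simp add: eqv_def)
qed

text \<open>Two congruences are solvable iff the prescribed values differ by an element of the ideal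
  of the two labels. These labels span the plane, so connectedness provides this.\<close>

lemma extendable_two_edges:
  assumes base2: "rank2_base T a b" and J: "a \<in> J" "b \<in> J" "J \<subseteq> T" and "w \<in> W"
    and two: "{\<delta>\<in>J. neg (w \<delta>)} \<subseteq> {\<beta>, \<gamma>}"
  shows "extendable T J w"
  unfolding extendable_def
proof (intro allI impI)
  fix P assume P: "gkm_below T J w P"
  have T: "T \<subseteq> \<Phi>p" using base2 unfolding rank2_base_def by blast
  show "\<exists>f. lifts J w P f"
  proof (cases "\<beta> \<in> J \<and> neg (w \<beta>) \<and> \<gamma> \<in> J \<and> neg (w \<gamma>) \<and> \<beta> \<noteq> \<gamma>")
    case False
    then consider "{\<delta>\<in>J. neg (w \<delta>)} \<subseteq> {\<beta>}" | "{\<delta>\<in>J. neg (w \<delta>)} \<subseteq> {\<gamma>}"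
      using two by blast
    then show ?thesis
    proof cases
      case 1
      then show ?thesis by (intro exI[of _ "P (w \<circ> refl \<beta>)"]) auto
    next
      case 2
      then show ?thesis by (intro exI[of _ "P (w \<circ> refl \<gamma>)"]) auto
    qed
  next
    case True
    then have T': "\<beta> \<in> T" "\<gamma> \<in> T" using J by auto
    then obtain p q p' q' where \<beta>: "\<beta> = p *\<^sub>R a + q *\<^sub>R b" and \<gamma>: "\<gamma> = p' *\<^sub>R a + q' *\<^sub>R b"
      using base2 unfolding rank2_base_def by metis
    \<comment> \<open>The determinant of \<open>\<beta>\<close>, \<open>\<gamma>\<close> in the
      base; Cramer's rule recovers \<open>a\<close> and \<open>b\<close>.\<close>
    define d where "d = p * q' - p' * q"
    have "d \<noteq> 0"
    proof
      assume "d = 0"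
      then have "p * q' = p' * q" by (simp add: d_def)
      then have eqs: "p' *\<^sub>R \<beta> = p *\<^sub>R \<gamma>" "q' *\<^sub>R \<beta> = q *\<^sub>R \<gamma>"
        unfolding \<beta> \<gamma> scaleR_add_right scaleR_scaleR by (simp_all add: mult.commute)
      have "\<gamma> \<noteq> 0" using T' T positive_root(1) zero_not_root by blast
      then have "p' \<noteq> 0 \<or> q' \<noteq> 0" by (auto simp: \<gamma>)
      then have "\<exists>k. \<beta> = k *\<^sub>R \<gamma>"
      proof
        assume "p' \<noteq> 0"
        then show ?thesis using scaleR_eqD[OF eqs(1)] scaleR_scaleR by metis
      next
        assume "q' \<noteq> 0"
        then show ?thesis using scaleR_eqD[OF eqs(2)] scaleR_scaleR by metis
      qed
      then obtain k where k: "\<beta> = k *\<^sub>R \<gamma>" by blast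
      have "\<gamma> \<in> \<Phi>p" "\<beta> \<in> \<Phi>p" using T' T by blast+
      then have "\<gamma> = \<beta>" using k by (rule positive_nonprop)
      then show False using True by simp
    qed
    have "d *\<^sub>R a = q' *\<^sub>R \<beta> - q *\<^sub>R \<gamma>" "d *\<^sub>R b = p *\<^sub>R \<gamma> - p' *\<^sub>R \<beta>"
      by (simp_all add: \<beta> \<gamma> d_def algebra_simps)
    then have a: "a = (1 / d) *\<^sub>R (q' *\<^sub>R \<beta> - q *\<^sub>R \<gamma>)" and b: "b = (1 / d) *\<^sub>R (p *\<^sub>R \<gamma> - p' *\<^sub>R \<beta>)"
      using scaleR_eqD[OF _ \<open>d \<noteq> 0\<close>] by blast+
    have w: "w (k *\<^sub>R (x *\<^sub>R y - x' *\<^sub>R y')) = k *\<^sub>R (x *\<^sub>R w y - x' *\<^sub>R w y')" for k x x' y y'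
      using weyl_linear[OF \<open>w \<in> W\<close>] by (simp add: linear_diff linear_scale)
    have "w a \<in> span {w \<beta>, w \<gamma>}" "w b \<in> span {w \<beta>, w \<gamma>}"
      by (subst a b, subst w, intro span_scale span_diff span_base; simp)+
    have "\<exists>r s. P (w \<circ> refl \<beta>) - P (w \<circ> refl \<gamma>) = lf (w \<beta>) * r + lf (w \<gamma>) * s"
    proof (rule gkm_below_connected[OF base2 J _ _ \<open>w \<in> W\<close> _ _ P])
      show "w \<beta> \<in> span \<Delta>" "w \<gamma> \<in> span \<Delta>"
        using weyl_pos_span[OF \<open>w \<in> W\<close>] T T' by blast+
      show "below T w (w \<circ> refl \<beta>)" "below T w (w \<circ> refl \<gamma>)"
        using True T' belowI by blast+
    qed fact+
    then obtain r s where rs: "P (w \<circ> refl \<beta>) - P (w \<circ> refl \<gamma>) = lf (w \<beta>) * r + lf (w \<gamma>) * s"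
      by blast
    show ?thesis
    proof (intro exI ballI impI)
      fix \<delta> assume "\<delta> \<in> J" "neg (w \<delta>)"
      then consider "\<delta> = \<beta>" | "\<delta> = \<gamma>" using two by blast
      then show "lf (w \<delta>) dvd (P (w \<circ> refl \<beta>) - lf (w \<beta>) * r) - P (w \<circ> refl \<delta>)"
      proof cases
        case 2
        then have "(P (w \<circ> refl \<beta>) - lf (w \<beta>) * r) - P (w \<circ> refl \<delta>) = lf (w \<gamma>) * s"
          using rs by (simp add: algebra_simps)
        then show ?thesis using 2 by simp
      qed simp
    qed
  qed
qed

end

section \<open>The root systems of rank two\<close>

text \<open>The antipodal pairs are \<open>f\<close>, \<open>p3\<close>, then \<open>p1\<close>,
  \<open>p4\<close>, then \<open>p2\<close>, \<open>p5\<close>. Each of \<open>p1 + p4 - p3\<close>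
  and \<open>p2 + p5 - p3\<close> satisfies two of the four congruences. Their difference is
  divisible by \<open>x0 * x3 = x1 * x4 - x2 * x5\<close>, so it can be split into multiples of
  \<open>x1 * x4\<close> and \<open>x2 * x5\<close>, which correct the two candidates to a common
  value.\<close>

lemma octahedron:
  fixes x0 :: "'i rpoly"
  assumes "x5 dvd p2 - p3" "x2 dvd p5 - p3" "x4 dvd p1 - p3" "x1 dvd p4 - p3"
    and x0: "x0 dvd p1 - p5" "x0 dvd p4 - p2" and x3: "x3 dvd p1 - p2" "x3 dvd p4 - p5"
    and coprime: "\<And>y. x0 dvd x3 * y \<Longrightarrow> x0 dvd y" and rel: "x0 * x3 = x1 * x4 - x2 * x5"
  shows "\<exists>f. x1 dvd f - p1 \<and> x2 dvd f - p2 \<and> x4 dvd f - p4 \<and> x5 dvd f - p5"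
proof -
  define D where "D = p1 + p4 - p2 - p5"
  have "x0 dvd (p1 - p5) + (p4 - p2)" using x0 by (rule dvd_add)
  then have "x0 dvd D" by (simp add: D_def algebra_simps)
  have "x3 dvd (p1 - p2) + (p4 - p5)" using x3 by (rule dvd_add)
  then have "x3 dvd D" by (simp add: D_def algebra_simps)
  then obtain y where "D = x3 * y" by (rule dvdE)
  with \<open>x0 dvd D\<close> have "x0 dvd y" using coprime by blast
  then obtain K where "y = x0 * K" by (rule dvdE)
  with \<open>D = x3 * y\<close> have K: "D = (x1 * x4 - x2 * x5) * K" by (simp add: mult_ac flip: rel)
  define f where "f = p2 + p5 - p3 - x2 * x5 * K"
  have f: "f = p1 + p4 - p3 - x1 * x4 * K"
    using K by (simp add: f_def D_def algebra_simps)
  have "x2 dvd (p5 - p3) - x2 * (x5 * K)" "x5 dvd (p2 - p3) - x5 * (x2 * K)"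
    "x1 dvd (p4 - p3) - x1 * (x4 * K)" "x4 dvd (p1 - p3) - x4 * (x1 * K)"
    by (intro dvd_diff assms dvd_triv_left)+
  moreover have "f - p2 = (p5 - p3) - x2 * (x5 * K)" "f - p5 = (p2 - p3) - x5 * (x2 * K)"
    by (simp_all add: f_def algebra_simps)
  moreover have "f - p1 = (p4 - p3) - x1 * (x4 * K)" "f - p4 = (p1 - p3) - x4 * (x1 * K)"
    by (simp_all add: f algebra_simps)
  ultimately show ?thesis by (intro exI[of _ f]) simp
qed

text \<open>Expanding integer multiples lets the simplifier decide identities between integral
  combinations of vectors.\<close>

lemma scaleR_expand:
  fixes v :: "'b::real_vector"
  shows "numeral Num.One *\<^sub>R v = v"
    "numeral (Num.Bit0 n) *\<^sub>R v = numeral n *\<^sub>R v + numeral n *\<^sub>R v"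
    "numeral (Num.Bit1 n) *\<^sub>R v = numeral n *\<^sub>R v + numeral n *\<^sub>R v + v"
    "(x * numeral (Num.Bit0 n)) *\<^sub>R v = (x * numeral n) *\<^sub>R v + (x * numeral n) *\<^sub>R v"
    "(x * numeral (Num.Bit1 n)) *\<^sub>R v = (x * numeral n) *\<^sub>R v + (x * numeral n) *\<^sub>R v + x *\<^sub>R v"
    "(numeral (Num.Bit0 n) * x) *\<^sub>R v = (numeral n * x) *\<^sub>R v + (numeral n * x) *\<^sub>R v"
    "(numeral (Num.Bit1 n) * x) *\<^sub>R v = (numeral n * x) *\<^sub>R v + (numeral n * x) *\<^sub>R v + x *\<^sub>R v"
  by (simp_all only: numeral.simps distrib_left distrib_right mult_1_right mult_1_left scaleR_add_left scaleR_one)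

section \<open>Divided differences and the octahedron in type G_2\<close>

context root_system
begin

text \<open>If \<open>w c\<close> is negative, a divided difference passes to \<open>w s_c\<close>,
  where the image of \<open>c\<close> is positive.\<close>

lemma extendable_stable:
  assumes "T \<subseteq> \<Phi>p" "J \<subseteq> T" "c \<in> J" and "w \<in> W"
    and simple: "\<And>\<beta>. \<beta> \<in> T \<Longrightarrow> \<beta> \<noteq> c \<Longrightarrow> refl c \<beta> \<in> T"
    and stable: "\<And>\<beta>. \<beta> \<in> J \<Longrightarrow> \<beta> \<noteq> c \<Longrightarrow> refl c \<beta> \<in> J"
    and pos: "\<And>w. w \<in> W \<Longrightarrow> w c \<bullet> \<rho> > 0 \<Longrightarrow> extendable T J w"
  shows "extendable T J w"
proof -
  have c: "c \<in> \<Phi>p" using assms by blast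
  have nz: "w c \<bullet> \<rho> \<noteq> 0"
    using root_inner_rho_nonzero[OF weyl_root[OF \<open>w \<in> W\<close> positive_root(1)[OF c]]] .
  show ?thesis
  proof (cases "w c \<bullet> \<rho> > 0")
    case False
    then have neg: "neg (w c)" using nz by simp
    have "extendable T J (w \<circ> refl c)"
      using weyl_comp_refl[OF \<open>w \<in> W\<close> positive_root(1)[OF c]] neg
      by (intro pos) (simp_all add: weyl_neg_apply[OF \<open>w \<in> W\<close>])
    then show ?thesis
      using extendable_divided_difference[OF \<open>w \<in> W\<close> assms(1-3) neg simple stable] by blast
  qed (rule pos[OF \<open>w \<in> W\<close>])
qed

text \<open>The octahedron arises from the cosets modulo \<open>s\<^sub>a\<close>: both \<open>P z + P (z s\<^sub>a)\<close> and
  \<open>(P z - P (z s\<^sub>a)) / z a\<close> are invariant under \<open>s\<^sub>a\<close>. Here \<open>j s\<^sub>a\<close> and \<open>i\<close> are adjacent.\<close>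

lemma invariant_edge:
  fixes L L' x P P' Q Q' R S :: "'i rpoly"
  assumes "x dvd P - Q'" "x dvd P' - Q" and R: "P - P' = L * R" and S: "Q - Q' = L' * S"
    and L: "x dvd L' + L" and coprime: "\<And>y. x dvd L * y \<Longrightarrow> x dvd y"
  shows "x dvd (P + P') - (Q + Q')" "x dvd R - S"
proof -
  have "x dvd (P - Q') + (P' - Q)" using assms(1,2) by (rule dvd_add)
  then show "x dvd (P + P') - (Q + Q')" by (simp add: algebra_simps)
  have "x dvd (P - Q') - (P' - Q) - (L' + L) * S"
    by (rule dvd_diff[OF dvd_diff[OF assms(1,2)] dvd_mult2[OF L]])
  also have "(P - Q') - (P' - Q) - (L' + L) * S = L * (R - S)"
  proof -
    have "(P - Q') - (P' - Q) = (P - P') + (Q - Q')" by simp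
    then show ?thesis unfolding R S by (simp add: algebra_simps)
  qed
  finally show "x dvd R - S" by (rule coprime)
qed

definition coroot :: "'a \<Rightarrow> 'a \<Rightarrow> real" where
  "coroot \<alpha> v = 2 * (v \<bullet> \<alpha>) / (\<alpha> \<bullet> \<alpha>)"

lemma refl_coroot: "refl \<alpha> v = v - coroot \<alpha> v *\<^sub>R \<alpha>"
  by (simp add: refl_def coroot_def)

lemma coroot_linear:
  "coroot \<alpha> (x + y) = coroot \<alpha> x + coroot \<alpha> y" "coroot \<alpha> (x - y) = coroot \<alpha> x - coroot \<alpha> y"
  "coroot \<alpha> (- x) = - coroot \<alpha> x" "coroot \<alpha> (c *\<^sub>R x) = c * coroot \<alpha> x"
  by (simp_all add: coroot_def inner_add_left inner_diff_left add_divide_distrib diff_divide_distrib distrib_left right_diff_distrib)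

text \<open>Conjugation of simple reflections expresses all others through the two simple coroots;
  the factors are the coordinates of the coroots, where \<open>a\<close>, \<open>a + b\<close>,
  \<open>2a + b\<close> are the short roots. Identities between products of reflections then reduce
  to linear arithmetic.\<close>

lemma g2_reflections:
  assumes "refl a b = b + 3 *\<^sub>R a" "refl b a = a + b" "a \<noteq> 0" "b \<noteq> 0"
  shows "coroot a a = 2" "coroot a b = - 3" "coroot b a = - 1" "coroot b b = 2"
    "refl (a + b) v = v - (coroot a v + 3 * coroot b v) *\<^sub>R (a + b)"
    "refl (2 *\<^sub>R a + b) v = v - (2 * coroot a v + 3 * coroot b v) *\<^sub>R (2 *\<^sub>R a + b)"
    "refl (3 *\<^sub>R a + b) v = v - (coroot a v + coroot b v) *\<^sub>R (3 *\<^sub>R a + b)"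
    "refl (3 *\<^sub>R a + 2 *\<^sub>R b) v = v - (coroot a v + 2 * coroot b v) *\<^sub>R (3 *\<^sub>R a + 2 *\<^sub>R b)"
proof -
  show aa: "coroot a a = 2" and bb: "coroot b b = 2" using assms by (simp_all add: coroot_def)
  have "- coroot a b *\<^sub>R a = 3 *\<^sub>R a" using assms(1) refl_coroot[of a b] by simp
  then show ab: "coroot a b = - 3" using \<open>a \<noteq> 0\<close> by (simp only: scaleR_cancel_right) simp
  have "- coroot b a *\<^sub>R b = 1 *\<^sub>R b" using assms(2) refl_coroot[of b a] by simp
  then show ba: "coroot b a = - 1" using \<open>b \<noteq> 0\<close> by (simp only: scaleR_cancel_right) simp
  note vals = aa ab ba bb coroot_linear
  have conj: "refl (refl \<alpha> \<beta>) v = refl \<alpha> (refl \<beta> (refl \<alpha> v))" for \<alpha> \<beta> v :: 'a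
    using fun_cong[OF refl_conj[of \<alpha> \<beta>], of "refl \<alpha> v"] by simp
  have "refl (a + b) v = refl b (refl a (refl b v))" for v
    unfolding assms(2)[symmetric] by (rule conj)
  then show r4: "refl (a + b) v = v - (coroot a v + 3 * coroot b v) *\<^sub>R (a + b)" for v
    by (rule trans) (simp add: refl_coroot vals algebra_simps scaleR_expand)
  have eq: "3 *\<^sub>R a + b = refl a b" using assms(1) by (simp add: add.commute)
  have "refl (3 *\<^sub>R a + b) v = refl a (refl b (refl a v))" for v unfolding eq by (rule conj)
  then show r1: "refl (3 *\<^sub>R a + b) v = v - (coroot a v + coroot b v) *\<^sub>R (3 *\<^sub>R a + b)" for v
    by (rule trans) (simp add: refl_coroot vals algebra_simps scaleR_expand)
  have eq: "2 *\<^sub>R a + b = refl a (a + b)" by (simp add: refl_coroot vals algebra_simps scaleR_expand)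
  have "refl (2 *\<^sub>R a + b) v = refl a (refl (a + b) (refl a v))" unfolding eq by (rule conj)
  then show "refl (2 *\<^sub>R a + b) v = v - (2 * coroot a v + 3 * coroot b v) *\<^sub>R (2 *\<^sub>R a + b)"
    unfolding r4 by (rule trans) (simp add: refl_coroot[of a] vals algebra_simps scaleR_expand)
  have eq: "3 *\<^sub>R a + 2 *\<^sub>R b = refl b (3 *\<^sub>R a + b)" by (simp add: refl_coroot vals algebra_simps scaleR_expand)
  have "refl (3 *\<^sub>R a + 2 *\<^sub>R b) v = refl b (refl (3 *\<^sub>R a + b) (refl b v))" unfolding eq by (rule conj)
  then show "refl (3 *\<^sub>R a + 2 *\<^sub>R b) v = v - (coroot a v + 2 * coroot b v) *\<^sub>R (3 *\<^sub>R a + 2 *\<^sub>R b)"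
    unfolding r1 by (rule trans) (simp add: refl_coroot[of b] vals algebra_simps scaleR_expand)
qed

text \<open>The one case in type \<open>G\<^sub>2\<close> which is not covered by divided differences and subsystems:
  all roots but the highest one belong to \<open>J\<close>, and \<open>w\<close> has four incoming edges, none of which
  is the simple reflection \<open>s\<^sub>a\<close>. The value at \<open>w s\<^sub>1 s\<^sub>a\<close>, which need not lie below \<open>w\<close>, is supplied
  separately. Roots are numbered by angle: \<open>a, 3a + b, 2a + b, 3a + 2b, a + b, b\<close>.\<close>

lemma g2_octahedron_values:
  assumes T: "T \<subseteq> \<Phi>p" and J_def: "J = {a, b, a + b, 2 *\<^sub>R a + b, 3 *\<^sub>R a + b}"
    and JT: "J \<subseteq> T" "3 *\<^sub>R a + 2 *\<^sub>R b \<in> T"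
    and refl: "refl a b = b + 3 *\<^sub>R a" "refl b a = a + b"
    and w: "w \<in> W" "w a \<bullet> \<rho> > 0" "neg (w (3 *\<^sub>R a + b))"
    and P: "gkm_below T J w P"
    and ex_v: "\<exists>v. lifts J (w \<circ> refl (3 *\<^sub>R a + b) \<circ> refl a) P v"
  shows "\<exists>f. lifts J w P f"
proof -
  obtain v where v: "\<And>\<beta>. \<beta> \<in> J \<Longrightarrow> neg ((w \<circ> refl (3 *\<^sub>R a + b) \<circ> refl a) \<beta>) \<Longrightarrow>
      lf ((w \<circ> refl (3 *\<^sub>R a + b) \<circ> refl a) \<beta>) dvd v - P (w \<circ> refl (3 *\<^sub>R a + b) \<circ> refl a \<circ> refl \<beta>)"
    using ex_v by blast
  define r1 r2 r3 r4 where "r1 = 3 *\<^sub>R a + b" and "r2 = 2 *\<^sub>R a + b" and "r3 = 3 *\<^sub>R a + 2 *\<^sub>R b" and "r4 = a + b"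
  note r_defs = r1_def r2_def r3_def r4_def
  have J: "a \<in> J" "b \<in> J" "r4 \<in> J" "r2 \<in> J" "r1 \<in> J" by (simp_all add: J_def r_defs)
  have J_eq: "J = {a, b, r4, r2, r1}" by (simp add: J_def r_defs)
  have r3T: "r3 \<in> T" using JT(2) by (simp add: r_defs)
  have pos: "a \<in> \<Phi>p" "b \<in> \<Phi>p" "r1 \<in> \<Phi>p" "r2 \<in> \<Phi>p" "r3 \<in> \<Phi>p" "r4 \<in> \<Phi>p"
    using J JT r3T T by blast+
  have nz: "a \<noteq> 0" "b \<noteq> 0" using pos positive_root(1) zero_not_root by blast+
  note g2 = g2_reflections[OF refl nz]
  have refls: "refl r1 x = x - (coroot a x + coroot b x) *\<^sub>R r1" "refl r2 x = x - (2 * coroot a x + 3 * coroot b x) *\<^sub>R r2"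
    "refl r3 x = x - (coroot a x + 2 * coroot b x) *\<^sub>R r3" "refl r4 x = x - (coroot a x + 3 * coroot b x) *\<^sub>R r4" for x
    unfolding r_defs by (rule g2)+
  note refls = refl_coroot[of a] refl_coroot[of b] refls
  note calc = r_defs g2(1-4) coroot_linear scaleR_expand
  note wl = linear_add[OF weyl_linear[OF w(1)]] linear_scale[OF weyl_linear[OF w(1)]]
  have neg: "neg (w b)" "neg (w r1)" "neg (w r2)" "neg (w r3)" "neg (w r4)"
    using w(2,3) by (simp_all add: r_defs wl inner_add_left)
  have fixed: "refl r2 b = b" "refl b r2 = r2" "refl r1 r4 = r4" "refl r4 r1 = r1"
    and moved: "refl r1 r2 = - a" "refl r4 r2 = a" "refl r1 b = r3" "refl r4 b = - r3"
    and moved_a: "refl b a = r4" "refl r4 a = r2" "refl r1 a = - r2"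
    and a_moved: "refl a b = r1" "refl a r1 = b" "refl a r2 = r4" "refl a r4 = r2"
    by (simp_all only: refls) (simp_all add: calc algebra_simps)
  \<comment> \<open>Each equation is an edge of the octahedron: from \<open>w s_i\<close> the
    reflection in \<open>c\<close> leads to \<open>w s_j s_a\<close>, in the coset of
    \<open>w s_j\<close> modulo \<open>s_a\<close>.\<close>
  have comps: "refl r2 \<circ> refl b = refl r3 \<circ> refl a" "refl b \<circ> refl r2 = refl r3 \<circ> refl a"
    "refl r1 \<circ> refl r4 = refl r3 \<circ> refl a" "refl r4 \<circ> refl r1 = refl r3 \<circ> refl a"
    "refl r1 \<circ> refl r2 = refl b \<circ> refl a" "refl r4 \<circ> refl r2 = refl r2 \<circ> refl a"
    "refl r1 \<circ> refl b = refl r2 \<circ> refl a" "refl r4 \<circ> refl b = refl b \<circ> refl a"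
    by (simp_all only: fun_eq_iff o_apply refls) (simp_all add: calc algebra_simps)
  have ca: "coroot a r1 = 3" "coroot a r2 = 1" "coroot a r3 = 0" "coroot a r4 = - 1" "coroot a b = - 3"
    by (simp_all add: r_defs coroot_linear g2(1,2))
  have ne: "r2 \<noteq> r1" "r4 \<noteq> r1" "b \<noteq> r1" using ca by auto
  define u where "u r = w \<circ> refl r" for r
  have uW: "u r \<in> W" if "r \<in> {r1, r2, r3, r4, b}" for r
    unfolding u_def using that pos positive_root(1) by (intro weyl_comp_refl[OF w(1)]) blast
  have aT: "a \<in> T" and bT: "b \<in> T" using J JT by blast+
  have bn: "below T w (u r)" if "r \<in> {r1, r2, r3, r4, b}" for r
    unfolding u_def by (rule belowI) (use that J JT r3T neg in auto)
  have down: "below T w (u r \<circ> refl c)"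
    if "r \<in> {r1, r2, r3, r4, b}" "c \<in> T" "neg (w (refl r c))" for r c
    using below_stepI[OF bn[OF that(1)] that(2)] that(3) by (simp add: u_def)
  \<comment> \<open>The partners in the same coset are below \<open>w\<close> too. The root
    \<open>r1\<close> is left out; there the value \<open>v\<close> stands in for \<open>P\<close>
    in \<open>Ps\<close>.\<close>
  have bs: "below T w (u r \<circ> refl a)" if "r \<in> {r2, r3, r4, b}" for r
  proof -
    have "u r3 \<circ> refl a = u r2 \<circ> refl b" "u r2 \<circ> refl a = u r1 \<circ> refl b"
      using comps(1,7) by (simp_all add: u_def comp_assoc)
    moreover have "below T w (u b \<circ> refl a)" "below T w (u r4 \<circ> refl a)"
      "below T w (u r2 \<circ> refl b)" "below T w (u r1 \<circ> refl b)"
      using neg by (intro down aT bT; simp add: moved moved_a fixed)+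
    ultimately show ?thesis using that by auto
  qed
  define Pn where "Pn r = P (u r)" for r
  define Ps where "Ps r = (if r = r1 then v else P (u r \<circ> refl a))" for r
  note edge = gkm_below_edge[OF P w(1) T JT(1)]
  have w1: "lf ((u r1 \<circ> refl a) \<beta>) dvd v - P (u r1 \<circ> refl a \<circ> refl \<beta>)"
    if "\<beta> \<in> J" "neg ((u r1 \<circ> refl a) \<beta>)" for \<beta>
    using v[of \<beta>] that unfolding u_def r_defs .
  have "\<exists>R. Pn r - Ps r = lf (u r a) * R" if r: "r \<in> {r1, r2, r3, r4, b}" for r
  proof (cases "r = r1")
    case False
    then show ?thesis using edge[OF J(1) bn[OF r]] bs[of r] r by (auto simp: Pn_def Ps_def dvd_def)
  next
    case True
    have "lf ((u r1 \<circ> refl a) a) dvd v - P (u r1 \<circ> refl a \<circ> refl a)"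
      by (rule w1[OF J(1)]) (simp add: u_def weyl_neg_apply[OF w(1)] linear_neg[OF linear_refl] moved_a neg)
    then have "- lf (u r1 a) dvd v - P (u r1)"
      using uW[of r1] pos by (simp add: weyl_neg_apply root_poly_minus weyl_pos_span)
    then have "lf (u r1 a) dvd - (v - P (u r1))" by (simp only: minus_dvd_iff dvd_minus_iff)
    then have "lf (u r1 a) dvd P (u r1) - v" by (simp only: minus_diff_eq)
    then show ?thesis using True by (simp add: Pn_def Ps_def dvd_def)
  qed
  then obtain R where R: "\<And>r. r \<in> {r1, r2, r3, r4, b} \<Longrightarrow> Pn r - Ps r = lf (u r a) * R r" by metis
  define F where "F r = Pn r + Ps r" for r
  \<comment> \<open>Both invariant functions satisfy the congruence along an edge of the octahedron.
    For \<open>i = r1\<close> one of the two edges joining the cosets involves \<open>v\<close>,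
    whose congruences are given only for negative labels; this is the purpose of
    \<open>sign\<close>.\<close>
  have pair: "lf (w (refl i c)) dvd F i - F j \<and> lf (w (refl i c)) dvd R i - R j"
    if ij: "i \<in> {r1, r2, r3, r4, b}" "j \<in> {r2, r3, r4, b}" and c: "c \<in> {r1, r2, r4, b}"
      and comp: "refl i \<circ> refl c = refl j \<circ> refl a" and sign: "i = r1 \<Longrightarrow> neg (w (refl i c))" for i j c
  proof -
    have j: "j \<noteq> r1" "j \<in> {r1, r2, r3, r4, b}" using ij ca by auto
    have cJ: "c \<in> J" "refl a c \<in> J" "c \<in> \<Phi>p" "c \<noteq> a" using c J pos a_moved ca g2(1) by auto
    have eq: "u i \<circ> refl c = u j \<circ> refl a" using comp by (simp add: u_def comp_assoc)
    have e1: "lf (u i c) dvd Pn i - Ps j"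
      using edge[OF cJ(1) bn[OF ij(1)]] bs[OF ij(2)] j(1) by (simp add: eq Pn_def Ps_def)
    have eq': "u i \<circ> refl a \<circ> refl (refl a c) = u j"
      using comp_refl_conj[of "u i" c a] by (simp add: eq)
    have e2: "lf (u i c) dvd Ps i - Pn j"
    proof (cases "i = r1")
      case True
      have "lf ((u r1 \<circ> refl a) (refl a c)) dvd v - P (u r1 \<circ> refl a \<circ> refl (refl a c))"
        by (rule w1[OF cJ(2)]) (use sign True in \<open>simp add: u_def\<close>)
      then show ?thesis using True eq' by (simp add: Pn_def Ps_def)
    next
      case False
      then have "i \<in> {r2, r3, r4, b}" using ij by blast
      then have "lf ((u i \<circ> refl a) (refl a c)) dvd P (u i \<circ> refl a) - P (u j)"
        using edge[OF cJ(2) bs[of i]] bn[OF j(2)] unfolding eq' by blast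
      then show ?thesis using False by (simp add: Pn_def Ps_def)
    qed
    have L: "lf (u i c) dvd lf (u j a) + lf (u i a)"
    proof -
      have "a \<in> span \<Delta>" using pos root_span positive_root(1) by blast
      then have "lf (u i c) dvd lf (u i (refl c a)) - lf (u i a)"
        by (rule lf_refl_cong[OF uW[OF ij(1)] cJ(3)])
      moreover have "u i (refl c a) = - u j a"
        using fun_cong[OF eq, of a] uW[OF j(2)] by (simp add: weyl_neg_apply)
      ultimately have "lf (u i c) dvd - (lf (u j a) + lf (u i a))"
        using weyl_pos_span[OF uW[OF j(2)] pos(1)] by (simp add: root_poly_minus)
      then show ?thesis by (simp only: dvd_minus_iff)
    qed
    have coprime: "lf (u i c) dvd y" if "lf (u i c) dvd lf (u i a) * y" for y
      using lf_dvd_cancel[OF uW[OF ij(1)] cJ(3) pos(1) cJ(4) that] .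
    show ?thesis
      using invariant_edge[OF e1 e2 R[OF ij(1)] R[OF j(2)] L coprime] by (simp add: F_def u_def)
  qed
  let ?x = "\<lambda>r. lf (w r)"
  have minus_dvd: "?x (- r) dvd y \<longleftrightarrow> ?x r dvd y" if "r \<in> \<Phi>p" for r y
    using weyl_pos_span[OF w(1) that] by (simp add: weyl_neg_apply[OF w(1)] root_poly_minus)
  \<comment> \<open>The forms \<open>x0\<close> to \<open>x5\<close> are the images under
    \<open>w\<close> of \<open>a, r1, r2, r3, r4, b\<close>, and \<open>p1\<close> to
    \<open>p5\<close> are the values at the cosets of \<open>w s_r\<close>. The antipode of
    \<open>w\<close> is the coset of \<open>r3\<close>, which is orthogonal to \<open>a\<close> and
    missing from \<open>J\<close>.\<close>
  have sub: "\<exists>f. ?x r1 dvd f - G r1 \<and> ?x r2 dvd f - G r2 \<and> ?x r4 dvd f - G r4 \<and> ?x b dvd f - G b"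
    if G: "G = F \<or> G = R" for G
  proof (rule octahedron)
    have pairG: "?x (refl i c) dvd G i - G j"
      if "i \<in> {r1, r2, r3, r4, b}" "j \<in> {r2, r3, r4, b}" "c \<in> {r1, r2, r4, b}"
        "refl i \<circ> refl c = refl j \<circ> refl a" "i = r1 \<Longrightarrow> neg (w (refl i c))" for i j c
      using pair[OF that] G by blast
    show "?x b dvd G r2 - G r3" using pairG[of r2 r3 b] comps fixed ne by simp
    show "?x r2 dvd G b - G r3" using pairG[of b r3 r2] comps fixed ne by simp
    show "?x r4 dvd G r1 - G r3" using pairG[of r1 r3 r4] comps fixed neg by simp
    show "?x r1 dvd G r4 - G r3" using pairG[of r4 r3 r1] comps fixed ne by simp
    have "?x (- a) dvd G r1 - G b"
      using pairG[of r1 b r2] comps moved w(2) by (simp add: weyl_neg_apply[OF w(1)])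
    then show "?x a dvd G r1 - G b" by (simp only: minus_dvd[OF pos(1)])
    show "?x a dvd G r4 - G r2" using pairG[of r4 r2 r2] comps moved ne by simp
    show "?x r3 dvd G r1 - G r2" using pairG[of r1 r2 b] comps moved neg by simp
    show "?x r3 dvd G r4 - G b" using pairG[of r4 b b] comps moved pos ne by (simp add: minus_dvd)
    show "?x a dvd y" if "?x a dvd ?x r3 * y" for y
      using lf_dvd_cancel[OF w(1) pos(1,5) _ that] ca g2(1) by fastforce
    have "w a \<in> span \<Delta>" "w b \<in> span \<Delta>" using weyl_pos_span[OF w(1)] pos by blast+
    then have "?x r1 = 3 * ?x a + ?x b" "?x r2 = 2 * ?x a + ?x b" "?x r3 = 3 * ?x a + 2 * ?x b" "?x r4 = ?x a + ?x b"
      by (simp_all add: r_defs wl root_poly_add root_poly_scale span_scale)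
    then show "?x a * ?x r3 = ?x r1 * ?x r4 - ?x r2 * ?x b" by (simp add: algebra_simps)
  qed
  obtain fF where fF: "?x r1 dvd fF - F r1 \<and> ?x r2 dvd fF - F r2 \<and> ?x r4 dvd fF - F r4 \<and> ?x b dvd fF - F b"
    using sub[of F] by blast
  obtain fR where fR: "?x r1 dvd fR - R r1 \<and> ?x r2 dvd fR - R r2 \<and> ?x r4 dvd fR - R r4 \<and> ?x b dvd fR - R b"
    using sub[of R] by blast
  \<comment> \<open>The value of \<open>P\<close> at a vertex is recovered from its two invariants
    as half of \<open>F + (z a) R\<close>.\<close>
  define f where "f = scalar (1 / 2) * (fF + ?x a * fR)"
  have "?x r dvd f - Pn r" if r: "r \<in> {r1, r2, r4, b}" for r
  proof -
    have "a \<in> span \<Delta>" "r \<in> \<Phi>p" using r pos root_span positive_root(1) by blast+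
    then have L: "?x r dvd lf (u r a) - ?x a" using lf_refl_cong[OF w(1)] by (simp add: u_def)
    have F: "?x r dvd fF - F r" "?x r dvd fR - R r" using r fF fR by blast+
    have "?x r dvd (fF - F r) + ?x a * (fR - R r) - (lf (u r a) - ?x a) * R r"
      by (rule dvd_diff[OF dvd_add[OF F(1) dvd_mult[OF F(2)]] dvd_mult2[OF L]])
    also have "\<dots> = fF + ?x a * fR - (F r + lf (u r a) * R r)" by (simp add: algebra_simps)
    also have "F r + lf (u r a) * R r = 2 * Pn r"
    proof -
      have "r \<in> {r1, r2, r3, r4, b}" using r by blast
      then show ?thesis by (simp only: R[symmetric] F_def) simp
    qed
    finally have "?x r dvd scalar (1 / 2) * (fF + ?x a * fR - 2 * Pn r)" by (rule dvd_mult)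
    also have "\<dots> = f - scalar (1 / 2) * scalar 2 * Pn r"
      by (simp add: f_def right_diff_distrib mult.assoc)
    also have "\<dots> = f - Pn r" by (simp only: mult_single) simp
    finally show ?thesis .
  qed
  then have "lifts J w P f"
    using w(2) unfolding J_eq by (auto simp: Pn_def u_def)
  then show ?thesis by blast
qed

section \<open>Coordinates and lower sets in a plane\<close>

lemma rank2_baseD:
  assumes "rank2_base T a b"
  shows "T \<subseteq> \<Phi>p" "a \<in> T" "b \<in> T" "\<And>\<beta>. \<beta> \<in> T \<Longrightarrow> \<beta> \<noteq> a \<Longrightarrow> refl a \<beta> \<in> T"
    "\<And>\<beta>. \<beta> \<in> T \<Longrightarrow> \<beta> \<noteq> b \<Longrightarrow> refl b \<beta> \<in> T"
  using assms unfolding rank2_base_def by blast+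

lemma rank2_coord_eq:
  assumes "rank2_base T a b" "x *\<^sub>R a + y *\<^sub>R b = x' *\<^sub>R a + y' *\<^sub>R b"
  shows "x = x'" "y = y'"
proof -
  have "(x - x') *\<^sub>R a + (y - y') *\<^sub>R b = 0"
    using assms(2) by (simp add: algebra_simps)
  then have "x - x' = 0 \<and> y - y' = 0" using assms(1) unfolding rank2_base_def by blast
  then show "x = x'" "y = y'" by simp_all
qed

lemma rank2_coord_nonneg:
  assumes "rank2_base T a b" "x *\<^sub>R a + y *\<^sub>R b \<in> T"
  shows "x \<ge> 0" "y \<ge> 0"
proof -
  obtain p q where "p \<ge> 0" "q \<ge> 0" "x *\<^sub>R a + y *\<^sub>R b = p *\<^sub>R a + q *\<^sub>R b"
    using assms unfolding rank2_base_def by blast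
  then show "x \<ge> 0" "y \<ge> 0" using rank2_coord_eq[OF assms(1)] by metis+
qed

lemma rank2_refl_coord:
  assumes "rank2_base T a b" "refl a b = b + m *\<^sub>R a" "x *\<^sub>R a + y *\<^sub>R b \<in> T" "y \<noteq> 0"
  shows "(m * y - x) *\<^sub>R a + y *\<^sub>R b \<in> T"
proof -
  have "x *\<^sub>R a + y *\<^sub>R b \<noteq> a"
    using rank2_coord_eq(2)[OF assms(1), of x y 1 0] assms(4) by auto
  then have "refl a (x *\<^sub>R a + y *\<^sub>R b) \<in> T" using rank2_baseD(4) assms(1,3) by blast
  also have "refl a (x *\<^sub>R a + y *\<^sub>R b) = (m * y - x) *\<^sub>R a + y *\<^sub>R b"
    by (simp add: refl_add refl_scale assms(2) algebra_simps)
  finally show ?thesis .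
qed

lemma rank2_refl_coord':
  assumes "rank2_base T a b" "refl b a = a + b" "x *\<^sub>R a + y *\<^sub>R b \<in> T" "x \<noteq> 0"
  shows "x *\<^sub>R a + (x - y) *\<^sub>R b \<in> T"
  using rank2_refl_coord[OF rank2_base_commute[OF assms(1)], of 1 y x] assms by (simp add: add.commute)

text \<open>A positive root \<open>x a + y b\<close> other than \<open>a, b\<close> stays positive under both simple reflections as long
  as it is not simple; this confines the slope \<open>x / y\<close> to finitely many values.\<close>

lemma rank2_roots:
  assumes base2: "rank2_base T a b" and refl: "refl a b = b + m *\<^sub>R a" "refl b a = a + b"
    and m: "m \<in> {1, 2, 3}" and \<gamma>: "\<gamma> \<in> T" "\<gamma> \<noteq> a" "\<gamma> \<noteq> b"
  shows "\<gamma> = a + b \<or> m \<ge> 2 \<and> \<gamma> = 2 *\<^sub>R a + b \<or> m = 3 \<and> (\<gamma> = 3 *\<^sub>R a + b \<or> \<gamma> = 3 *\<^sub>R a + 2 *\<^sub>R b)"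
proof -
  obtain x y where xy: "\<gamma> = x *\<^sub>R a + y *\<^sub>R b" "x \<ge> 0" "y \<ge> 0"
    using base2 \<gamma>(1) unfolding rank2_base_def by blast
  have same: "\<gamma> = \<delta>" if "\<delta> \<in> T" "\<gamma> = k *\<^sub>R \<delta>" for k \<delta>
    using positive_nonprop[of \<delta> \<gamma> k] that \<gamma>(1) rank2_baseD(1)[OF base2] by blast
  have "x \<noteq> 0" using same[of b y] xy \<gamma> rank2_baseD[OF base2] by auto
  have "y \<noteq> 0" using same[of a x] xy \<gamma> rank2_baseD[OF base2] by auto
  note pos = \<open>x \<noteq> 0\<close> \<open>y \<noteq> 0\<close> xy(2,3)
  note ra = rank2_refl_coord[OF base2 refl(1)] and rb = rank2_refl_coord'[OF base2 refl(2)]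
  note nn = rank2_coord_nonneg[OF base2]
  have \<gamma>T: "x *\<^sub>R a + y *\<^sub>R b \<in> T" using \<gamma>(1) xy(1) by simp
  have A: "(m * y - x) *\<^sub>R a + y *\<^sub>R b \<in> T" using ra[OF \<gamma>T] pos by blast
  have B: "x *\<^sub>R a + (x - y) *\<^sub>R b \<in> T" using rb[OF \<gamma>T] pos by blast
  \<comment> \<open>The coordinates of \<open>s_a \<gamma>\<close> and \<open>s_b \<gamma>\<close>
    are nonnegative, so the slope \<open>x / y\<close> lies between 1 and \<open>m\<close>.\<close>
  have le: "x \<le> m * y" "y \<le> x" using nn(1)[OF A] nn(2)[OF B] by simp_all
  have abT: "a + b \<in> T"
    using rank2_baseD(5)[OF base2, of a] rank2_baseD(2)[OF base2] refl(2)
      rank2_coord_eq(1)[OF base2, of 1 0 0 1] by fastforce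
  have eq1: "\<gamma> = a + b" if "x = y" using same[OF abT, of y] that xy by (simp add: scaleR_add_right)
  have maT: "m *\<^sub>R a + b \<in> T"
    using rank2_baseD(4)[OF base2, of b] rank2_baseD(3)[OF base2] refl(1)
      rank2_coord_eq(1)[OF base2, of 1 0 0 1] by (fastforce simp: add.commute)
  have eqm: "\<gamma> = m *\<^sub>R a + b" if "x = m * y"
    using same[OF maT, of y] that xy by (simp add: scaleR_add_right mult.commute)
  show ?thesis
  proof (cases "x = y")
    case False
    then have "x - y > 0" using le by simp
    have BA: "(m * (x - y) - x) *\<^sub>R a + (x - y) *\<^sub>R b \<in> T" using ra[OF B] \<open>x - y > 0\<close> by simp
    from m consider "m = 1" | "m = 2" | "m = 3" by blast
    then show ?thesis
    proof cases
      case 1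
      then show ?thesis using le False by simp
    next
      case 2
      then have "x = m * y" using nn(1)[OF BA] le by simp
      then show ?thesis using eqm 2 by simp
    next
      case 3
      show ?thesis
      proof (cases "x = m * y")
        case False
        then have "m * y - x \<noteq> 0" by simp
        then have "y \<le> m * y - x" using nn(2)[OF rb[OF A]] by simp
        \<comment> \<open>Here \<open>1 < x / y < 3\<close>. If \<open>s_a s_b \<gamma>\<close> has
          no \<open>a\<close>-component, the slope is 3/2. Otherwise one more reflection gives
          \<open>x \<ge> 2 y\<close>, while \<open>s_b s_a \<gamma>\<close> gives
          \<open>x \<le> 2 y\<close>.\<close>
        show ?thesis
        proof (cases "m * (x - y) - x = 0")
          case True
          then have "\<gamma> = (y / 2) *\<^sub>R (3 *\<^sub>R a + 2 *\<^sub>R b)"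
            using xy(1) 3 by (simp add: scaleR_add_right)
          moreover have "3 *\<^sub>R a + (3 - 1) *\<^sub>R b \<in> T" using rb[of 3 1] maT 3 by simp
          ultimately show ?thesis using same[of "3 *\<^sub>R a + 2 *\<^sub>R b" "y / 2"] 3 by simp
        next
          case False
          then have "x - y \<le> m * (x - y) - x" using nn(2)[OF rb[OF BA]] by simp
          then have "x = 2 * y" using \<open>y \<le> m * y - x\<close> 3 by simp
          then have "\<gamma> = y *\<^sub>R (2 *\<^sub>R a + b)" using xy(1) by (simp add: scaleR_add_right mult.commute)
          moreover have "2 *\<^sub>R a + 1 *\<^sub>R b \<in> T" using ra[of 1 1] abT 3 by simp
          ultimately show ?thesis using same[of "2 *\<^sub>R a + b" y] 3 by simp
        qed
      qed (use eqm 3 in simp)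
    qed
  qed (use eq1 in simp)
qed

text \<open>The set with three roots is stable under \<open>s_b\<close>, which exchanges
  \<open>a\<close> and \<open>a + b\<close>. Once \<open>w b\<close> is positive, at most two edges
  are left in either case.\<close>

lemma rank2_extendable_small:
  assumes base2: "rank2_base T a b" and refl: "refl b a = a + b" and J: "J = {a, b} \<or> J = {a, b, a + b}"
    and "J \<subseteq> T" "w \<in> W"
  shows "extendable T J w"
  using J
proof
  assume "J = {a, b}"
  then show ?thesis
    using extendable_two_edges[OF base2, of J w a b] assms(4,5) by blast
next
  assume J: "J = {a, b, a + b}"
  note T = rank2_baseD[OF base2]
  show ?thesis
  proof (rule extendable_stable[OF T(1) \<open>J \<subseteq> T\<close> _ \<open>w \<in> W\<close> T(5)])
    fix v assume "v \<in> W" "v b \<bullet> \<rho> > 0"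
    then show "extendable T J v"
      using extendable_two_edges[OF base2, of J v a "a + b"] J \<open>J \<subseteq> T\<close> by force
  next
    have "refl b (a + b) = a" using refl_refl[of b a] refl by simp
    then show "refl b \<beta> \<in> J" if "\<beta> \<in> J" "\<beta> \<noteq> b" for \<beta> using that J refl by auto
  qed (use J in auto)
qed

text \<open>Four roots are stable under \<open>s_b\<close>, and for \<open>w b > 0\<close> only the
  short roots matter. Five roots are stable under \<open>s_a\<close>; for \<open>w a > 0\<close> the
  sign of \<open>w (3a + b)\<close> decides between the case of four roots and the
  octahedron.\<close>

lemma g2_extendable:
  assumes base2: "rank2_base T a b" and refl: "refl a b = b + 3 *\<^sub>R a" "refl b a = a + b"
    and J: "J = {a, b, a + b, 2 *\<^sub>R a + b} \<or> J = {a, b, a + b, 2 *\<^sub>R a + b, 3 *\<^sub>R a + b}"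
    and JT: "J \<subseteq> T" and r3: "3 *\<^sub>R a + 2 *\<^sub>R b \<in> T" and "w \<in> W"
  shows "extendable T J w"
proof -
  note T = rank2_baseD[OF base2]
  have nz: "a \<noteq> 0" "b \<noteq> 0"
    using T(1-3) positive_root(1) zero_not_root by blast+
  note g2 = g2_reflections[OF refl nz]
  note calc = refl_coroot[of a] refl_coroot[of b] g2(1-4) coroot_linear scaleR_expand
  have r: "refl a (a + b) = 2 *\<^sub>R a + b" "refl a (2 *\<^sub>R a + b) = a + b" "refl a (3 *\<^sub>R a + b) = b"
    "refl a b = 3 *\<^sub>R a + b" "refl b (a + b) = a" "refl b (2 *\<^sub>R a + b) = 2 *\<^sub>R a + b"
    "refl (a + b) a = 2 *\<^sub>R a + b" "refl (a + b) (2 *\<^sub>R a + b) = a"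
    "refl (3 *\<^sub>R a + b) a = - (2 *\<^sub>R a + b)"
    by (simp_all only: g2(5-8)) (simp_all add: calc algebra_simps)
  let ?S = "{a, a + b, 2 *\<^sub>R a + b}"
  have coroots: "coroot a (a + b) = - 1" "coroot a (2 *\<^sub>R a + b) = 1" "coroot a (3 *\<^sub>R a + b) = 3"
    by (simp_all add: coroot_linear g2(1,2))
  have ne: "a \<noteq> b" "a + b \<noteq> a" "a + b \<noteq> b" "2 *\<^sub>R a + b \<noteq> a" "2 *\<^sub>R a + b \<noteq> b" "2 *\<^sub>R a + b \<noteq> a + b"
    "3 *\<^sub>R a + b \<noteq> a"
    using coroots g2(1,2) by fastforce+
  have four: "extendable T J w" if J: "J = {a, b, a + b, 2 *\<^sub>R a + b}" and "J \<subseteq> T" "w \<in> W" for J w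
  proof (rule extendable_stable[OF T(1) \<open>J \<subseteq> T\<close> _ \<open>w \<in> W\<close> T(5)])
    \<comment> \<open>The positive short roots form a system of type A_2 with base \<open>a\<close>,
      \<open>a + b\<close>, to which the case of a full set applies.\<close>
    have "rank2_base ?S a (a + b)"
      unfolding rank2_base_def
    proof (intro conjI allI impI ballI)
      show "?S \<subseteq> \<Phi>p" using T(1) that by blast
    next
      fix p q assume "p *\<^sub>R a + q *\<^sub>R (a + b) = 0"
      then have "(p + q) *\<^sub>R a + q *\<^sub>R b = 0 *\<^sub>R a + 0 *\<^sub>R b" by (simp add: algebra_simps)
      then have "p + q = 0" "q = 0" using rank2_coord_eq[OF base2] by blast+
      then show "p = 0" "q = 0" by simp_all
    next
      fix \<beta> assume "\<beta> \<in> ?S"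
      then have "\<beta> = 1 *\<^sub>R a + 0 *\<^sub>R (a + b) \<or> \<beta> = 0 *\<^sub>R a + 1 *\<^sub>R (a + b) \<or> \<beta> = 1 *\<^sub>R a + 1 *\<^sub>R (a + b)"
        by (auto simp: scaleR_2)
      moreover have "(0::real) \<le> 0" "(0::real) \<le> 1" by simp_all
      ultimately show "\<exists>p q. 0 \<le> p \<and> 0 \<le> q \<and> \<beta> = p *\<^sub>R a + q *\<^sub>R (a + b)" by blast
    qed (use r ne in auto)
    then have full: "extendable ?S ?S v" if "v \<in> W" for v using extendable_full that by blast
    fix v assume v: "v \<in> W" "v b \<bullet> \<rho> > 0"
    show "extendable T J v"
      by (rule extendable_mono[OF full[OF v(1)]]) (use that v in auto)
  next
    show "refl b \<beta> \<in> J" if "\<beta> \<in> J" "\<beta> \<noteq> b" for \<beta> using that J r refl by auto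
  qed (use that in auto)
  have five: "extendable T J w" if J: "J = {a, b, a + b, 2 *\<^sub>R a + b, 3 *\<^sub>R a + b}" and "J \<subseteq> T" "w \<in> W" for w
  proof (rule extendable_stable[OF T(1) \<open>J \<subseteq> T\<close> _ \<open>w \<in> W\<close> T(4)])
    show stable: "refl a \<beta> \<in> J" if "\<beta> \<in> J" "\<beta> \<noteq> a" for \<beta> using that J r by auto
    fix w assume w: "w \<in> W" "w a \<bullet> \<rho> > 0"
    have mono: "extendable T J v" if v: "v \<in> W" "v (3 *\<^sub>R a + b) \<bullet> \<rho> > 0" for v
    proof (rule extendable_mono)
      show "extendable T {a, b, a + b, 2 *\<^sub>R a + b} v" using four v \<open>J \<subseteq> T\<close> J by blast
    qed (use J v in auto)
    show "extendable T J w"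
    proof (cases "w (3 *\<^sub>R a + b) \<bullet> \<rho> > 0")
      case False
      have r1: "3 *\<^sub>R a + b \<in> \<Phi>p" using J \<open>J \<subseteq> T\<close> T(1) by blast
      then have neg: "neg (w (3 *\<^sub>R a + b))"
        using False root_inner_rho_nonzero[OF weyl_root[OF w(1) positive_root(1)[OF r1]]] by linarith
      show ?thesis
        unfolding extendable_def
      proof (intro allI impI)
        fix P assume P: "gkm_below T J w P"
        show "\<exists>f. lifts J w P f"
        proof (rule g2_octahedron_values[OF T(1) J \<open>J \<subseteq> T\<close> r3 refl w neg P])
          \<comment> \<open>At \<open>z\<close> the root \<open>3a + b\<close> has positive image,
            so the case of four roots applies there, and a divided difference by \<open>a\<close>
            passes from \<open>z\<close> to \<open>w'\<close>. It remains to see that every vertex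
            below \<open>w'\<close> is also below \<open>w\<close>, where the congruences are
            available.\<close>
          define z w' where "z = w \<circ> refl (3 *\<^sub>R a + b)" and "w' = z \<circ> refl a"
          have z: "z \<in> W" unfolding z_def by (rule weyl_comp_refl[OF w(1) positive_root(1)[OF r1]])
          have wl: "w (x *\<^sub>R a + y *\<^sub>R b) \<bullet> \<rho> = x * (w a \<bullet> \<rho>) + y * (w b \<bullet> \<rho>)" for x y
            using weyl_linear[OF w(1)] by (simp add: linear_add linear_scale inner_add_left)
          have negs: "neg (w b)" "neg (w (a + b))" "neg (w (2 *\<^sub>R a + b))" "neg (w (3 *\<^sub>R a + 2 *\<^sub>R b))"
            using w(2) neg wl[of 3 1] wl[of 1 1] wl[of 2 1] wl[of 3 2] by simp_all
          have z_pos: "z (3 *\<^sub>R a + b) \<bullet> \<rho> > 0" "z a \<bullet> \<rho> > 0"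
          proof -
            have "z (3 *\<^sub>R a + b) = - w (3 *\<^sub>R a + b)" "z a = - w (2 *\<^sub>R a + b)"
              unfolding z_def o_apply refl_self r(9) by (rule weyl_neg_apply[OF w(1)])+
            then show "z (3 *\<^sub>R a + b) \<bullet> \<rho> > 0" "z a \<bullet> \<rho> > 0" using neg negs(3) by simp_all
          qed
          have w'_neg: "neg (w' a)" using z_pos by (simp add: w'_def weyl_neg_apply[OF z])
          have w': "w' \<in> W" unfolding w'_def by (rule weyl_comp_refl[OF z positive_root(1)]) (use T(1,2) in blast)
          have w'_z: "w' \<circ> refl a = z" by (simp add: w'_def)
          have "extendable T J (w' \<circ> refl a)" unfolding w'_z by (rule mono[OF z z_pos(1)])
          then have ext: "extendable T J w'"
            using extendable_divided_difference[OF w' T(1) \<open>J \<subseteq> T\<close> _ w'_neg T(4) stable] J by blast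
          have wz: "below T w z" unfolding z_def using J \<open>J \<subseteq> T\<close> neg by (intro belowI) auto
          have comps: "refl (3 *\<^sub>R a + b) \<circ> refl b \<circ> refl a = refl (2 *\<^sub>R a + b)"
            "refl (3 *\<^sub>R a + b) \<circ> refl (a + b) \<circ> refl a = refl (3 *\<^sub>R a + 2 *\<^sub>R b)"
            "refl (3 *\<^sub>R a + b) \<circ> refl (2 *\<^sub>R a + b) \<circ> refl a = refl b"
            "refl (3 *\<^sub>R a + b) \<circ> refl (3 *\<^sub>R a + 2 *\<^sub>R b) \<circ> refl a = refl (a + b)"
            by (simp_all only: fun_eq_iff o_apply g2(5-8)) (simp_all add: calc algebra_simps)
          \<comment> \<open>A vertex below \<open>w'\<close> is \<open>z\<close>, below
            \<open>z\<close>, or of the form \<open>y s_a\<close> with \<open>y\<close> below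
            \<open>z\<close>. For the last kind, a single step from \<open>z\<close> followed by
            \<open>s_a\<close> is one reflection of \<open>w\<close>; longer paths are conjugated by
            \<open>s_a\<close>.\<close>
          have first: "below T w (z \<circ> refl \<beta> \<circ> refl a)" if \<beta>: "\<beta> \<in> T" "neg (z \<beta>)" for \<beta>
          proof -
            have "\<beta> \<noteq> a" "\<beta> \<noteq> 3 *\<^sub>R a + b" using z_pos \<beta>(2) by auto
            then have "\<beta> \<in> {b, a + b, 2 *\<^sub>R a + b, 3 *\<^sub>R a + 2 *\<^sub>R b}"
              using rank2_roots[OF base2 refl _ \<beta>(1)] by auto
            then have "\<exists>\<gamma>\<in>T. neg (w \<gamma>) \<and> z \<circ> refl \<beta> \<circ> refl a = w \<circ> refl \<gamma>"
              using J \<open>J \<subseteq> T\<close> r3 negs comps by (auto simp: z_def comp_assoc)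
            then show ?thesis using belowI by metis
          qed
          have second: "below T w (y \<circ> refl a)" if "below T z y" for y
            using that
          proof (induction rule: tranclp_induct)
            case (base y)
            then show ?case using first unfolding descent_def by blast
          next
            case (step y y')
            then obtain \<beta> where \<beta>: "\<beta> \<in> T" "neg (y \<beta>)" "y' = y \<circ> refl \<beta>"
              unfolding descent_def by blast
            show ?case
            proof (cases "\<beta> = a")
              case True
              have "y' \<circ> refl a = y" unfolding \<beta>(3) True by simp
              then show ?thesis using tranclp_trans[OF wz step.hyps(1)] by (simp only:)
            next
              case False
              then have "descent T (y \<circ> refl a) (y' \<circ> refl a)"
                unfolding \<beta>(3) using descent_conj \<beta> T(4) by blast
              with step.IH show ?thesis by (meson tranclp.trancl_into_trancl)
            qed
          qed
          have below_w: "below T w y" if "below T w' y" for y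
          proof -
            have "y = w' \<circ> refl a \<or> below T (w' \<circ> refl a) y \<or> below T (w' \<circ> refl a) (y \<circ> refl a)"
              by (rule below_cases_simple) (use T(4) that in blast)+
            then show ?thesis
              unfolding w'_z
            proof (elim disjE)
              assume "below T z (y \<circ> refl a)"
              then have "below T w (y \<circ> refl a \<circ> refl a)" by (rule second)
              then show ?thesis by simp
            qed (use wz tranclp_trans[OF wz] in blast)+
          qed
          have "gkm_below T J w' P" using P below_w unfolding gkm_below_def by blast
          then have "\<exists>v. lifts J w' P v"
            using ext unfolding extendable_def by blast
          then show "\<exists>v. lifts J (w \<circ> refl (3 *\<^sub>R a + b) \<circ> refl a) P v"
            unfolding w'_def z_def .
        qed
      qed
    qed (rule mono[OF w(1)])
  qed (use J in auto)
  show ?thesis using four five J JT \<open>w \<in> W\<close> by blast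
qed

section \<open>The base of a plane and its Cartan integers\<close>

lemma coroot_int: "\<alpha> \<in> \<Phi> \<Longrightarrow> \<beta> \<in> \<Phi> \<Longrightarrow> coroot \<alpha> \<beta> \<in> \<int>"
  using cartan_int by (simp add: coroot_def)

text \<open>The Cartan integers are nonpositive because reflected simple roots have nonnegative
  coordinates. They vanish together, and their product is below 4, so one of them is -1 unless both
  are 0.\<close>

lemma rank2_cartan:
  assumes base2: "rank2_base T a b"
  obtains "refl a b = b" "refl b a = a"
  | m where "m \<in> {1, 2, 3}" "refl a b = b + m *\<^sub>R a" "refl b a = a + b"
  | m where "m \<in> {1, 2, 3}" "refl b a = a + m *\<^sub>R b" "refl a b = b + a"
proof -
  note T = rank2_baseD[OF base2]
  have roots: "a \<in> \<Phi>" "b \<in> \<Phi>" using T positive_root(1) by blast+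
  have ab: "a \<noteq> b"
    using rank2_coord_eq(1)[OF base2, of 1 0 0 1] by auto
  obtain i j where i: "coroot a b = of_int i" and j: "coroot b a = of_int j"
    using coroot_int roots by (meson Ints_cases)
  have nz: "a \<bullet> a > 0" "b \<bullet> b > 0" using roots zero_not_root by auto
  have ra: "refl a b = (- of_int i) *\<^sub>R a + 1 *\<^sub>R b" and rb: "refl b a = 1 *\<^sub>R a + (- of_int j) *\<^sub>R b"
    by (simp_all add: refl_coroot i j)
  have "refl a b \<in> T" "refl b a \<in> T" using T ab by blast+
  then have le: "i \<le> 0" "j \<le> 0"
    using rank2_coord_nonneg[OF base2] unfolding ra rb by fastforce+
  have ab_i: "2 * (a \<bullet> b) = of_int i * (a \<bullet> a)" and ab_j: "2 * (a \<bullet> b) = of_int j * (b \<bullet> b)"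
    using i j nz by (simp_all add: coroot_def field_simps inner_commute)
  have lt: "i * j < 4"
  proof -
    \<comment> \<open>A multiple of the component of \<open>a\<close> orthogonal to
      \<open>b\<close>; that it is nonzero gives the strict Cauchy-Schwarz inequality.\<close>
    define x where "x = (b \<bullet> b) *\<^sub>R a - (a \<bullet> b) *\<^sub>R b"
    have "x \<noteq> 0"
    proof
      assume "x = 0"
      then have "(b \<bullet> b) *\<^sub>R a + (- (a \<bullet> b)) *\<^sub>R b = 0" by (simp add: x_def)
      then have "b \<bullet> b = 0" using base2 unfolding rank2_base_def by blast
      then show False using nz by simp
    qed
    then have "x \<bullet> x > 0" by simp
    also have "x \<bullet> x = (b \<bullet> b) * ((a \<bullet> a) * (b \<bullet> b) - (a \<bullet> b) * (a \<bullet> b))"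
      by (simp add: x_def inner_diff_left inner_diff_right inner_commute algebra_simps)
    finally have "(a \<bullet> b) * (a \<bullet> b) < (a \<bullet> a) * (b \<bullet> b)"
      using nz by (simp add: zero_less_mult_iff)
    moreover have "4 * ((a \<bullet> b) * (a \<bullet> b)) = (of_int i * (a \<bullet> a)) * (of_int j * (b \<bullet> b))"
      by (simp flip: ab_i ab_j)
    ultimately have "of_int (i * j) * ((a \<bullet> a) * (b \<bullet> b)) < 4 * ((a \<bullet> a) * (b \<bullet> b))"
      by (simp add: mult_ac)
    then have "of_int (i * j) < (4::real)" using nz by (simp add: mult_less_cancel_right)
    then show ?thesis by linarith
  qed
  have zero: "i = 0 \<longleftrightarrow> j = 0"
    using ab_i ab_j nz by (metis mult_eq_0_iff of_int_0_eq_iff less_irrefl)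
  show thesis
  proof (cases "i = 0")
    case True
    then show thesis using zero ra rb by (intro that(1)) simp_all
  next
    case False
    then have neg: "i \<le> - 1" "j \<le> - 1" using le zero by auto
    have "i = - 1 \<or> j = - 1"
    proof (rule ccontr)
      assume "\<not> ?thesis"
      then have "2 * 2 \<le> (- i) * (- j)" using neg by (intro mult_mono) auto
      then show False using lt by simp
    qed
    then show thesis
    proof
      assume "j = - 1"
      then have "i = - 1 \<or> i = - 2 \<or> i = - 3" using lt neg by auto
      then show thesis using that(2)[of "- of_int i"] ra rb \<open>j = - 1\<close> by (auto simp: add.commute)
    next
      assume "i = - 1"
      then have "j = - 1 \<or> j = - 2 \<or> j = - 3" using lt neg by auto
      then show thesis using that(3)[of "- of_int j"] ra rb \<open>i = - 1\<close> by (auto simp: add.commute)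
    qed
  qed
qed

text \<open>The pairings with \<open>\<eta>\<close> and \<open>\<rho>\<close> are coordinates on the
  plane. Positive roots lie in the open half plane of positive height, so those of extremal slope
  generate the cone of all of them.\<close>

lemma rank2_base_exists:
  assumes \<beta>: "\<beta> \<in> \<Phi>p" "\<beta>' \<in> \<Phi>p" "\<beta> \<noteq> \<beta>'"
  shows "\<exists>a b. rank2_base (\<Phi>p \<inter> span {\<beta>, \<beta>'}) a b"
proof -
  define T where "T = \<Phi>p \<inter> span {\<beta>, \<beta>'}"
  have fin: "finite T" unfolding T_def
    by (rule finite_subset[OF _ finite_roots]) (auto simp: positive_root_iff)
  have \<beta>T: "\<beta> \<in> T" "\<beta>' \<in> T" using \<beta> by (simp_all add: T_def span_base)
  have T_pos: "\<gamma> \<bullet> \<rho> > 0" if "\<gamma> \<in> T" for \<gamma> using that positive_root(2) by (simp add: T_def)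
  have "\<beta>' \<bullet> \<beta>' > 0" using \<beta> positive_root(1) zero_not_root by auto
  \<comment> \<open>The component of \<open>\<beta>\<close> orthogonal to \<open>\<beta>'\<close>,
    which gives the two roots different slopes.\<close>
  define \<eta> where "\<eta> = \<beta> - ((\<beta> \<bullet> \<beta>') / (\<beta>' \<bullet> \<beta>')) *\<^sub>R \<beta>'"
  have \<eta>': "\<beta>' \<bullet> \<eta> = 0" using \<open>\<beta>' \<bullet> \<beta>' > 0\<close> by (simp add: \<eta>_def inner_diff_right inner_commute)
  have "\<eta> \<noteq> 0"
  proof
    assume "\<eta> = 0"
    then have "\<beta> = ((\<beta> \<bullet> \<beta>') / (\<beta>' \<bullet> \<beta>')) *\<^sub>R \<beta>'" by (simp add: \<eta>_def)
    then show False using positive_nonprop[OF \<beta>(2,1)] \<beta>(3) by blast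
  qed
  have "\<beta> \<bullet> \<eta> = \<eta> \<bullet> \<eta>"
    using \<eta>' by (subst (2) \<eta>_def) (simp add: inner_diff_left)
  then have \<eta>: "\<beta> \<bullet> \<eta> > 0" using \<open>\<eta> \<noteq> 0\<close> by simp
  text \<open>The base consists of the two positive roots of extremal slope.\<close>
  define slope where "slope \<gamma> = (\<gamma> \<bullet> \<eta>) / (\<gamma> \<bullet> \<rho>)" for \<gamma>
  have "Max (slope ` T) \<in> slope ` T" "Min (slope ` T) \<in> slope ` T"
    using fin \<beta>T by (intro Max_in Min_in; blast)+
  then obtain a b where "a \<in> T" "slope a = Max (slope ` T)" "b \<in> T" "slope b = Min (slope ` T)"
    by (metis imageE)
  then have a: "a \<in> T" "\<And>\<gamma>. \<gamma> \<in> T \<Longrightarrow> slope \<gamma> \<le> slope a"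
    and b: "b \<in> T" "\<And>\<gamma>. \<gamma> \<in> T \<Longrightarrow> slope b \<le> slope \<gamma>"
    using fin by simp_all
  have "slope \<beta>' < slope \<beta>" using \<eta> \<eta>' T_pos \<beta>T by (simp add: slope_def)
  then have ab: "slope b < slope a" using a(2)[OF \<beta>T(1)] b(2)[OF \<beta>T(2)] by linarith
  have vanish: "e = 0" if "e \<in> span {\<beta>, \<beta>'}" "e \<bullet> \<eta> = 0" "e \<bullet> \<rho> = 0" for e
  proof -
    obtain p q where e: "e = p *\<^sub>R \<beta> + q *\<^sub>R \<beta>'" using \<open>e \<in> _\<close> unfolding span_pair_iff by blast
    have "p = 0" using that(2) \<eta> \<eta>' by (simp add: e inner_add_left)
    moreover have "q = 0" using that(3) T_pos[OF \<beta>T(2)] \<open>p = 0\<close> by (simp add: e inner_add_left)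
    ultimately show ?thesis using e by simp
  qed
  have comb: "\<exists>p q. p \<ge> 0 \<and> q \<ge> 0 \<and> \<gamma> = p *\<^sub>R a + q *\<^sub>R b" if \<gamma>: "\<gamma> \<in> T" for \<gamma>
  proof -
    define t where "t = (slope \<gamma> - slope b) / (slope a - slope b)"
    have t: "0 \<le> t" "t \<le> 1" using ab a(2)[OF \<gamma>] b(2)[OF \<gamma>] by (simp_all add: t_def field_simps)
    have ts: "t * slope a + (1 - t) * slope b = slope \<gamma>"
    proof -
      have "t * (slope a - slope b) = slope \<gamma> - slope b" using ab by (simp add: t_def)
      then show ?thesis by (simp add: algebra_simps)
    qed
    define p q where "p = t * (\<gamma> \<bullet> \<rho>) / (a \<bullet> \<rho>)" and "q = (1 - t) * (\<gamma> \<bullet> \<rho>) / (b \<bullet> \<rho>)"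
    have "\<gamma> - (p *\<^sub>R a + q *\<^sub>R b) = 0"
    proof (rule vanish)
      show "\<gamma> - (p *\<^sub>R a + q *\<^sub>R b) \<in> span {\<beta>, \<beta>'}"
        using \<gamma> a(1) b(1) unfolding T_def by (intro span_diff span_add span_scale) auto
      have "p * (a \<bullet> \<eta>) + q * (b \<bullet> \<eta>) = (t * slope a + (1 - t) * slope b) * (\<gamma> \<bullet> \<rho>)"
        by (simp add: p_def q_def slope_def algebra_simps)
      also have "\<dots> = \<gamma> \<bullet> \<eta>" unfolding ts using T_pos[OF \<gamma>] by (simp add: slope_def)
      finally show "(\<gamma> - (p *\<^sub>R a + q *\<^sub>R b)) \<bullet> \<eta> = 0" by (simp add: inner_diff_left inner_add_left)
      have "p * (a \<bullet> \<rho>) = t * (\<gamma> \<bullet> \<rho>)" "q * (b \<bullet> \<rho>) = (1 - t) * (\<gamma> \<bullet> \<rho>)"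
        using T_pos[OF a(1)] T_pos[OF b(1)] by (simp_all add: p_def q_def)
      then show "(\<gamma> - (p *\<^sub>R a + q *\<^sub>R b)) \<bullet> \<rho> = 0"
        by (simp add: inner_diff_left inner_add_left left_diff_distrib)
    qed
    moreover have "p \<ge> 0" "q \<ge> 0"
      using t T_pos[OF a(1)] T_pos[OF b(1)] T_pos[OF \<gamma>] by (simp_all add: p_def q_def)
    ultimately show ?thesis by (intro exI[of _ p] exI[of _ q]) simp
  qed
  have indep2: "p = 0 \<and> q = 0" if "p *\<^sub>R a + q *\<^sub>R b = 0" for p q
  proof -
    have "p * (a \<bullet> \<rho>) + q * (b \<bullet> \<rho>) = 0" "p * (a \<bullet> \<eta>) + q * (b \<bullet> \<eta>) = 0"
      using arg_cong[OF that, of "\<lambda>x. x \<bullet> \<rho>"] arg_cong[OF that, of "\<lambda>x. x \<bullet> \<eta>"]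
      by (simp_all add: inner_add_left)
    moreover have "a \<bullet> \<eta> = slope a * (a \<bullet> \<rho>)" "b \<bullet> \<eta> = slope b * (b \<bullet> \<rho>)"
      using T_pos[OF a(1)] T_pos[OF b(1)] by (simp_all add: slope_def)
    ultimately have s: "p * (a \<bullet> \<rho>) = - (q * (b \<bullet> \<rho>))" "slope a * (p * (a \<bullet> \<rho>)) + slope b * (q * (b \<bullet> \<rho>)) = 0"
      by (simp_all add: algebra_simps)
    then have "(slope b - slope a) * (q * (b \<bullet> \<rho>)) = 0" by (simp add: algebra_simps)
    then have "q = 0" using ab T_pos[OF b(1)] by auto
    then show ?thesis using s(1) T_pos[OF a(1)] by auto
  qed
  \<comment> \<open>Reflection in \<open>c\<close> keeps the positive coefficient of the other base
    vector, so the negative of the reflected root cannot be positive.\<close>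
  have closed: "refl c \<gamma> \<in> T"
    if c: "c \<in> T" "\<gamma> \<in> T" and \<gamma>: "\<gamma> = p *\<^sub>R c + q *\<^sub>R c'" "q > 0"
      and comb': "\<And>\<delta>. \<delta> \<in> T \<Longrightarrow> \<exists>p q. p \<ge> 0 \<and> q \<ge> 0 \<and> \<delta> = p *\<^sub>R c + q *\<^sub>R c'"
      and indep': "\<And>p q. p *\<^sub>R c + q *\<^sub>R c' = 0 \<Longrightarrow> q = 0" for c c' \<gamma> p q
  proof -
    have cr: "c \<in> \<Phi>" "\<gamma> \<in> \<Phi>" using c positive_root(1) by (auto simp: T_def)
    then have root: "refl c \<gamma> \<in> \<Phi>" by (rule refl_root)
    have sp: "refl c \<gamma> \<in> span {\<beta>, \<beta>'}"
      unfolding refl_def using c by (intro span_diff span_scale) (auto simp: T_def)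
    have "- refl c \<gamma> \<notin> T"
    proof
      assume "- refl c \<gamma> \<in> T"
      then obtain p' q' where q': "q' \<ge> 0" "- refl c \<gamma> = p' *\<^sub>R c + q' *\<^sub>R c'" using comb' by blast
      have r: "(p - coroot c \<gamma>) *\<^sub>R c + q *\<^sub>R c' = refl c \<gamma>"
        by (simp add: refl_coroot scaleR_diff_left \<gamma>(1)[symmetric] diff_add_eq)
      have "(p - coroot c \<gamma> + p') *\<^sub>R c + (q + q') *\<^sub>R c' =
          ((p - coroot c \<gamma>) *\<^sub>R c + q *\<^sub>R c') + (p' *\<^sub>R c + q' *\<^sub>R c')"
        by (simp add: scaleR_add_left)
      also have "\<dots> = 0" unfolding r q'(2)[symmetric] by simp
      finally have "(p - coroot c \<gamma> + p') *\<^sub>R c + (q + q') *\<^sub>R c' = 0" .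
      then have "q + q' = 0" by (rule indep')
      then show False using q'(1) \<gamma>(2) by simp
    qed
    then have "- refl c \<gamma> \<notin> \<Phi>p" using span_neg[OF sp] by (simp add: T_def)
    then show ?thesis using root_cases[OF root] sp by (simp add: T_def)
  qed
  have nonprop: "\<gamma> = c" if "\<gamma> \<in> T" "c \<in> T" "\<gamma> = p *\<^sub>R c" for \<gamma> c p
    using positive_nonprop[of c \<gamma> p] that by (simp add: T_def)
  have "rank2_base T a b"
    unfolding rank2_base_def
  proof (intro conjI ballI allI impI)
    show "refl a \<gamma> \<in> T" if \<gamma>: "\<gamma> \<in> T" "\<gamma> \<noteq> a" for \<gamma>
    proof -
      obtain p q where pq: "p \<ge> 0" "q \<ge> 0" "\<gamma> = p *\<^sub>R a + q *\<^sub>R b" using comb \<gamma> by blast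
      then have "q \<noteq> 0" using nonprop[OF \<gamma>(1) a(1), of p] \<gamma>(2) by auto
      then show ?thesis using closed[OF a(1) \<gamma>(1) pq(3)] comb indep2 pq(2) by force
    qed
    show "refl b \<gamma> \<in> T" if \<gamma>: "\<gamma> \<in> T" "\<gamma> \<noteq> b" for \<gamma>
    proof -
      obtain p q where pq: "p \<ge> 0" "q \<ge> 0" "\<gamma> = p *\<^sub>R a + q *\<^sub>R b" using comb \<gamma> by blast
      then have "p \<noteq> 0" using nonprop[OF \<gamma>(1) b(1), of q] \<gamma>(2) by auto
      have pq': "\<gamma> = q *\<^sub>R b + p *\<^sub>R a" using pq(3) by (simp add: add.commute)
      show ?thesis
      proof (rule closed[OF b(1) \<gamma>(1) pq'])
        show "p > 0" using pq \<open>p \<noteq> 0\<close> by simp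
        show "\<exists>p q. p \<ge> 0 \<and> q \<ge> 0 \<and> \<delta> = p *\<^sub>R b + q *\<^sub>R a" if "\<delta> \<in> T" for \<delta>
          using comb[OF that] by (metis add.commute)
        show "q = 0" if "p *\<^sub>R b + q *\<^sub>R a = 0" for p q
          using indep2[of q p] that by (simp add: add.commute)
      qed
    qed
  qed (use a(1) b(1) comb indep2 in \<open>auto simp: T_def\<close>)
  then show ?thesis unfolding T_def by blast
qed

end

section \<open>Hessenberg sets in a plane\<close>

locale hessenberg = root_system +
  fixes h :: "'a set"
  assumes hess: "hessenberg_set \<Phi> \<Delta> h"
begin

lemma h_positive: "\<beta> \<in> h \<Longrightarrow> \<beta> \<in> \<Phi>p"
  using hess unfolding hessenberg_set_def by blast

lemma h_lower: "\<gamma> \<in> h \<Longrightarrow> \<beta> \<in> \<Phi>p \<Longrightarrow> \<gamma> - \<beta> \<in> \<Phi>p \<Longrightarrow> \<beta> \<in> h"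
  using hess h_positive[of \<gamma>] pos_sums.intros(1)[of "\<gamma> - \<beta>" \<Phi>p]
  unfolding hessenberg_set_def root_prec_def by blast

text \<open>Two distinct roots in the lower set force both simple roots into it. Subtracting simple
  roots orders the remaining ones in a chain, so the possible lower sets are the initial segments of
  this chain.\<close>

lemma extendable_asymmetric:
  assumes base2: "rank2_base T a b" and m: "m \<in> {1, 2, 3}" "refl a b = b + m *\<^sub>R a" "refl b a = a + b"
    and two: "\<beta> \<in> h \<inter> T" "\<beta>' \<in> h \<inter> T" "\<beta> \<noteq> \<beta>'" and "w \<in> W"
  shows "extendable T (h \<inter> T) w"
proof -
  note T = rank2_baseD[OF base2]
  let ?J = "h \<inter> T"
  have pos: "\<gamma> \<in> \<Phi>p" if "\<gamma> \<in> T" for \<gamma> using that T(1) by blast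
  note roots = rank2_roots[OF base2 m(2,3,1)]
  note rc = rank2_refl_coord[OF base2 m(2)] and rc' = rank2_refl_coord'[OF base2 m(3)]
  have abT: "a + b \<in> T" using rc'[of 1 0] T(2) by simp
  have ab_simple: "a \<in> h" "b \<in> h" if "a + b \<in> h"
    using h_lower[OF that] T pos by simp_all
  have r2T: "2 *\<^sub>R a + b \<in> T" if m2: "m \<ge> 2"
  proof -
    consider "m = 2" | "m = 3" using m(1) m2 by auto
    then show ?thesis using rc[of 0 1] rc[of 1 1] T(3) abT by cases simp_all
  qed
  have r1T: "3 *\<^sub>R a + b \<in> T" if "m = 3" using rc[of 0 1] T(3) that by simp
  have r3T: "3 *\<^sub>R a + 2 *\<^sub>R b \<in> T" if "m = 3" using rc'[of 3 1] r1T[OF that] by simp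
  have down2: "a + b \<in> h" if "2 *\<^sub>R a + b \<in> h"
    by (rule h_lower[OF that pos[OF abT]]) (simp add: pos[OF T(2)] algebra_simps scaleR_2)
  have down1: "2 *\<^sub>R a + b \<in> h" if "3 *\<^sub>R a + b \<in> h" "m = 3"
    using h_lower[OF that(1), of "2 *\<^sub>R a + b"] r2T pos T(2) that(2) by (simp flip: scaleR_diff_left)
  have down3: "3 *\<^sub>R a + b \<in> h" if "3 *\<^sub>R a + 2 *\<^sub>R b \<in> h" "m = 3"
    using h_lower[OF that(1), of "3 *\<^sub>R a + b"] r1T pos T(3) that(2) by (simp add: scaleR_2)
  have ab: "a \<in> h" "b \<in> h"
  proof -
    have "a \<in> h \<and> b \<in> h"
    proof (cases "a + b \<in> h")
      case False
      then have "\<gamma> = a \<or> \<gamma> = b" if "\<gamma> \<in> ?J" for \<gamma>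
        using roots[of \<gamma>] that down1 down2 down3 by blast
      then show ?thesis using two by blast
    qed (use ab_simple in blast)
    then show "a \<in> h" "b \<in> h" by blast+
  qed
  have small: ?thesis if "?J = {a, b} \<or> ?J = {a, b, a + b}"
    using rank2_extendable_small[OF base2 m(3) that _ \<open>w \<in> W\<close>] by blast
  have full: ?thesis if "T \<subseteq> h"
    using extendable_full[OF base2 \<open>w \<in> W\<close>] that by (simp add: Int_absorb1)
  have inJ: "a \<in> ?J" "b \<in> ?J" using ab T by blast+
  consider "a + b \<notin> h" | "a + b \<in> h" "m = 1 \<or> 2 *\<^sub>R a + b \<notin> h"
    | "a + b \<in> h" "m = 2" "2 *\<^sub>R a + b \<in> h" | "a + b \<in> h" "m = 3" "2 *\<^sub>R a + b \<in> h"
    using m(1) by blast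
  then show ?thesis
  proof cases
    case 1
    then have "?J \<subseteq> {a, b}" using roots down1 down2 down3 by blast
    then have "?J = {a, b}" using inJ by blast
    then show ?thesis using small by blast
  next
    case 2
    then have "?J \<subseteq> {a, b, a + b}" using roots down1 down3 by fastforce
    then have "?J = {a, b, a + b}" using inJ 2 abT by blast
    then show ?thesis using small by blast
  next
    case 3
    then have "T \<subseteq> {a, b, a + b, 2 *\<^sub>R a + b}" using roots by auto
    then show ?thesis using full 3 ab by blast
  next
    case 4
    have Tsub: "T \<subseteq> {a, b, a + b, 2 *\<^sub>R a + b, 3 *\<^sub>R a + b, 3 *\<^sub>R a + 2 *\<^sub>R b}" using roots by blast
    have J3: "a + b \<in> ?J" "2 *\<^sub>R a + b \<in> ?J" using 4 abT r2T by auto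
    have refl3: "refl a b = b + 3 *\<^sub>R a" using m(2) 4 by simp
    note g2 = g2_extendable[OF base2 refl3 m(3) _ _ r3T[OF 4(2)] \<open>w \<in> W\<close>]
    show ?thesis
    proof (cases "3 *\<^sub>R a + 2 *\<^sub>R b \<in> h")
      case True
      then have "T \<subseteq> h" using Tsub 4 ab down3 by blast
      then show ?thesis by (rule full)
    next
      case False
      then have sub: "?J \<subseteq> {a, b, a + b, 2 *\<^sub>R a + b, 3 *\<^sub>R a + b}" using Tsub by blast
      show ?thesis
      proof (cases "3 *\<^sub>R a + b \<in> h")
        case True
        then have "?J = {a, b, a + b, 2 *\<^sub>R a + b, 3 *\<^sub>R a + b}" using sub inJ J3 r1T 4 by blast
        then show ?thesis by (intro g2) auto
      next
        case False
        then have "?J = {a, b, a + b, 2 *\<^sub>R a + b}" using sub inJ J3 by blast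
        then show ?thesis by (intro g2) auto
      qed
    qed
  qed
qed

text \<open>The simple roots can be ordered so that \<open>refl b a = a + b\<close>, unless they are
  orthogonal. In that case \<open>s_a\<close> negates the coefficient of \<open>a\<close>, which
  leaves no root besides the simple ones.\<close>

lemma extendable_plane:
  assumes \<beta>: "\<beta> \<in> h" "\<beta>' \<in> h" "\<beta> \<noteq> \<beta>'" and "w \<in> W" and T_def: "T = \<Phi>p \<inter> span {\<beta>, \<beta>'}"
  shows "extendable T (h \<inter> T) w"
proof -
  have two: "\<beta> \<in> h \<inter> T" "\<beta>' \<in> h \<inter> T"
    using \<beta> h_positive by (simp_all add: T_def span_base)
  obtain a b where base2: "rank2_base T a b"
    using rank2_base_exists[OF h_positive[OF \<beta>(1)] h_positive[OF \<beta>(2)] \<beta>(3)] unfolding T_def by blast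
  note T = rank2_baseD[OF base2]
  from base2 show ?thesis
  proof (cases rule: rank2_cartan)
    case 1
    have "\<gamma> = a \<or> \<gamma> = b" if \<gamma>: "\<gamma> \<in> T" for \<gamma>
    proof (rule ccontr)
      assume other: "\<not> (\<gamma> = a \<or> \<gamma> = b)"
      obtain p q where pq: "p \<ge> 0" "q \<ge> 0" "\<gamma> = p *\<^sub>R a + q *\<^sub>R b"
        using base2 \<gamma> unfolding rank2_base_def by blast
      have "refl a \<gamma> \<in> T" using T(4) \<gamma> other by blast
      also have "refl a \<gamma> = (- p) *\<^sub>R a + q *\<^sub>R b" using pq(3) 1 by (simp add: refl_add refl_scale)
      finally have "p = 0" using rank2_coord_nonneg(1)[OF base2] pq(1) by fastforce
      then have "\<gamma> = q *\<^sub>R b" using pq(3) by simp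
      moreover have "b \<in> \<Phi>p" "\<gamma> \<in> \<Phi>p" using T(1,3) \<gamma> by blast+
      ultimately have "b = \<gamma>" using positive_nonprop by blast
      then show False using other by blast
    qed
    then have "h \<inter> T = {a, b}" using two \<beta>(3) by blast
    then show ?thesis using extendable_two_edges[OF base2, of "{a, b}" w a b] T(2,3) \<open>w \<in> W\<close> by auto
  next
    case (2 m)
    then show ?thesis using extendable_asymmetric[OF base2 _ _ _ two \<beta>(3) \<open>w \<in> W\<close>] by blast
  next
    case (3 m)
    then show ?thesis
      using extendable_asymmetric[OF rank2_base_commute[OF base2] _ _ _ two \<beta>(3) \<open>w \<in> W\<close>] by blast
  qed
qed

end

section \<open>Flow-up classes\<close>

context hessenberg
begin

lemma finite_h: "finite h"
  by (rule finite_subset[OF _ finite_roots]) (auto dest: h_positive positive_root)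

definition inv_h :: "('a \<Rightarrow> 'a) \<Rightarrow> 'a set" where
  "inv_h w = {\<beta>\<in>h. neg (w \<beta>)}"

lemma finite_inv_h: "finite (inv_h w)"
  using finite_h by (simp add: inv_h_def)

lemma inv_h_psi: "w \<in> W \<Longrightarrow> \<beta> \<in> inv_h w \<Longrightarrow> \<psi> w < \<psi> (w \<circ> refl \<beta>)"
  using psi_less h_positive by (auto simp: inv_h_def)

lemma inv_h_weyl: "w \<in> W \<Longrightarrow> \<beta> \<in> h \<Longrightarrow> w \<circ> refl \<beta> \<in> W"
  by (rule weyl_comp_refl[OF _ positive_root(1)[OF h_positive]])

lemma lf_h_span: "w \<in> W \<Longrightarrow> \<beta> \<in> h \<Longrightarrow> w \<beta> \<in> span \<Delta>"
  using weyl_pos_span h_positive by blast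

text \<open>The condition on \<open>inv w \<alpha>\<close> says
  \<open>\<alpha> = - w \<beta>\<close> with \<open>\<beta>\<close> in \<open>h\<close>, and then
  \<open>s_\<alpha> w = w s_\<beta>\<close>. Positivity of the label is the negativity of
  \<open>w \<beta>\<close>.\<close>

lemma hess_edge_iff:
  "hess_edge \<Phi> \<Delta> h u \<alpha> w \<longleftrightarrow> w \<in> W \<and> (\<exists>\<beta>\<in>inv_h w. \<alpha> = - w \<beta> \<and> u = w \<circ> refl \<beta>)"
proof
  assume e: "hess_edge \<Phi> \<Delta> h u \<alpha> w"
  then have w: "w \<in> W" and u: "w = refl \<alpha> \<circ> u" and \<alpha>: "\<alpha> \<in> \<Phi>p"
    unfolding hess_edge_def by blast+
  obtain \<beta> where \<beta>: "\<beta> \<in> h" "inv w \<alpha> = - \<beta>"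
    using e unfolding hess_edge_def by blast
  have "surj w" by (rule orthogonal_transformation_surj[OF weyl_orthogonal[OF w]])
  then have "\<alpha> = w (- \<beta>)" using \<beta>(2) surj_f_inv_f[of w \<alpha>] by simp
  then have \<alpha>': "\<alpha> = - w \<beta>" by (simp add: weyl_neg_apply[OF w])
  then have "neg (w \<beta>)" using positive_root(2)[OF \<alpha>] by simp
  moreover have "u = w \<circ> refl \<beta>"
  proof -
    have "refl \<alpha> \<circ> (refl \<alpha> \<circ> u) = u" by simp
    then have "refl \<alpha> \<circ> w = u" by (simp only: u[symmetric])
    then show ?thesis
      unfolding orthogonal_comp_refl[OF weyl_orthogonal[OF w]] \<alpha>' refl_uminus by (rule sym)
  qed
  ultimately show "w \<in> W \<and> (\<exists>\<beta>\<in>inv_h w. \<alpha> = - w \<beta> \<and> u = w \<circ> refl \<beta>)"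
    using w \<alpha>' \<beta>(1) by (auto simp: inv_h_def)
next
  assume "w \<in> W \<and> (\<exists>\<beta>\<in>inv_h w. \<alpha> = - w \<beta> \<and> u = w \<circ> refl \<beta>)"
  then obtain \<beta> where w: "w \<in> W" and \<beta>: "\<beta> \<in> h" "neg (w \<beta>)" and \<alpha>: "\<alpha> = - w \<beta>" and u: "u = w \<circ> refl \<beta>"
    by (auto simp: inv_h_def)
  have "w \<beta> \<in> \<Phi>" by (rule weyl_root[OF w positive_root(1)[OF h_positive[OF \<beta>(1)]]])
  then have "\<alpha> \<in> \<Phi>p" using neg_root[of "w \<beta>"] \<beta>(2) by (simp add: positive_root_iff \<alpha>)
  moreover have "w = refl \<alpha> \<circ> u"
    unfolding u \<alpha> refl_uminus orthogonal_comp_refl[OF weyl_orthogonal[OF w]] by simp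
  moreover have "inv w \<alpha> = - \<beta>"
    unfolding \<alpha> weyl_neg_apply[OF w, symmetric]
    by (rule inv_f_f[OF orthogonal_transformation_inj[OF weyl_orthogonal[OF w]]])
  ultimately show "hess_edge \<Phi> \<Delta> h u \<alpha> w"
    unfolding hess_edge_def using w \<beta>(1) inv_h_weyl[OF w \<beta>(1)] u by auto
qed

lemma hess_less_psi: "hess_less \<Phi> \<Delta> h x y \<Longrightarrow> \<psi> y < \<psi> x"
proof -
  let ?E = "{(u, w). \<exists>\<alpha>. hess_edge \<Phi> \<Delta> h u \<alpha> w}"
  have edge: "\<psi> w < \<psi> u" if "(u, w) \<in> ?E" for u w
    using that inv_h_psi by (auto simp: hess_edge_iff)
  assume "hess_less \<Phi> \<Delta> h x y"
  then have "(x, y) \<in> ?E\<^sup>+" by (simp add: hess_less_def)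
  then show ?thesis
  proof (induction rule: trancl_induct)
    case (base y)
    then show ?case by (rule edge)
  next
    case (step y z)
    then show ?case using edge[of y z] by simp
  qed
qed

lemma hess_less_step:
  assumes "w \<in> W" "\<beta> \<in> inv_h w" "w \<circ> refl \<beta> = x \<or> hess_less \<Phi> \<Delta> h x (w \<circ> refl \<beta>)"
  shows "hess_less \<Phi> \<Delta> h x w"
proof -
  have "(w \<circ> refl \<beta>, w) \<in> {(u, w). \<exists>\<alpha>. hess_edge \<Phi> \<Delta> h u \<alpha> w}"
    using assms(1,2) unfolding hess_edge_iff by blast
  then show ?thesis using assms(3) unfolding hess_less_def by (auto intro: trancl.intros)
qed

section \<open>The product of the labels at a vertex\<close>

definition euler :: "('a \<Rightarrow> 'a) \<Rightarrow> 'a rpoly" where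
  "euler w = (\<Prod>\<beta>\<in>inv_h w. lf (- w \<beta>))"

lemma in_edges_eq: "w \<in> W \<Longrightarrow> in_edges \<Phi> \<Delta> h w = (\<lambda>\<beta>. (w \<circ> refl \<beta>, - w \<beta>)) ` inv_h w"
  unfolding in_edges_def hess_edge_iff by auto

lemma inj_in_edges: "w \<in> W \<Longrightarrow> inj_on (\<lambda>\<beta>. (w \<circ> refl \<beta>, - w \<beta>)) A"
  by (rule inj_onI) (simp add: inj_eq orthogonal_transformation_inj weyl_orthogonal)

lemma hess_length_eq: "w \<in> W \<Longrightarrow> hess_length \<Phi> \<Delta> h w = card (inv_h w)"
  by (simp add: hess_length_def in_edges_eq card_image inj_in_edges)

lemma prod_in_edges: "w \<in> W \<Longrightarrow> (\<Prod>e\<in>in_edges \<Phi> \<Delta> h w. lf (snd e)) = euler w"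
  by (simp add: in_edges_eq prod.reindex inj_in_edges euler_def)

lemma euler_ring: "in_poly_ring \<Delta> (euler w)"
  unfolding euler_def by (intro in_poly_ring_prod in_poly_ring_root_poly)

lemma neg_inv_h:
  assumes "w \<in> W" "\<beta> \<in> inv_h w"
  shows "- w \<beta> \<in> span \<Delta>" "- w \<beta> \<noteq> 0"
  using assms lf_h_span weyl_pos_nonzero h_positive by (auto simp: inv_h_def intro: span_neg)

lemma euler_homogeneous: "w \<in> W \<Longrightarrow> homogeneous (card (inv_h w)) (euler w)"
  unfolding euler_def using finite_inv_h homogeneous_root_poly neg_inv_h by (intro homogeneous_prod) auto

lemma euler_nonzero: "w \<in> W \<Longrightarrow> euler w \<noteq> 0"
  unfolding euler_def using finite_inv_h neg_inv_h by (intro rpoly_prod_nonzero) (auto simp: root_poly_eq_0_iff)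

lemma lf_dvd_euler: "w \<in> W \<Longrightarrow> \<beta> \<in> inv_h w \<Longrightarrow> lf (w \<beta>) dvd euler w"
proof -
  assume w: "w \<in> W" "\<beta> \<in> inv_h w"
  have "lf (- w \<beta>) dvd euler w" unfolding euler_def using w finite_inv_h by (intro dvd_prodI)
  moreover have "w \<beta> \<in> span \<Delta>" using w lf_h_span by (simp add: inv_h_def)
  ultimately show ?thesis by (simp add: root_poly_minus)
qed

text \<open>Distinct labels are primes that are not associated, since positive roots are pairwise
  non-proportional.\<close>

lemma euler_dvd:
  assumes w: "w \<in> W" and dvd: "\<And>\<beta>. \<beta> \<in> inv_h w \<Longrightarrow> lf (w \<beta>) dvd p"
  shows "euler w dvd p"
  unfolding euler_def
proof (rule prod_dvd_by_classes[where R = "(=)"])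
  fix \<beta> \<gamma> assume \<beta>\<gamma>: "\<beta> \<in> inv_h w" "\<gamma> \<in> inv_h w" "lf (- w \<beta>) dvd lf (- w \<gamma>)"
  then obtain c where "- w \<gamma> = c *\<^sub>R (- w \<beta>)" using root_poly_dvd_root_poly neg_inv_h[OF w] by blast
  then have "w \<gamma> = c *\<^sub>R w \<beta>" by simp
  then show "\<beta> = \<gamma>" using weyl_positive_nonprop[OF w, of \<beta> \<gamma> c] h_positive \<beta>\<gamma> by (auto simp: inv_h_def)
next
  fix \<beta> assume \<beta>: "\<beta> \<in> inv_h w"
  then have "{\<gamma> \<in> inv_h w. \<beta> = \<gamma>} = {\<beta>}" by auto
  moreover have "w \<beta> \<in> span \<Delta>" using w \<beta> lf_h_span by (simp add: inv_h_def)
  then have "lf (- w \<beta>) dvd p" using dvd[OF \<beta>] by (simp add: root_poly_minus)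
  ultimately show "(\<Prod>\<gamma>\<in>{\<gamma> \<in> inv_h w. \<beta> = \<gamma>}. lf (- w \<gamma>)) dvd p" by simp
qed (use finite_inv_h prime_root_poly neg_inv_h[OF w] in \<open>auto intro: identity_equivp\<close>)

text \<open>The plane of two labels at \<open>w\<close> is the image under \<open>w\<close> of a
  plane of roots. There the rank two result applies, since everything below \<open>w\<close> has
  larger \<open>\<psi>\<close>.\<close>

theorem extend_vertex:
  assumes w: "w \<in> W"
    and P: "\<And>z \<beta>. z \<in> W \<Longrightarrow> \<psi> w < \<psi> z \<Longrightarrow> \<beta> \<in> inv_h z \<Longrightarrow> lf (z \<beta>) dvd P z - P (z \<circ> refl \<beta>)"
  shows "\<exists>f. \<forall>\<beta>\<in>inv_h w. lf (w \<beta>) dvd f - P (w \<circ> refl \<beta>)"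
proof -
  \<comment> \<open>Lifting needs residues indexed by linear forms; reflecting on the left in
    \<open>w \<beta>\<close> is reflecting on the right in \<open>\<beta>\<close>.\<close>
  define F where "F \<alpha> = P (refl \<alpha> \<circ> w)" for \<alpha>
  have F: "F (w \<beta>) = P (w \<circ> refl \<beta>)" for \<beta>
    by (simp add: F_def orthogonal_comp_refl[OF weyl_orthogonal[OF w]])
  have hp: "\<beta> \<in> \<Phi>p" if "\<beta> \<in> inv_h w" for \<beta> using that h_positive by (simp add: inv_h_def)
  have "\<exists>f. \<forall>\<delta>\<in>w ` inv_h w. lf \<delta> dvd f - F \<delta>"
  proof (rule lift_from_planes)
    fix \<alpha> \<alpha>' c assume *: "\<alpha> \<in> w ` inv_h w" "\<alpha>' \<in> w ` inv_h w" "\<alpha>' = c *\<^sub>R \<alpha>"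
    then obtain \<beta> \<beta>' where \<beta>: "\<beta> \<in> inv_h w" "\<beta>' \<in> inv_h w" "\<alpha> = w \<beta>" "\<alpha>' = w \<beta>'" by blast
    then have "\<beta> = \<beta>'"
      using weyl_positive_nonprop[OF w hp[OF \<beta>(1)] hp[OF \<beta>(2)], of c] *(3) by auto
    then show "\<alpha> = \<alpha>'" by (simp only: \<beta>)
  next
    fix \<alpha> \<alpha>' assume "\<alpha> \<in> w ` inv_h w" "\<alpha>' \<in> w ` inv_h w" "\<alpha> \<noteq> \<alpha>'"
    then obtain \<beta> \<beta>' where \<beta>: "\<beta> \<in> inv_h w" "\<beta>' \<in> inv_h w" "\<alpha> = w \<beta>" "\<alpha>' = w \<beta>'" "\<beta> \<noteq> \<beta>'" by blast
    define T where "T = \<Phi>p \<inter> span {\<beta>, \<beta>'}"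
    have "extendable T (h \<inter> T) w"
      using extendable_plane[OF _ _ \<beta>(5) w T_def] \<beta>(1,2) by (simp add: inv_h_def)
    moreover have "gkm_below T (h \<inter> T) w P"
      unfolding gkm_below_def
    proof (intro allI impI)
      fix z \<gamma> assume z: "below T w z" "\<gamma> \<in> h \<inter> T" "neg (z \<gamma>)"
      have T: "T \<subseteq> \<Phi>p" by (simp add: T_def)
      show "lf (z \<gamma>) dvd P z - P (z \<circ> refl \<gamma>)"
        using below_weyl[OF z(1) w T] below_psi[OF z(1) w T] z(2,3) by (intro P) (simp_all add: inv_h_def)
    qed
    ultimately obtain f where f: "\<And>\<gamma>. \<gamma> \<in> h \<inter> T \<Longrightarrow> neg (w \<gamma>) \<Longrightarrow> lf (w \<gamma>) dvd f - P (w \<circ> refl \<gamma>)"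
      unfolding extendable_def by blast
    have "lf \<delta> dvd f - F \<delta>" if \<delta>: "\<delta> \<in> w ` inv_h w" "\<delta> \<in> span {\<alpha>, \<alpha>'}" for \<delta>
    proof -
      obtain \<gamma> where \<gamma>: "\<gamma> \<in> inv_h w" "\<delta> = w \<gamma>" using \<delta>(1) by blast
      obtain p q where "\<delta> = p *\<^sub>R \<alpha> + q *\<^sub>R \<alpha>'" using \<delta>(2) unfolding span_pair_iff by blast
      then have "w \<gamma> = w (p *\<^sub>R \<beta> + q *\<^sub>R \<beta>')"
        by (simp only: \<gamma>(2) \<beta>(3,4) linear_add[OF weyl_linear[OF w]] linear_scale[OF weyl_linear[OF w]])
      then have "\<gamma> = p *\<^sub>R \<beta> + q *\<^sub>R \<beta>'"
        by (rule injD[OF orthogonal_transformation_inj[OF weyl_orthogonal[OF w]]])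
      then have "\<gamma> \<in> span {\<beta>, \<beta>'}" unfolding span_pair_iff by blast
      then have "\<gamma> \<in> h \<inter> T" using \<gamma>(1) hp by (simp add: T_def inv_h_def)
      then show ?thesis unfolding \<gamma>(2) F using f \<gamma>(1) by (simp add: inv_h_def)
    qed
    then show "\<exists>f. \<forall>\<delta>\<in>w ` inv_h w \<inter> span {\<alpha>, \<alpha>'}. lf \<delta> dvd f - F \<delta>" by blast
  next
    show "w ` inv_h w \<subseteq> span \<Delta>" using lf_h_span[OF w] unfolding inv_h_def by blast
    show "0 \<notin> w ` inv_h w"
    proof
      assume "0 \<in> w ` inv_h w"
      then obtain \<beta> where "\<beta> \<in> inv_h w" "w \<beta> = 0" by (metis imageE)
      then show False using weyl_pos_nonzero[OF w hp] by blast
    qed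
  qed (use finite_inv_h in simp)
  then show ?thesis by (simp add: F)
qed

text \<open>Both projections, to \<open>R[\<Delta>]\<close> and to degree \<open>d\<close>, fix the
  prescribed values and keep divisibility by the labels.\<close>

lemma extend_vertex_homogeneous:
  assumes w: "w \<in> W"
    and "\<And>z \<beta>. z \<in> W \<Longrightarrow> \<psi> w < \<psi> z \<Longrightarrow> \<beta> \<in> inv_h z \<Longrightarrow> lf (z \<beta>) dvd P z - P (z \<circ> refl \<beta>)"
    and P: "\<And>z. in_poly_ring \<Delta> (P z)" "\<And>z. homogeneous d (P z)"
  shows "\<exists>f. in_poly_ring \<Delta> f \<and> homogeneous d f \<and> (\<forall>\<beta>\<in>inv_h w. lf (w \<beta>) dvd f - P (w \<circ> refl \<beta>))"
proof -
  obtain f where f: "\<And>\<beta>. \<beta> \<in> inv_h w \<Longrightarrow> lf (w \<beta>) dvd f - P (w \<circ> refl \<beta>)"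
    using extend_vertex[OF assms(1,2)] by blast
  define g where "g = hom_comp d (restrict_vars \<Delta> f)"
  have "lf (w \<beta>) dvd g - P (w \<circ> refl \<beta>)" if \<beta>: "\<beta> \<in> inv_h w" for \<beta>
  proof -
    have span: "w \<beta> \<in> span \<Delta>" using \<beta> lf_h_span[OF w] by (simp add: inv_h_def)
    have "restrict_vars \<Delta> (lf (w \<beta>)) dvd restrict_vars \<Delta> (f - P (w \<circ> refl \<beta>))"
      using f[OF \<beta>] by (auto simp: dvd_def restrict_vars_mult)
    then have "lf (w \<beta>) dvd restrict_vars \<Delta> f - P (w \<circ> refl \<beta>)"
      by (simp add: restrict_vars_diff restrict_vars_id in_poly_ring_root_poly P)
    then have "lf (w \<beta>) dvd hom_comp d (restrict_vars \<Delta> f - P (w \<circ> refl \<beta>))"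
      by (rule dvd_hom_comp[OF homogeneous_root_poly[OF span]])
    then show ?thesis by (simp add: g_def hom_comp_diff hom_comp_id P)
  qed
  then show ?thesis
    using homogeneous_hom_comp in_poly_ring_hom_comp[OF in_poly_ring_restrict_vars] unfolding g_def by blast
qed

text \<open>The vertex added last has minimal \<open>\<psi>\<close> in \<open>U\<close>. Edges
  leaving it end outside \<open>U\<close>, so only its incoming edges constrain the new
  value.\<close>

lemma flow_up_on_upper_set:
  assumes x: "x \<in> W" and "U \<subseteq> W" "\<And>z z'. z \<in> U \<Longrightarrow> z' \<in> W \<Longrightarrow> \<psi> z < \<psi> z' \<Longrightarrow> z' \<in> U"
  shows "\<exists>P. (\<forall>z. z \<notin> U \<longrightarrow> P z = 0) \<and> (\<forall>z. in_poly_ring \<Delta> (P z) \<and> homogeneous (card (inv_h x)) (P z)) \<and>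
     (\<forall>z\<in>U. \<forall>\<beta>\<in>inv_h z. lf (z \<beta>) dvd P z - P (z \<circ> refl \<beta>)) \<and>
     (x \<in> U \<longrightarrow> P x = euler x) \<and> (\<forall>z. P z \<noteq> 0 \<longrightarrow> z = x \<or> hess_less \<Phi> \<Delta> h x z)"
  using assms(2,3)
proof (induction "card U" arbitrary: U rule: less_induct)
  case less
  have fin: "finite U" using less.prems(1) finite_weyl finite_subset by blast
  show ?case
  proof (cases "U = {}")
    case True
    then show ?thesis by (intro exI[of _ "\<lambda>_. 0"]) simp
  next
    case False
    have "Min (\<psi> ` U) \<in> \<psi> ` U" using fin False by (intro Min_in) simp_all
    then obtain y where y: "y \<in> U" "\<psi> y = Min (\<psi> ` U)" by (metis imageE)
    then have min: "\<psi> y \<le> \<psi> z" if "z \<in> U" for z using fin that by simp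
    have yW: "y \<in> W" using y less.prems by blast
    define U' where "U' = U - {y}"
    have "card U' < card U" unfolding U'_def using fin y(1) by (rule card_Diff1_less)
    moreover have "U' \<subseteq> W" using less.prems by (auto simp: U'_def)
    moreover have "z' \<in> U'" if "z \<in> U'" "z' \<in> W" "\<psi> z < \<psi> z'" for z z'
      using less.prems(2)[of z z'] min[of z] that by (auto simp: U'_def)
    ultimately obtain P where P0: "\<And>z. z \<notin> U' \<Longrightarrow> P z = 0"
      and Pr: "\<And>z. in_poly_ring \<Delta> (P z)" "\<And>z. homogeneous (card (inv_h x)) (P z)"
      and Pe: "\<And>z \<beta>. z \<in> U' \<Longrightarrow> \<beta> \<in> inv_h z \<Longrightarrow> lf (z \<beta>) dvd P z - P (z \<circ> refl \<beta>)"
      and Px: "x \<in> U' \<Longrightarrow> P x = euler x"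
      and Ps: "\<And>z. P z \<noteq> 0 \<Longrightarrow> z = x \<or> hess_less \<Phi> \<Delta> h x z"
      using less.hyps[of U'] by blast
    have inU': "z \<in> U'" if "z \<in> W" "\<psi> y < \<psi> z" for z
      using less.prems(2)[OF y(1) that] that(2) by (auto simp: U'_def)
    have "\<exists>f. in_poly_ring \<Delta> f \<and> homogeneous (card (inv_h x)) f \<and>
        (\<forall>\<beta>\<in>inv_h y. lf (y \<beta>) dvd f - P (y \<circ> refl \<beta>)) \<and> (y = x \<longrightarrow> f = euler x) \<and>
        (f \<noteq> 0 \<longrightarrow> y = x \<or> hess_less \<Phi> \<Delta> h x y)"
    proof -
      \<comment> \<open>At \<open>x\<close> all sources carry 0, having larger \<open>\<psi>\<close>
        than the support allows. Above \<open>x\<close> the extension theorem applies. Elsewhere 0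
        works, since no source is \<open>x\<close> or above it.\<close>
      consider "y = x" | "y \<noteq> x" "hess_less \<Phi> \<Delta> h x y" | "y \<noteq> x" "\<not> hess_less \<Phi> \<Delta> h x y" by blast
      then show ?thesis
      proof cases
        case 1
        have "P (y \<circ> refl \<beta>) = 0" if "\<beta> \<in> inv_h y" for \<beta>
        proof (rule ccontr)
          assume "P (y \<circ> refl \<beta>) \<noteq> 0"
          then have "\<psi> (y \<circ> refl \<beta>) \<le> \<psi> x" using Ps hess_less_psi by fastforce
          then show False using inv_h_psi[OF yW that] 1 by simp
        qed
        then show ?thesis
          using 1 lf_dvd_euler[OF x] euler_ring euler_homogeneous[OF x] by (intro exI[of _ "euler x"]) auto
      next
        case 2
        have "\<exists>f. in_poly_ring \<Delta> f \<and> homogeneous (card (inv_h x)) f \<and> (\<forall>\<beta>\<in>inv_h y. lf (y \<beta>) dvd f - P (y \<circ> refl \<beta>))"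
          using Pe inU' Pr by (intro extend_vertex_homogeneous[OF yW]) blast+
        then show ?thesis using 2 by blast
      next
        case 3
        have "P (y \<circ> refl \<beta>) = 0" if "\<beta> \<in> inv_h y" for \<beta>
          using Ps[of "y \<circ> refl \<beta>"] hess_less_step[OF yW that, of x] 3 by blast
        then show ?thesis using 3 by (intro exI[of _ 0]) simp
      qed
    qed
    then obtain f where f: "in_poly_ring \<Delta> f" "homogeneous (card (inv_h x)) f"
      "\<And>\<beta>. \<beta> \<in> inv_h y \<Longrightarrow> lf (y \<beta>) dvd f - P (y \<circ> refl \<beta>)" "y = x \<Longrightarrow> f = euler x"
      "f \<noteq> 0 \<Longrightarrow> y = x \<or> hess_less \<Phi> \<Delta> h x y" by blast
    have edge: "lf (z \<beta>) dvd (P(y := f)) z - (P(y := f)) (z \<circ> refl \<beta>)"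
      if z: "z \<in> U" "\<beta> \<in> inv_h z" for z \<beta>
    proof -
      have zW: "z \<in> W" using z(1) less.prems(1) by blast
      have ne: "z \<circ> refl \<beta> \<noteq> y" using inv_h_psi[OF zW z(2)] min[OF z(1)] by auto
      have upd: "(P(y := f)) (z \<circ> refl \<beta>) = P (z \<circ> refl \<beta>)" by (rule fun_upd_other[OF ne])
      show ?thesis
      proof (cases "z = y")
        case True
        show ?thesis using f(3)[of \<beta>] z(2) unfolding upd unfolding True by (simp only: fun_upd_same)
      next
        case False
        then have "z \<in> U'" using z by (simp add: U'_def)
        then show ?thesis unfolding upd fun_upd_other[OF False] using Pe z(2) by blast
      qed
    qed
    show ?thesis
    proof (intro exI[of _ "P(y := f)"] conjI)
      show "\<forall>z. z \<notin> U \<longrightarrow> (P(y := f)) z = 0" using P0 y(1) by (auto simp: U'_def)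
      show "\<forall>z\<in>U. \<forall>\<beta>\<in>inv_h z. lf (z \<beta>) dvd (P(y := f)) z - (P(y := f)) (z \<circ> refl \<beta>)"
        using edge by blast
      show "x \<in> U \<longrightarrow> (P(y := f)) x = euler x" using Px f(4) by (auto simp: U'_def)
    qed (use Pr f Ps in auto)
  qed
qed

theorem flow_up_exists:
  assumes x: "x \<in> W"
  shows "\<exists>P. flow_up \<Phi> \<Delta> h x P"
proof -
  obtain P where P0: "\<And>z. z \<notin> W \<Longrightarrow> P z = 0"
    and Pr: "\<And>z. in_poly_ring \<Delta> (P z)" "\<And>z. homogeneous (card (inv_h x)) (P z)"
    and Pe: "\<And>z \<beta>. z \<in> W \<Longrightarrow> \<beta> \<in> inv_h z \<Longrightarrow> lf (z \<beta>) dvd P z - P (z \<circ> refl \<beta>)"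
    and Px: "P x = euler x" and Ps: "\<And>z. P z \<noteq> 0 \<Longrightarrow> z = x \<or> hess_less \<Phi> \<Delta> h x z"
    using flow_up_on_upper_set[OF x order_refl] x by blast
  have "lf \<alpha> dvd P w - P u" if e: "hess_edge \<Phi> \<Delta> h u \<alpha> w" for u \<alpha> w
  proof -
    obtain \<beta> where w: "w \<in> W" and \<beta>: "\<beta> \<in> inv_h w" "\<alpha> = - w \<beta>" "u = w \<circ> refl \<beta>"
      using e unfolding hess_edge_iff by blast
    have "w \<beta> \<in> span \<Delta>" using lf_h_span[OF w] \<beta>(1) by (simp add: inv_h_def)
    then show ?thesis unfolding \<beta>(2,3) using Pe[OF w \<beta>(1)] by (simp add: root_poly_minus)
  qed
  then have "P \<in> gkm_deg \<Phi> \<Delta> h (hess_length \<Phi> \<Delta> h x)"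
    unfolding gkm_deg_def gkm_ring_def using P0 Pr by (auto simp: hess_length_eq[OF x])
  then have "flow_up \<Phi> \<Delta> h x P"
    unfolding flow_up_def using Px Ps by (simp add: prod_in_edges[OF x])
  then show ?thesis by blast
qed

section \<open>Triangularity and the basis property\<close>

lemma flow_up_diag: "x \<in> W \<Longrightarrow> flow_up \<Phi> \<Delta> h x P \<Longrightarrow> P x = euler x"
  by (simp add: flow_up_def prod_in_edges)

lemma flow_up_support: "flow_up \<Phi> \<Delta> h x P \<Longrightarrow> P y \<noteq> 0 \<Longrightarrow> y = x \<or> \<psi> y < \<psi> x"
  using hess_less_psi by (auto simp: flow_up_def)

lemma flow_up_gkm: "flow_up \<Phi> \<Delta> h x P \<Longrightarrow> P \<in> gkm_ring \<Phi> \<Delta> h"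
  by (simp add: flow_up_def gkm_deg_def)

lemma gkm_ring_edge:
  assumes "P \<in> gkm_ring \<Phi> \<Delta> h" "w \<in> W" "\<beta> \<in> inv_h w"
  shows "lf (w \<beta>) dvd P w - P (w \<circ> refl \<beta>)"
proof -
  have "hess_edge \<Phi> \<Delta> h (w \<circ> refl \<beta>) (- w \<beta>) w" using assms(2,3) unfolding hess_edge_iff by blast
  then have "lf (- w \<beta>) dvd P w - P (w \<circ> refl \<beta>)" using assms(1) unfolding gkm_ring_def by blast
  moreover have "w \<beta> \<in> span \<Delta>" using lf_h_span[OF assms(2)] assms(3) by (simp add: inv_h_def)
  ultimately show ?thesis by (simp add: root_poly_minus)
qed

lemma gkm_ring_diff_smult:
  assumes "P \<in> gkm_ring \<Phi> \<Delta> h" "Q \<in> gkm_ring \<Phi> \<Delta> h" "in_poly_ring \<Delta> g"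
  shows "(\<lambda>w. P w - g * Q w) \<in> gkm_ring \<Phi> \<Delta> h"
proof -
  have "lf \<alpha> dvd (P w - g * Q w) - (P u - g * Q u)" if "hess_edge \<Phi> \<Delta> h u \<alpha> w" for u \<alpha> w
  proof -
    have "lf \<alpha> dvd P w - P u" "lf \<alpha> dvd Q w - Q u"
      using assms(1,2) that unfolding gkm_ring_def by blast+
    then have "lf \<alpha> dvd (P w - P u) - g * (Q w - Q u)" by (intro dvd_diff[OF _ dvd_mult])
    then show ?thesis by (simp add: algebra_simps)
  qed
  moreover have "in_poly_ring \<Delta> (P w - g * Q w)" if "w \<in> W" for w
    using assms that unfolding gkm_ring_def by (intro in_poly_ring_diff in_poly_ring_mult) blast+
  ultimately show ?thesis using assms(1,2) unfolding gkm_ring_def by simp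
qed

text \<open>Division by the diagonal entry at the vertex of largest \<open>\<psi>\<close> in the support.\<close>

lemma flow_up_spans:
  assumes F: "\<And>x. x \<in> W \<Longrightarrow> flow_up \<Phi> \<Delta> h x (F x)"
    and "P \<in> gkm_ring \<Phi> \<Delta> h" "L \<subseteq> W" "\<And>z. z \<in> W - L \<Longrightarrow> P z = 0"
    and "\<And>z z'. z \<in> L \<Longrightarrow> z' \<in> W \<Longrightarrow> \<psi> z' < \<psi> z \<Longrightarrow> z' \<in> L"
  shows "\<exists>c. (\<forall>x. in_poly_ring \<Delta> (c x)) \<and> (\<forall>x. x \<notin> W \<longrightarrow> c x = 0) \<and> P = (\<lambda>y. \<Sum>x\<in>W. c x * F x y)"
  using assms(2-)
proof (induction "card L" arbitrary: L P rule: less_induct)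
  case less
  have fin: "finite L" using less.prems(2) finite_weyl finite_subset by blast
  have P_out: "P z = 0" if "z \<notin> W" for z using less.prems(1) that unfolding gkm_ring_def by blast
  show ?case
  proof (cases "L = {}")
    case True
    then have "P z = 0" for z using less.prems(3) P_out by blast
    then show ?thesis by (intro exI[of _ "\<lambda>_. 0"]) auto
  next
    case False
    have "Max (\<psi> ` L) \<in> \<psi> ` L" using fin False by (intro Max_in) simp_all
    then obtain y where y: "y \<in> L" "\<psi> y = Max (\<psi> ` L)" by (metis imageE)
    then have max: "\<psi> z \<le> \<psi> y" if "z \<in> L" for z using fin that by simp
    have yW: "y \<in> W" using y less.prems by blast
    have "euler y dvd P y"
    proof (rule euler_dvd[OF yW])
      fix \<beta> assume \<beta>: "\<beta> \<in> inv_h y"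
      have "y \<circ> refl \<beta> \<in> W" using inv_h_weyl[OF yW] \<beta> by (simp add: inv_h_def)
      moreover have "y \<circ> refl \<beta> \<notin> L" using inv_h_psi[OF yW \<beta>] max by fastforce
      ultimately have "P (y \<circ> refl \<beta>) = 0" using less.prems(3) by blast
      then show "lf (y \<beta>) dvd P y" using gkm_ring_edge[OF less.prems(1) yW \<beta>] by (simp only: diff_zero)
    qed
    then obtain g0 where g0: "P y = euler y * g0" by (rule dvdE)
    \<comment> \<open>The quotient may involve foreign variables; restriction removes them and keeps
      the equation, whose other two terms lie in \<open>R[\<Delta>]\<close>.\<close>
    define g where "g = restrict_vars \<Delta> g0"
    have g_ring: "in_poly_ring \<Delta> g" unfolding g_def by (rule in_poly_ring_restrict_vars)
    have "in_poly_ring \<Delta> (P y)" using less.prems(1) yW unfolding gkm_ring_def by blast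
    then have g: "P y = euler y * g"
      using restrict_vars_mult[of \<Delta> "euler y" g0] by (simp add: g0[symmetric] restrict_vars_id euler_ring g_def)
    note Fy = F[OF yW]
    define Q where "Q w = P w - g * F y w" for w
    have "\<exists>c. (\<forall>x. in_poly_ring \<Delta> (c x)) \<and> (\<forall>x. x \<notin> W \<longrightarrow> c x = 0) \<and> Q = (\<lambda>y. \<Sum>x\<in>W. c x * F x y)"
    proof (rule less.hyps[of "L - {y}"])
      show "card (L - {y}) < card L" using fin y(1) by (rule card_Diff1_less)
      show "Q \<in> gkm_ring \<Phi> \<Delta> h"
        unfolding Q_def by (rule gkm_ring_diff_smult[OF less.prems(1) flow_up_gkm[OF Fy] g_ring])
      show "L - {y} \<subseteq> W" using less.prems(2) by blast
      show "z' \<in> L - {y}" if "z \<in> L - {y}" "z' \<in> W" "\<psi> z' < \<psi> z" for z z'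
        using less.prems(4)[of z z'] max[of z] that by auto
      show "Q z = 0" if z: "z \<in> W - (L - {y})" for z
      proof (cases "z = y")
        case True
        then show ?thesis using g flow_up_diag[OF yW Fy] by (simp add: Q_def mult.commute)
      next
        case False
        then have "z \<notin> L" using z by blast
        have "F y z = 0"
        proof (rule ccontr)
          assume "F y z \<noteq> 0"
          then have "\<psi> z < \<psi> y" using flow_up_support[OF Fy] False by blast
          then show False using less.prems(4)[OF y(1)] z \<open>z \<notin> L\<close> by blast
        qed
        then show ?thesis using less.prems(3) z \<open>z \<notin> L\<close> by (simp add: Q_def)
      qed
    qed
    then obtain c where c: "\<And>x. in_poly_ring \<Delta> (c x)" "\<And>x. x \<notin> W \<Longrightarrow> c x = 0"
      and Q: "Q = (\<lambda>y. \<Sum>x\<in>W. c x * F x y)" by blast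
    define d where "d x = c x + (if x = y then g else 0)" for x
    have "P z = (\<Sum>x\<in>W. d x * F x z)" for z
    proof -
      have "(\<Sum>x\<in>W. d x * F x z) = (\<Sum>x\<in>W. c x * F x z) + (\<Sum>x\<in>W. if x = y then g * F y z else 0)"
        unfolding sum.distrib[symmetric] by (rule sum.cong) (auto simp: d_def distrib_right)
      also have "\<dots> = Q z + g * F y z" using finite_weyl yW by (simp add: Q)
      finally show ?thesis by (simp add: Q_def)
    qed
    moreover have "in_poly_ring \<Delta> (d x)" for x using c(1) g_ring by (simp add: d_def in_poly_ring_add)
    moreover have "d x = 0" if "x \<notin> W" for x using c(2) that yW by (auto simp: d_def)
    ultimately show ?thesis by (intro exI[of _ d]) auto
  qed
qed

text \<open>In the relation at \<open>x\<close>, another class that is nonzero there belongs to a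
  vertex of larger \<open>\<psi>\<close>, whose coefficient vanishes by induction. The diagonal
  entry can then be cancelled.\<close>

lemma flow_up_independent:
  assumes F: "\<And>x. x \<in> W \<Longrightarrow> flow_up \<Phi> \<Delta> h x (F x)"
    and zero: "\<And>y. (\<Sum>x\<in>W. d x * F x y) = 0" and "x \<in> W"
  shows "d x = 0"
  using assms(3)
proof (induction rule: weyl_psi_induct)
  case (less x)
  have "d z * F z x = 0" if "z \<in> W" "z \<noteq> x" for z
    using flow_up_support[OF F[OF that(1)], of x] less.IH[OF that(1)] that by (cases "F z x = 0") auto
  then have "(\<Sum>z\<in>W. d z * F z x) = (\<Sum>z\<in>W. if z = x then d x * F x x else 0)"
    by (intro sum.cong) auto
  then have "d x * euler x = 0"
    using zero[of x] less.hyps finite_weyl flow_up_diag[OF less.hyps F[OF less.hyps]] by simp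
  then show ?case using rpoly_no_zero_divisors euler_nonzero[OF less.hyps] by blast
qed

theorem flow_up_basis:
  assumes F: "\<And>x. x \<in> W \<Longrightarrow> flow_up \<Phi> \<Delta> h x (F x)" and P: "P \<in> gkm_ring \<Phi> \<Delta> h"
  shows "\<exists>!c. (\<forall>x\<in>W. in_poly_ring \<Delta> (c x)) \<and> (\<forall>x. x \<notin> W \<longrightarrow> c x = 0) \<and> P = (\<lambda>y. \<Sum>x\<in>W. c x * F x y)"
proof (rule ex_ex1I)
  have "P z = 0" if "z \<in> W - W" for z using that by simp
  then obtain c where "\<And>x. in_poly_ring \<Delta> (c x)" "\<And>x. x \<notin> W \<Longrightarrow> c x = 0" "P = (\<lambda>y. \<Sum>x\<in>W. c x * F x y)"
    using flow_up_spans[OF F P order_refl] by blast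
  then show "\<exists>c. (\<forall>x\<in>W. in_poly_ring \<Delta> (c x)) \<and> (\<forall>x. x \<notin> W \<longrightarrow> c x = 0) \<and> P = (\<lambda>y. \<Sum>x\<in>W. c x * F x y)"
    by blast
next
  fix c c'
  assume c: "(\<forall>x\<in>W. in_poly_ring \<Delta> (c x)) \<and> (\<forall>x. x \<notin> W \<longrightarrow> c x = 0) \<and> P = (\<lambda>y. \<Sum>x\<in>W. c x * F x y)"
    and c': "(\<forall>x\<in>W. in_poly_ring \<Delta> (c' x)) \<and> (\<forall>x. x \<notin> W \<longrightarrow> c' x = 0) \<and> P = (\<lambda>y. \<Sum>x\<in>W. c' x * F x y)"
  have zero: "(\<Sum>x\<in>W. (c x - c' x) * F x y) = 0" for y
  proof -
    have "P = (\<lambda>y. \<Sum>x\<in>W. c x * F x y)" "P = (\<lambda>y. \<Sum>x\<in>W. c' x * F x y)"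
      using c c' by blast+
    from fun_cong[OF this(1), of y] fun_cong[OF this(2), of y]
    have "(\<Sum>x\<in>W. c x * F x y) = (\<Sum>x\<in>W. c' x * F x y)" by (rule trans[OF sym])
    then show ?thesis by (simp add: left_diff_distrib sum_subtractf)
  qed
  have "c x - c' x = 0" if "x \<in> W" for x
    by (rule flow_up_independent[where d = "\<lambda>x. c x - c' x", OF F zero that])
  then have "c x = c' x" if "x \<in> W" for x using that by simp
  moreover have "c x = c' x" if "x \<notin> W" for x using c c' that by simp
  ultimately show "c = c'" by blast
qed

end

theorem theorem2p5:
  fixes \<Phi> \<Delta> h :: "'a::euclidean_space set"
  assumes "crystallographic_root_system \<Phi>"
    and "is_base \<Phi> \<Delta>"
    and "hessenberg_set \<Phi> \<Delta> h"
  shows "(\<forall>x\<in>weyl_group \<Delta>. \<exists>P. flow_up \<Phi> \<Delta> h x P) \<and>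
    (\<exists>F. (\<forall>x\<in>weyl_group \<Delta>. flow_up \<Phi> \<Delta> h x (F x)) \<and>
       (\<forall>P\<in>gkm_ring \<Phi> \<Delta> h. \<exists>!c. (\<forall>x\<in>weyl_group \<Delta>. in_poly_ring \<Delta> (c x)) \<and>
            (\<forall>x. x \<notin> weyl_group \<Delta> \<longrightarrow> c x = 0) \<and>
            P = (\<lambda>y. \<Sum>x\<in>weyl_group \<Delta>. c x * F x y)))"
proof -
  interpret hessenberg \<Delta> \<Phi> h
    using assms by unfold_locales (auto simp: is_base_def)
  have ex: "\<forall>x\<in>weyl_group \<Delta>. \<exists>P. flow_up \<Phi> \<Delta> h x P" using flow_up_exists by simp
  from bchoice[OF this] obtain F where F: "\<forall>x\<in>weyl_group \<Delta>. flow_up \<Phi> \<Delta> h x (F x)" ..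
  then have Fx: "flow_up \<Phi> \<Delta> h x (F x)" if "x \<in> weyl_group \<Delta>" for x using that by simp
  show ?thesis
    by (intro conjI exI[of _ F] ballI flow_up_basis[OF Fx]) (use ex F in simp_all)
qed

end
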